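(* Let $k$ be an algebraically closed field, $\mathcal Q=k(T)$, $\mathcal Z=k[T]$, and let $K$ be a finite separable extension of $\mathcal Q$ of degree $n$, with $\mathcal O_K$ the integral closure of $\mathcal Z$ in $K$. Suppose that $K/\mathcal Q$ is tamely ramified above $\infty$ (the place of $\mathcal Q$ with uniformizer $T^{-1}$). Then \[M(K)\leq\deg(d_K)-n.\]
   Context: $d_K$ is the discriminant of $\mathcal O_K$ over $\mathcal Z$, an ideal of $\mathcal Z$ generated by a polynomial $f$, and $\deg(d_K)=\deg(f)$. On $\mathcal Q$, $\deg$ is the degree at infinity: $\deg(a/b)=\deg(a)-\deg(b)$ for polynomials $a,b\neq0$, and $\deg(0)=-\infty$. The Euclidean minimum is \[M(K)=\max_{x\in K}\min_{y\in\mathcal O_K}\deg\big(N_{K/\mathcal Q}(x-y)\big).\] *)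

theory Defs
  imports
    "HOL-Library.Extended_Real"
    "HOL-Computational_Algebra.Computational_Algebra"
    "Jordan_Normal_Form.Determinant"
begin

section \<open>Finite extensions of fields: norm, trace, discriminant\<close>

text \<open>
  A field extension \<open>L/F\<close> is given by a field homomorphism \<open>emb\<close> from \<open>F\<close> to \<open>L\<close>; this makes
  \<open>L\<close> a vector space over \<open>F\<close>.
\<close>

locale field_extension = field_hom emb
  for emb :: "'f::field \<Rightarrow> 'l::field"
begin

sublocale vector_space "\<lambda>a x. emb a * x"
  by unfold_locales (simp_all only: hom_add hom_mult hom_one ring_distribs mult.assoc mult_1_left)

definition finite_extension :: bool where
  "finite_extension \<longleftrightarrow> (\<exists>B. finite B \<and> span B = UNIV)"

definition ext_degree :: nat where
  "ext_degree = dim UNIV"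

text \<open>
  An irreducible polynomial vanishing at \<open>x\<close> is, up to a constant factor, the minimal polynomial
  of \<open>x\<close>; it is separable iff it is coprime to its derivative.
\<close>

definition separable_extension :: bool where
  "separable_extension \<longleftrightarrow>
     (\<forall>x. \<exists>p. irreducible p \<and> poly (map_poly emb p) x = 0 \<and> coprime p (pderiv p))"

definition basis_list :: "'l list \<Rightarrow> bool" where
  "basis_list bs \<longleftrightarrow> distinct bs \<and> independent (set bs) \<and> span (set bs) = UNIV"

text \<open>The matrix of multiplication by \<open>x\<close> with respect to the basis \<open>bs\<close>.\<close>

definition mult_mat :: "'l list \<Rightarrow> 'l \<Rightarrow> 'f mat" where
  "mult_mat bs x =
     mat (length bs) (length bs) (\<lambda>(i, j). representation (set bs) (x * bs ! j) (bs ! i))"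

text \<open>
  Determinant and trace of multiplication by \<open>x\<close>. They do not depend on the basis, so an
  arbitrary one is chosen.
\<close>

definition ext_norm :: "'l \<Rightarrow> 'f" where
  "ext_norm x = det (mult_mat (SOME bs. basis_list bs) x)"

definition ext_trace :: "'l \<Rightarrow> 'f" where
  "ext_trace x =
     (let A = mult_mat (SOME bs. basis_list bs) x in \<Sum>i<dim_row A. A $$ (i, i))"

definition tuple_disc :: "'l list \<Rightarrow> 'f" where
  "tuple_disc xs =
     det (mat (length xs) (length xs) (\<lambda>(i, j). ext_trace (xs ! i * xs ! j)))"

end


section \<open>Degree on the rational function field\<close>

text \<open>
  \<open>-fract_degree\<close> is the normalized valuation at infinity on nonzero elements; the value at 0 is
  only given its correct meaning in \<open>deg_infinity\<close>.
\<close>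

definition fract_degree :: "'a::field poly fract \<Rightarrow> int" where
  "fract_degree q =
     (THE d. \<exists>a b. a \<noteq> 0 \<and> b \<noteq> 0 \<and> q = Fract a b \<and> d = int (degree a) - int (degree b))"

lemma fract_degree_Fract:
  assumes "a \<noteq> 0" "b \<noteq> 0"
  shows "fract_degree (Fract a b) = int (degree a) - int (degree b)"
  unfolding fract_degree_def
proof (rule the_equality)
  show "\<exists>a' b'. a' \<noteq> 0 \<and> b' \<noteq> 0 \<and> Fract a b = Fract a' b' \<and>
          int (degree a) - int (degree b) = int (degree a') - int (degree b')"
    using assms by blast
next
  fix d
  assume "\<exists>a' b'. a' \<noteq> 0 \<and> b' \<noteq> 0 \<and> Fract a b = Fract a' b' \<and>
            d = int (degree a') - int (degree b')"
  then obtain a' b' where nz: "a' \<noteq> 0" "b' \<noteq> 0" and eq: "a * b' = a' * b"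
    and d: "d = int (degree a') - int (degree b')"
    using assms by (auto simp: eq_fract)
  have "degree a + degree b' = degree a' + degree b"
    using arg_cong[OF eq, of degree] assms nz by (simp add: degree_mult_eq)
  then show "d = int (degree a) - int (degree b)"
    using d by simp
qed

definition deg_infinity :: "'a::field poly fract \<Rightarrow> ereal" where
  "deg_infinity q = (if q = 0 then -\<infinity> else ereal (of_int (fract_degree q)))"


section \<open>Ideals of the polynomial ring\<close>

definition ideal_generated :: "'r::comm_ring_1 set \<Rightarrow> 'r set" where
  "ideal_generated S = Modules.module.span (*) S"

lemma ideal_generated_singleton: "ideal_generated {f} = {g. f dvd g}"
proof -
  have "Modules.module ((*) :: 'a \<Rightarrow> 'a \<Rightarrow> 'a)"
    by (rule Modules.module.intro) (simp_all only: distrib_left distrib_right mult.assoc mult_1_left)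
  then have "ideal_generated {f} = range (\<lambda>k. k * f)"
    unfolding ideal_generated_def by (rule Modules.module.span_singleton)
  also have "\<dots> = {g. f dvd g}"
  proof (rule Set.set_eqI)
    fix g
    have "g \<in> range (\<lambda>k. k * f) \<longleftrightarrow> (\<exists>k. g = k * f)"
      by (rule image_iff[THEN trans]) simp
    also have "\<dots> \<longleftrightarrow> f dvd g"
      unfolding dvd_def by (subst mult.commute[of f]) (rule refl)
    finally show "g \<in> range (\<lambda>k. k * f) \<longleftrightarrow> g \<in> {g. f dvd g}"
      by simp
  qed
  finally show ?thesis .
qed

text \<open>Every ideal of \<open>k[T]\<close> is principal, and generators are unique up to units.\<close>

definition ideal_degree :: "'a::field poly set \<Rightarrow> nat" where
  "ideal_degree I = degree (SOME f. I = ideal_generated {f})"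

lemma ideal_degree_principal: "ideal_degree (ideal_generated {f}) = degree f"
proof -
  define g where "g = (SOME g. ideal_generated {f} = ideal_generated {g})"
  have "ideal_generated {f} = ideal_generated {g}"
    unfolding g_def by (rule someI[of _ f]) simp
  then have *: "{h. f dvd h} = {h. g dvd h}"
    unfolding ideal_generated_singleton .
  have dvd: "f dvd g" "g dvd f"
    using * dvd_refl[of f] dvd_refl[of g] by blast+
  have "degree f = degree g"
  proof (cases "f = 0 \<or> g = 0")
    case True
    with dvd have "f = g" by (metis dvd_0_left)
    then show ?thesis by (rule arg_cong)
  next
    case False
    with dvd show ?thesis by (metis dvd_imp_degree_le le_antisym)
  qed
  then show ?thesis
    unfolding ideal_degree_def g_def by (rule sym)
qed


section \<open>Places and tame ramification\<close>

text \<open>Valuations are normalized; the value at 0 (conventionally infinity) is irrelevant.\<close>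

definition discrete_valuation :: "('l::field \<Rightarrow> int) \<Rightarrow> bool" where
  "discrete_valuation w \<longleftrightarrow>
     (\<forall>x y. x \<noteq> 0 \<longrightarrow> y \<noteq> 0 \<longrightarrow> w (x * y) = w x + w y) \<and>
     (\<forall>x y. x \<noteq> 0 \<longrightarrow> y \<noteq> 0 \<longrightarrow> x + y \<noteq> 0 \<longrightarrow> min (w x) (w y) \<le> w (x + y)) \<and>
     w ` (UNIV - {0}) = UNIV"

locale function_field = field_extension emb
  for emb :: "'k::field poly fract \<Rightarrow> 'l::field"
begin

text \<open>\<open>w\<close> is a place above infinity with ramification index \<open>e\<close>.\<close>

definition place_above_infinity :: "('l \<Rightarrow> int) \<Rightarrow> nat \<Rightarrow> bool" where
  "place_above_infinity w e \<longleftrightarrow>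
     discrete_valuation w \<and> e > 0 \<and> (\<forall>q. q \<noteq> 0 \<longrightarrow> w (emb q) = int e * (- fract_degree q))"

text \<open>
  The residue field at infinity is \<open>'k\<close>; when it is perfect, in particular when it is algebraically
  closed, residue extensions are automatically separable, so that tameness only
  concerns the ramification indices. In characteristic 0 the condition holds because \<open>e > 0\<close>.
\<close>

definition tame_above_infinity :: bool where
  "tame_above_infinity \<longleftrightarrow> (\<forall>w e. place_above_infinity w e \<longrightarrow> \<not> CHAR('k) dvd e)"


section \<open>Ring of integers, discriminant and Euclidean minimum\<close>

definition ring_of_integers :: "'l set" where
  "ring_of_integers =
     {x. \<exists>p :: 'k poly poly. lead_coeff p = 1 \<and> poly (map_poly (\<lambda>a. emb (to_fract a)) p) x = 0}"

text \<open>
  The ideal of \<open>k[T]\<close> generated by the discriminants of all \<open>n\<close>-tuples of integers, \<open>n\<close> being the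
  degree of the extension; it is generated by the discriminant of any integral basis.
\<close>

definition disc_ideal :: "'k poly set" where
  "disc_ideal =
     ideal_generated {d. \<exists>xs. length xs = ext_degree \<and> set xs \<subseteq> ring_of_integers \<and>
                              to_fract d = tuple_disc xs}"

text \<open>
  The values of \<open>deg_infinity\<close> are integers or \<open>-\<infinity>\<close>, and \<open>deg_infinity (ext_norm (x - y))\<close>
  is bounded below over all integers \<open>y\<close> when \<open>x\<close> is not itself integral; so the infimum is a
  minimum, and the supremum is a maximum as soon as it is finite.
\<close>

definition euclidean_minimum :: ereal where
  "euclidean_minimum = (SUP x. INF y\<in>ring_of_integers. deg_infinity (ext_norm (x - y)))"

end

end

theory Submission
  imports Defs "Jordan_Normal_Form.Char_Poly"
begin

text \<open>
  Let \<open>R\<close> be the ring of elements of \<open>K\<close> that are integral at all places above infinity and \<open>N\<close> the norm.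
  The places are found by Chevalley's extension theorem, and the approximation theorem shows that \<open>R\<close>
  is free of rank \<open>n\<close> over the valuation ring at infinity and that some \<open>g\<close> has
  \<open>deg (N g) = deg d_K - n\<close>; here \<open>k\<close> being algebraically closed makes all residue degrees 1.
  By reduction theory the ring of integers has a basis \<open>y\<^sub>1, \<dots>, y\<^sub>n\<close> over \<open>k[T]\<close> which is orthogonal for
  the norm with unit ball \<open>g R\<close>: an element \<open>\<Sum> q\<^sub>i y\<^sub>i\<close> lies in \<open>g R\<close> iff \<open>deg q\<^sub>i \<le> - a\<^sub>i\<close> for all \<open>i\<close>.
  If all \<open>a\<^sub>i \<le> 1\<close>, subtracting the polynomial parts of the coordinates brings every \<open>x\<close> into \<open>g R\<close>,
  where norms have degree at most \<open>deg d_K - n\<close>.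
  If some \<open>a\<^sub>i \<ge> 2\<close>, the element \<open>z\<close> of the trace-dual basis belonging to \<open>y\<^sub>i\<close> satisfies
  \<open>deg (Tr (T z g r)) < 0\<close> for all \<open>r \<in> R\<close>. By tameness \<open>T z g\<close> then lies in the radical of \<open>R\<close>, so that
  \<open>deg (N (T z g)) < 0\<close>, that is \<open>deg (N z) < - deg d_K\<close>. This is impossible, because \<open>z\<close> lies in the
  inverse different and hence \<open>N z * d_K\<close> is a nonzero polynomial.
\<close>

section \<open>The degree at infinity\<close>

text \<open>The exponent \<open>deg d_K - n\<close> comes from two opposite demands on
  \<open>g\<close>. The final bound is \<open>deg (N g)\<close>, which should be small; but a bad
  index gives \<open>n + deg (N z) + deg (N g)\<close> at most -1, while duality gives
  \<open>deg (N z) + deg d_K\<close> at least 0, and these collide exactly when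
  \<open>deg (N g)\<close> is at least \<open>deg d_K - n\<close>. The threshold 1 for the
  \<open>a_i\<close> is the quality of approximation in \<open>k(T)\<close>: removing polynomial
  parts leaves remainders of degree at most -1. The main obstacle is the freeness of
  \<open>R\<close> with rank \<open>n\<close>, that is, the identity \<open>sum e_w = n\<close>. One
  inequality is a direct valuation argument. For the other one, successive expansion in a local
  basis yields only better and better approximations, and some finiteness must exclude elements
  outside the span. It is supplied by reduction theory, applied first with \<open>g = 1\<close>: a
  reduced basis bounds the coordinates of all elements of \<open>R\<close>.\<close>

definition deg_le :: "'a::field poly fract \<Rightarrow> int \<Rightarrow> bool" where
  "deg_le q d \<longleftrightarrow> q = 0 \<or> fract_degree q \<le> d"

definition fract_T :: "'a::field poly fract" where
  "fract_T = to_fract [:0, 1:]"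

definition fract_const :: "'a::field \<Rightarrow> 'a poly fract" where
  "fract_const c = to_fract [:c:]"

lemma fract_cases:
  obtains (zero) "q = 0" | (nonzero) a b :: "'a::field poly" where "a \<noteq> 0" "b \<noteq> 0" "q = Fract a b"
    "fract_degree q = int (degree a) - int (degree b)"
proof (cases q)
  case (Fract a b)
  show ?thesis
  proof (cases "a = 0")
    case True
    with Fract have "q = 0" by (simp add: Zero_fract_def eq_fract)
    then show ?thesis by (rule zero)
  next
    case False
    with Fract show ?thesis
      by (intro nonzero[of a b]) (simp_all add: fract_degree_Fract)
  qed
qed

lemma fract_degree_to_fract [simp]: "p \<noteq> 0 \<Longrightarrow> fract_degree (to_fract p) = int (degree p)"
  unfolding to_fract_def by (subst fract_degree_Fract) auto

lemma fract_degree_mult: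
  assumes "p \<noteq> 0" "q \<noteq> 0"
  shows "fract_degree (p * q) = fract_degree p + fract_degree q"
proof (cases p rule: fract_cases)
  case (nonzero a b)
  note p = nonzero
  show ?thesis
  proof (cases q rule: fract_cases)
    case (nonzero c d)
    with p show ?thesis by (simp add: fract_degree_Fract degree_mult_eq)
  qed (use assms in simp)
qed (use assms in simp)

lemma fract_degree_1 [simp]: "fract_degree 1 = 0"
  using fract_degree_to_fract[of 1] by simp

lemma fract_degree_inverse: "q \<noteq> 0 \<Longrightarrow> fract_degree (inverse q) = - fract_degree q"
  using fract_degree_mult[of q "inverse q"] by simp

lemma fract_degree_divide:
  "p \<noteq> 0 \<Longrightarrow> q \<noteq> 0 \<Longrightarrow> fract_degree (p / q) = fract_degree p - fract_degree q"
  by (simp add: divide_inverse fract_degree_mult fract_degree_inverse)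

lemma fract_degree_power: "q \<noteq> 0 \<Longrightarrow> fract_degree (q ^ m) = int m * fract_degree q"
  by (induction m) (simp_all add: fract_degree_mult algebra_simps)

lemma fract_T_nonzero [simp]: "fract_T \<noteq> 0"
  by (simp add: fract_T_def)

lemma fract_degree_T [simp]: "fract_degree fract_T = 1"
  by (simp add: fract_T_def)

lemma fract_degree_T_powi [simp]: "fract_degree (fract_T powi s) = s"
  by (auto simp: power_int_def fract_degree_power fract_degree_inverse)

lemma fract_const_0 [simp]: "fract_const 0 = 0"
  and fract_const_1 [simp]: "fract_const 1 = 1"
  and fract_const_eq_0_iff [simp]: "fract_const c = 0 \<longleftrightarrow> c = 0"
  and fract_const_add: "fract_const (c + d) = fract_const c + fract_const d"
  and fract_const_mult: "fract_const (c * d) = fract_const c * fract_const d"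
  by (simp_all add: fract_const_def flip: to_fract_add to_fract_mult one_pCons)

lemma fract_const_minus: "fract_const (- c) = - fract_const c"
  using fract_const_add[of c "- c"] by (simp add: eq_neg_iff_add_eq_0 add.commute)

lemma fract_degree_const [simp]: "c \<noteq> 0 \<Longrightarrow> fract_degree (fract_const c) = 0"
  by (simp add: fract_const_def)

lemma deg_le_0 [simp]: "deg_le 0 d"
  by (simp add: deg_le_def)

lemma deg_le_mono: "deg_le q d \<Longrightarrow> d \<le> d' \<Longrightarrow> deg_le q d'"
  by (auto simp: deg_le_def)

lemma deg_le_mult: "deg_le p c \<Longrightarrow> deg_le q d \<Longrightarrow> deg_le (p * q) (c + d)"
  by (cases "p = 0"; cases "q = 0") (auto simp: deg_le_def fract_degree_mult)

lemma deg_le_add: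
  assumes "deg_le p d" "deg_le q d"
  shows "deg_le (p + q) d"
proof (cases p rule: fract_cases)
  case (nonzero a b)
  note p = nonzero
  show ?thesis
  proof (cases q rule: fract_cases)
    case (nonzero a' b')
    have eq: "p + q = Fract (a * b' + a' * b) (b * b')"
      using p nonzero by simp
    show ?thesis
    proof (cases "a * b' + a' * b = 0")
      case True
      then show ?thesis by (simp add: eq deg_le_def Zero_fract_def eq_fract)
    next
      case False
      have "p \<noteq> 0" "q \<noteq> 0"
        using p nonzero by (simp_all add: Zero_fract_def eq_fract)
      with assms p nonzero have "int (degree a) - int (degree b) \<le> d" "int (degree a') - int (degree b') \<le> d"
        by (simp_all add: deg_le_def)
      moreover have "degree (a * b' + a' * b) \<le> max (degree (a * b')) (degree (a' * b))"
        by (rule degree_add_le_max)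
      ultimately have "int (degree (a * b' + a' * b)) \<le> d + int (degree (b * b'))"
        using p nonzero by (simp add: degree_mult_eq max_def split: if_splits)
      with False show ?thesis
        using p nonzero by (simp add: eq deg_le_def fract_degree_Fract)
    qed
  qed (use assms in simp)
qed (use assms in simp)

lemma deg_le_minus_iff [simp]: "deg_le (- q) d \<longleftrightarrow> deg_le q d"
proof (cases "q = 0")
  case False
  have "- q = fract_const (-1) * q"
    by (simp add: fract_const_minus)
  with False have "fract_degree (- q) = fract_degree q"
    using fract_degree_mult[of "fract_const (-1)" q] by simp
  with False show ?thesis by (simp add: deg_le_def)
qed simp

lemma deg_le_diff: "deg_le p d \<Longrightarrow> deg_le q d \<Longrightarrow> deg_le (p - q) d"
  using deg_le_add[of p d "- q"] by simp

lemma deg_le_sum: "(\<And>i. i \<in> A \<Longrightarrow> deg_le (f i) d) \<Longrightarrow> deg_le (sum f A) d"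
  by (induction A rule: infinite_finite_induct) (simp_all add: deg_le_add)

lemma deg_le_prod: "(\<And>i. i \<in> A \<Longrightarrow> deg_le (f i) (d i)) \<Longrightarrow> deg_le (prod f A) (sum d A)"
  by (induction A rule: infinite_finite_induct) (simp_all add: deg_le_mult, simp_all add: deg_le_def)

lemma deg_le_1 [simp]: "deg_le 1 0"
  by (simp add: deg_le_def)

lemma deg_le_T_powi [simp]: "deg_le (fract_T powi s) s"
  by (simp add: deg_le_def)

lemma deg_le_T_powi_mult_iff: "deg_le (fract_T powi s * q) d \<longleftrightarrow> deg_le q (d - s)"
  by (cases "q = 0") (auto simp: deg_le_def fract_degree_mult)

lemma ex_deg_le: "\<exists>d. deg_le q d"
  by (auto simp: deg_le_def)

lemma ex_deg_le_finite:
  assumes "finite A"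
  shows "\<exists>d. \<forall>i\<in>A. deg_le (f i) d"
  using assms
proof induction
  case (insert a A)
  then obtain d where d: "\<forall>i\<in>A. deg_le (f i) d" by blast
  obtain c where "deg_le (f a) c" using ex_deg_le by blast
  with d have "\<forall>i\<in>insert a A. deg_le (f i) (max c d)"
    by (auto intro: deg_le_mono)
  then show ?case by blast
qed simp

text \<open>Euclidean division of the numerator by the denominator. The -1 is the covering radius of
  \<open>k[T]\<close> in \<open>k(T)\<close>; it decides which values of \<open>a i\<close> still
  allow rounding of coordinates.\<close>

lemma ex_poly_part: "\<exists>p. deg_le (q - to_fract p) (-1)"
proof (cases q rule: fract_cases)
  case zero
  then show ?thesis by (intro exI[of _ 0]) simp
next
  case (nonzero a b)
  have "q - to_fract (a div b) = Fract (a - a div b * b) b"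
    using nonzero by (simp add: to_fract_def)
  also have "a - a div b * b = a mod b"
    by (simp add: minus_div_mult_eq_mod)
  finally have eq: "q - to_fract (a div b) = Fract (a mod b) b" .
  have "deg_le (q - to_fract (a div b)) (-1)"
  proof (cases "a mod b = 0")
    case True
    then show ?thesis unfolding eq by (simp add: deg_le_def Zero_fract_def eq_fract)
  next
    case False
    then show ?thesis unfolding eq
      using nonzero degree_mod_less[of b a] by (simp add: deg_le_def fract_degree_Fract)
  qed
  then show ?thesis by blast
qed

text \<open>The residue field at infinity is \<open>k\<close>: the polynomial part of an element of
  degree at most 0 must be constant.\<close>

lemma ex_leading_const:
  assumes "deg_le q 0"
  shows "\<exists>c. deg_le (q - fract_const c) (-1)"
proof -
  obtain p where p: "deg_le (q - to_fract p) (-1)" using ex_poly_part by blast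
  then have "deg_le (q - (q - to_fract p)) 0"
    using assms by (intro deg_le_diff deg_le_mono[OF p]) auto
  then have "degree p = 0"
    by (cases "p = 0") (auto simp: deg_le_def)
  then obtain c where "p = [:c:]" by (metis degree_0_id)
  with p show ?thesis by (auto simp: fract_const_def)
qed

lemma ex_leading_term:
  assumes "q \<noteq> 0"
  shows "\<exists>c. c \<noteq> 0 \<and> deg_le (q - fract_const c * fract_T powi fract_degree q) (fract_degree q - 1)"
proof -
  define s where "s = fract_degree q"
  define q' where "q' = fract_T powi (- s) * q"
  have q: "q = fract_T powi s * q'"
    by (simp add: q'_def power_int_minus field_simps)
  have "deg_le q' 0"
    by (simp add: q'_def deg_le_T_powi_mult_iff s_def) (simp add: deg_le_def)
  then obtain c where c: "deg_le (q' - fract_const c) (-1)"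
    using ex_leading_const by blast
  have "c \<noteq> 0"
  proof
    assume "c = 0"
    with c have "deg_le q (s - 1)" 
      by (simp add: q deg_le_T_powi_mult_iff)
    with assms show False by (simp add: deg_le_def s_def)
  qed
  moreover have "q - fract_const c * fract_T powi s = fract_T powi s * (q' - fract_const c)"
    by (simp add: q algebra_simps)
  with c have "deg_le (q - fract_const c * fract_T powi s) (s - 1)"
    by (simp add: deg_le_T_powi_mult_iff)
  ultimately show ?thesis unfolding s_def by blast
qed

text \<open>Every Leibniz term takes one entry from each column, so bounds for the columns add up.
  Separate bounds for the columns are what is needed when a single basis element has a smaller image
  than the others.\<close>

lemma deg_le_det:
  assumes "A \<in> carrier_mat n n" "\<And>i j. i < n \<Longrightarrow> j < n \<Longrightarrow> deg_le (A $$ (i, j)) (d j)"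
  shows "deg_le (det A) (\<Sum>j<n. d j)"
proof -
  have "deg_le (signof p * (\<Prod>i = 0..<n. A $$ (i, p i))) (\<Sum>j<n. d j)" if "p permutes {0..<n}" for p
  proof -
    have "deg_le (\<Prod>i = 0..<n. A $$ (i, p i)) (\<Sum>i = 0..<n. d (p i))"
      using assms(2) permutes_in_image[OF that] by (intro deg_le_prod) auto
    also have "(\<Sum>i = 0..<n. d (p i)) = (\<Sum>j<n. d j)"
      using sum.permute[OF that, of d] by (simp add: o_def atLeast0LessThan)
    finally show ?thesis
      by (cases rule: sign_cases[of p]) auto
  qed
  then show ?thesis
    unfolding det_def'[OF assms(1)] by (intro deg_le_sum) auto
qed

section \<open>Bases, norm and trace\<close>

lemma trace_mat_mult_commute:
  fixes A B :: "'a::comm_ring_1 mat"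
  assumes "A \<in> carrier_mat n n" "B \<in> carrier_mat n n"
  shows "(\<Sum>i<n. (A * B) $$ (i, i)) = (\<Sum>i<n. (B * A) $$ (i, i))"
proof -
  have "(\<Sum>i<n. (A * B) $$ (i, i)) = (\<Sum>i<n. \<Sum>k<n. A $$ (i, k) * B $$ (k, i))"
    using assms by (intro sum.cong) (auto simp: scalar_prod_def atLeast0LessThan)
  also have "\<dots> = (\<Sum>k<n. \<Sum>i<n. B $$ (k, i) * A $$ (i, k))"
    by (subst sum.swap) (simp add: mult.commute)
  also have "\<dots> = (\<Sum>i<n. (B * A) $$ (i, i))"
    using assms by (intro sum.cong) (auto simp: scalar_prod_def atLeast0LessThan)
  finally show ?thesis .
qed

locale finite_field_extension = field_extension emb
  for emb :: "'f::field \<Rightarrow> 'l::field" +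
  assumes finite_ext: finite_extension
begin

declare scale_scale [simp del]

section \<open>Coordinates with respect to ordered bases\<close>

definition lin_comb :: "'l list \<Rightarrow> (nat \<Rightarrow> 'f) \<Rightarrow> 'l" where
  "lin_comb bs f = (\<Sum>i<length bs. emb (f i) * bs ! i)"

definition coord :: "'l list \<Rightarrow> 'l \<Rightarrow> nat \<Rightarrow> 'f" where
  "coord bs x i = representation (set bs) x (bs ! i)"

lemma finite_dimensional: "\<exists>B. finite_dimensional_vector_space (\<lambda>a x. emb a * x) B"
proof -
  obtain C where C: "finite C" "span C = UNIV"
    using finite_ext unfolding finite_extension_def by blast
  obtain B where B: "B \<subseteq> C" "independent B" "C \<subseteq> span B"
    using maximal_independent_subset by blast
  have "span B = UNIV"
    using B(3) C(2) span_mono[of C "span B"] by (auto simp: span_span)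
  with B C show ?thesis
    by (intro exI[of _ B]) (unfold_locales, auto dest: finite_subset)
qed

lemma independent_card_le:
  assumes "independent B"
  shows "finite B \<and> card B \<le> ext_degree"
proof -
  obtain B0 where "finite_dimensional_vector_space (\<lambda>a x. emb a * x) B0"
    using finite_dimensional by blast
  then interpret fd: finite_dimensional_vector_space "\<lambda>a x. emb a * x" B0 .
  show ?thesis
    using fd.independent_card_le_dim[OF _ assms, of UNIV] fd.finiteI_independent[OF assms]
    by (simp add: ext_degree_def)
qed

lemma independent_span_UNIV:
  assumes "independent B" "ext_degree \<le> card B"
  shows "span B = UNIV"
proof -
  obtain B0 where "finite_dimensional_vector_space (\<lambda>a x. emb a * x) B0"
    using finite_dimensional by blast
  then interpret fd: finite_dimensional_vector_space "\<lambda>a x. emb a * x" B0 .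
  show ?thesis
    using fd.card_ge_dim_independent[of B UNIV] assms by (auto simp: ext_degree_def)
qed

lemma ex_basis_list: "\<exists>bs. basis_list bs"
proof -
  obtain B where B: "independent B" "UNIV \<subseteq> span B"
    using basis_exists[of UNIV] by metis
  then obtain bs where "set bs = B" "distinct bs"
    using independent_card_le finite_distinct_list by blast
  with B show ?thesis
    unfolding basis_list_def by (intro exI[of _ bs]) auto
qed

lemma length_basis_list: "basis_list bs \<Longrightarrow> length bs = ext_degree"
  unfolding basis_list_def ext_degree_def
  using basis_card_eq_dim[of "set bs" UNIV] by (simp add: distinct_card)

lemma ext_degree_pos: "ext_degree > 0"
proof (rule ccontr)
  assume "\<not> ext_degree > 0"
  moreover obtain bs where bs: "basis_list bs" using ex_basis_list by blast
  ultimately have "bs = []" using length_basis_list[OF bs] by simp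
  then have "(1::'l) \<in> span {}" using bs by (simp add: basis_list_def)
  then show False by (simp add: span_empty)
qed

lemma sum_set_basis:
  assumes "distinct bs"
  shows "(\<Sum>b\<in>set bs. h b) = (\<Sum>i<length bs. h (bs ! i))"
  using sum.reindex_bij_betw[OF bij_betw_nth[OF assms refl refl], of h] by simp

lemma lin_comb_coord:
  assumes "basis_list bs"
  shows "lin_comb bs (coord bs x) = x"
proof -
  have "(\<Sum>b\<in>set bs. emb (representation (set bs) x b) * b) = x"
    using assms by (intro sum_representation_eq) (auto simp: basis_list_def)
  then show ?thesis
    using assms by (simp add: lin_comb_def coord_def basis_list_def sum_set_basis)
qed

lemma coord_add: "basis_list bs \<Longrightarrow> coord bs (x + y) i = coord bs x i + coord bs y i"
  by (simp add: coord_def representation_add basis_list_def)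

lemma coord_scale: "basis_list bs \<Longrightarrow> coord bs (emb c * x) i = c * coord bs x i"
  by (simp add: coord_def representation_scale basis_list_def)

lemma coord_0: "coord bs 0 i = 0"
  by (simp add: coord_def representation_zero)

lemma coord_diff: "basis_list bs \<Longrightarrow> coord bs (x - y) i = coord bs x i - coord bs y i"
  by (simp add: coord_def representation_diff basis_list_def)

lemma coord_sum: "basis_list bs \<Longrightarrow> coord bs (sum h A) i = (\<Sum>a\<in>A. coord bs (h a) i)"
  by (induction A rule: infinite_finite_induct) (simp_all add: coord_0 coord_add)

lemma coord_nth:
  "basis_list bs \<Longrightarrow> i < length bs \<Longrightarrow> j < length bs \<Longrightarrow> coord bs (bs ! j) i = (if i = j then 1 else 0)"
  by (auto simp: coord_def representation_basis basis_list_def nth_eq_iff_index_eq)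

lemma coord_lin_comb: "basis_list bs \<Longrightarrow> i < length bs \<Longrightarrow> coord bs (lin_comb bs f) i = f i"
  by (simp add: lin_comb_def coord_sum coord_scale coord_nth if_distrib cong: if_cong)

lemma lin_comb_add: "lin_comb bs (\<lambda>i. f i + g i) = lin_comb bs f + lin_comb bs g"
  by (simp add: lin_comb_def hom_add ring_distribs sum.distrib)

lemma lin_comb_diff: "lin_comb bs (\<lambda>i. f i - g i) = lin_comb bs f - lin_comb bs g"
  by (simp add: lin_comb_def hom_minus ring_distribs sum_subtractf)

lemma lin_comb_scale: "lin_comb bs (\<lambda>i. c * f i) = emb c * lin_comb bs f"
  by (simp add: lin_comb_def hom_mult sum_distrib_left mult.assoc)

text \<open>Independence suffices by counting dimensions. It also excludes repetitions, since two
  equal entries satisfy the relation with coefficients 1 and -1.\<close>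

lemma basis_listI:
  assumes len: "length bs = ext_degree"
    and indep: "\<And>f i. lin_comb bs f = 0 \<Longrightarrow> i < length bs \<Longrightarrow> f i = 0"
  shows "basis_list bs"
proof -
  have dist: "distinct bs"
  proof (rule ccontr)
    assume "\<not> distinct bs"
    then obtain i j where ij: "i < length bs" "j < length bs" "i \<noteq> j" "bs ! i = bs ! j"
      by (auto simp: distinct_conv_nth)
    define f :: "nat \<Rightarrow> 'f" where "f = (\<lambda>k. (if k = i then 1 else 0) - (if k = j then 1 else 0))"
    have "lin_comb bs f = 0"
      unfolding f_def lin_comb_diff using ij by (simp add: lin_comb_def if_distrib if_distribR cong: if_cong)
    from indep[OF this ij(1)] show False using ij(3) by (simp add: f_def)
  qed
  have ind: "independent (set bs)"
  proof (rule independent_if_scalars_zero)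
    fix h x assume *: "(\<Sum>x\<in>set bs. emb (h x) * x) = 0" and x: "x \<in> set bs"
    from x obtain i where i: "i < length bs" "x = bs ! i" by (auto simp: in_set_conv_nth)
    have "lin_comb bs (\<lambda>i. h (bs ! i)) = 0"
      using * sum_set_basis[OF dist, of "\<lambda>x. emb (h x) * x"] by (simp add: lin_comb_def)
    from indep[OF this i(1)] show "h x = 0" using i by simp
  qed simp
  moreover have "span (set bs) = UNIV"
    using independent_span_UNIV[OF ind] len dist by (simp add: distinct_card)
  ultimately show ?thesis using dist by (simp add: basis_list_def)
qed

section \<open>Multiplication matrices, norm and trace\<close>

lemma mult_mat_carrier [simp]: "mult_mat bs x \<in> carrier_mat (length bs) (length bs)"
  by (simp add: mult_mat_def)

lemma mult_mat_index:
  "i < length bs \<Longrightarrow> j < length bs \<Longrightarrow> mult_mat bs x $$ (i, j) = coord bs (x * bs ! j) i"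
  by (simp add: mult_mat_def coord_def)

lemma coord_mult:
  assumes "basis_list bs" "i < length bs"
  shows "coord bs (x * y) i = (\<Sum>k<length bs. mult_mat bs x $$ (i, k) * coord bs y k)"
proof -
  have "x * y = (\<Sum>k<length bs. emb (coord bs y k) * (x * bs ! k))"
    by (subst (1) lin_comb_coord[OF assms(1), of y, symmetric])
       (simp add: lin_comb_def sum_distrib_left mult_ac)
  then show ?thesis
    using assms by (simp add: coord_sum coord_scale mult_mat_index) (simp add: mult.commute)
qed

lemma mult_mat_mult:
  assumes "basis_list bs"
  shows "mult_mat bs (x * y) = mult_mat bs x * mult_mat bs y"
  using assms
  by (intro eq_matI) (auto simp: mult_mat_index scalar_prod_def coord_mult mult.assoc atLeast0LessThan
      mult_mat_carrier[THEN carrier_matD(1)] mult_mat_carrier[THEN carrier_matD(2)])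

lemma mult_mat_1: "basis_list bs \<Longrightarrow> mult_mat bs 1 = 1\<^sub>m (length bs)"
  by (intro eq_matI) (auto simp: mult_mat_index coord_nth
      mult_mat_carrier[THEN carrier_matD(1)] mult_mat_carrier[THEN carrier_matD(2)])

definition change_mat :: "'l list \<Rightarrow> 'l list \<Rightarrow> 'f mat" where
  "change_mat bs cs = mat (length bs) (length cs) (\<lambda>(i, j). coord bs (cs ! j) i)"

lemma coord_change:
  assumes "basis_list bs" "basis_list cs" "i < length bs"
  shows "coord bs x i = (\<Sum>k<length cs. coord bs (cs ! k) i * coord cs x k)"
  by (subst lin_comb_coord[OF assms(2), of x, symmetric])
     (use assms in \<open>simp add: lin_comb_def coord_sum coord_scale\<close>, simp add: mult.commute)

lemma change_mat_inverse:
  assumes "basis_list bs" "basis_list cs"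
  shows "change_mat bs cs * change_mat cs bs = 1\<^sub>m (length bs)"
  using assms coord_change[OF assms, symmetric]
  by (intro eq_matI) (auto simp: change_mat_def scalar_prod_def coord_nth atLeast0LessThan)

lemma mult_mat_change:
  assumes "basis_list bs" "basis_list cs"
  shows "mult_mat bs x * change_mat bs cs = change_mat bs cs * mult_mat cs x"
proof (intro eq_matI)
  fix i j assume "i < dim_row (change_mat bs cs * mult_mat cs x)"
    "j < dim_col (change_mat bs cs * mult_mat cs x)"
  then have ij: "i < length bs" "j < length cs"
    by (simp_all add: change_mat_def mult_mat_def)
  have "(mult_mat bs x * change_mat bs cs) $$ (i, j) =
      (\<Sum>k<length bs. mult_mat bs x $$ (i, k) * coord bs (cs ! j) k)"
    using ij by (simp add: change_mat_def scalar_prod_def atLeast0LessThan mult_mat_carrier[THEN carrier_matD(1)]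
       mult_mat_carrier[THEN carrier_matD(2)])
  also have "\<dots> = coord bs (x * cs ! j) i"
    using coord_mult[OF assms(1) ij(1)] by simp
  also have "\<dots> = (\<Sum>k<length cs. coord bs (cs ! k) i * coord cs (x * cs ! j) k)"
    using coord_change[OF assms ij(1)] .
  also have "\<dots> = (change_mat bs cs * mult_mat cs x) $$ (i, j)"
    using ij by (simp add: change_mat_def scalar_prod_def atLeast0LessThan mult_mat_def coord_def)
  finally show "(mult_mat bs x * change_mat bs cs) $$ (i, j) = (change_mat bs cs * mult_mat cs x) $$ (i, j)" .
qed (simp_all add: change_mat_def mult_mat_def)

lemma mult_mat_similar:
  assumes "basis_list bs" "basis_list cs"
  shows "mult_mat bs x = change_mat bs cs * (mult_mat cs x * change_mat cs bs)"
proof -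
  have len: "length bs = length cs" using assms by (simp add: length_basis_list)
  have c: "change_mat bs cs \<in> carrier_mat (length cs) (length cs)"
    "change_mat cs bs \<in> carrier_mat (length cs) (length cs)"
    "mult_mat bs x \<in> carrier_mat (length cs) (length cs)"
    "mult_mat cs x \<in> carrier_mat (length cs) (length cs)"
    using len by (simp_all add: change_mat_def mult_mat_def)
  have "mult_mat bs x = mult_mat bs x * (change_mat bs cs * change_mat cs bs)"
    using c assms len by (simp add: change_mat_inverse)
  also have "\<dots> = change_mat bs cs * (mult_mat cs x * change_mat cs bs)"
    using c by (simp add: mult_mat_change[OF assms] assoc_mult_mat[of _ "length cs" "length cs" _ "length cs" _ "length cs"]
       assoc_mult_mat[symmetric, of "mult_mat bs x" "length cs" "length cs" _ "length cs" _ "length cs"])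
  finally show ?thesis .
qed

lemma some_basis_list: "basis_list (SOME bs. basis_list bs)"
  using ex_basis_list by (rule someI_ex)

lemma ext_norm_eq_det:
  assumes "basis_list bs"
  shows "ext_norm x = det (mult_mat bs x)"
proof -
  define cs where "cs = (SOME bs. basis_list bs)"
  have cs: "basis_list cs" unfolding cs_def by (rule some_basis_list)
  define n where "n = length bs"
  have len: "length cs = n" using assms cs by (simp add: length_basis_list n_def)
  have c: "change_mat bs cs \<in> carrier_mat n n" "change_mat cs bs \<in> carrier_mat n n"
    "mult_mat cs x \<in> carrier_mat n n"
    using len by (simp_all add: change_mat_def mult_mat_def n_def)
  have "det (mult_mat bs x) = det (change_mat bs cs) * det (change_mat cs bs) * det (mult_mat cs x)"
    unfolding mult_mat_similar[OF assms cs, of x]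
    using c by (simp add: det_mult[of _ n])
  also have "det (change_mat bs cs) * det (change_mat cs bs) = 1"
    using det_mult[OF c(1,2)] change_mat_inverse[OF assms cs] by simp
  finally show ?thesis by (simp add: ext_norm_def cs_def)
qed

lemma ext_trace_eq:
  assumes "basis_list bs"
  shows "ext_trace x = (\<Sum>i<length bs. coord bs (x * bs ! i) i)"
proof -
  define cs where "cs = (SOME bs. basis_list bs)"
  have cs: "basis_list cs" unfolding cs_def by (rule some_basis_list)
  define n where "n = length bs"
  have len: "length cs = n" using assms cs by (simp add: length_basis_list n_def)
  have c: "change_mat bs cs \<in> carrier_mat n n" "change_mat cs bs \<in> carrier_mat n n"
    "mult_mat cs x \<in> carrier_mat n n"
    using len by (simp_all add: change_mat_def mult_mat_def n_def)
  have "(\<Sum>i<n. coord bs (x * bs ! i) i) = (\<Sum>i<n. mult_mat bs x $$ (i, i))"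
    by (simp add: mult_mat_index n_def)
  also have "\<dots> = (\<Sum>i<n. (change_mat bs cs * (mult_mat cs x * change_mat cs bs)) $$ (i, i))"
    unfolding mult_mat_similar[OF assms cs, of x] ..
  also have "\<dots> = (\<Sum>i<n. (mult_mat cs x * change_mat cs bs * change_mat bs cs) $$ (i, i))"
    using c by (intro trace_mat_mult_commute) auto
  also have "mult_mat cs x * change_mat cs bs * change_mat bs cs = mult_mat cs x"
    using c len by (simp add: change_mat_inverse[OF cs assms] assoc_mult_mat[of _ n n _ n _ n])
  finally show ?thesis using len by (simp add: ext_trace_def Let_def cs_def n_def mult_mat_def)
qed

lemma ext_norm_mult: "ext_norm (x * y) = ext_norm x * ext_norm y"
proof -
  obtain bs where bs: "basis_list bs" using ex_basis_list by blast
  show ?thesis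
    by (simp add: ext_norm_eq_det[OF bs] mult_mat_mult[OF bs] det_mult[of _ "length bs"])
qed

lemma ext_norm_1 [simp]: "ext_norm 1 = 1"
proof -
  obtain bs where bs: "basis_list bs" using ex_basis_list by blast
  show ?thesis by (simp add: ext_norm_eq_det[OF bs] mult_mat_1[OF bs])
qed

lemma ext_norm_nonzero: "x \<noteq> 0 \<Longrightarrow> ext_norm x \<noteq> 0"
  using ext_norm_mult[of x "inverse x"] by auto

lemma ext_norm_emb: "ext_norm (emb q) = q ^ ext_degree"
proof -
  obtain bs where bs: "basis_list bs" using ex_basis_list by blast
  have "mult_mat bs (emb q) = q \<cdot>\<^sub>m 1\<^sub>m (length bs)"
    by (intro eq_matI) (auto simp: mult_mat_index coord_scale[OF bs] coord_nth[OF bs]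
        mult_mat_carrier[THEN carrier_matD(1)] mult_mat_carrier[THEN carrier_matD(2)])
  then show ?thesis by (simp add: ext_norm_eq_det[OF bs] length_basis_list[OF bs])
qed

lemma ext_norm_0 [simp]: "ext_norm 0 = 0"
proof -
  have "ext_norm 0 = 0 ^ ext_degree"
    using ext_norm_emb[of 0] by (simp only: hom_zero)
  also have "\<dots> = 0"
    using ext_degree_pos by (rule zero_power)
  finally show ?thesis .
qed

lemma ext_norm_power: "ext_norm (x ^ m) = ext_norm x ^ m"
  by (induction m) (simp_all add: ext_norm_mult)

lemma ext_norm_inverse: "ext_norm (inverse x) = inverse (ext_norm x)"
proof (cases "x = 0")
  case False
  then show ?thesis
    using ext_norm_mult[of x "inverse x"] by (intro inverse_unique[symmetric]) simp
qed simp

lemma ext_norm_powi: "ext_norm (x powi m) = ext_norm x powi m"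
  by (simp add: power_int_def ext_norm_power ext_norm_inverse)

lemma ext_trace_add: "ext_trace (x + y) = ext_trace x + ext_trace y"
proof -
  obtain bs where bs: "basis_list bs" using ex_basis_list by blast
  show ?thesis by (simp add: ext_trace_eq[OF bs] ring_distribs coord_add[OF bs] sum.distrib)
qed

lemma ext_trace_scale: "ext_trace (emb q * x) = q * ext_trace x"
proof -
  obtain bs where bs: "basis_list bs" using ex_basis_list by blast
  show ?thesis by (simp add: ext_trace_eq[OF bs] mult.assoc coord_scale[OF bs] sum_distrib_left)
qed

lemma ext_trace_sum: "ext_trace (sum h A) = (\<Sum>a\<in>A. ext_trace (h a))"
proof (induction A rule: infinite_finite_induct)
  case empty
  show ?case using ext_trace_scale[of 0 0] by simp
qed (use ext_trace_scale[of 0 0] in \<open>simp_all add: ext_trace_add\<close>)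

lemma ext_trace_lin_comb: "ext_trace (lin_comb bs f * z) = (\<Sum>i<length bs. f i * ext_trace (bs ! i * z))"
  by (simp add: lin_comb_def sum_distrib_right mult.assoc ext_trace_sum ext_trace_scale)

end

section \<open>Valuation rings\<close>

definition is_subring :: "'l::field set \<Rightarrow> bool" where
  "is_subring A \<longleftrightarrow> 1 \<in> A \<and> (\<forall>x\<in>A. \<forall>y\<in>A. x - y \<in> A \<and> x * y \<in> A)"

text \<open>The exponent \<open>m\<close> is automatically positive, since \<open>m = 0\<close>
  would read \<open>1 = 0\<close>.\<close>

definition integral_over :: "'l::field set \<Rightarrow> 'l \<Rightarrow> bool" where
  "integral_over A x \<longleftrightarrow> (\<exists>m a. (\<forall>i. a i \<in> A) \<and> x ^ m = (\<Sum>i<m. a i * x ^ i))"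

definition adjoin :: "'l::field set \<Rightarrow> 'l \<Rightarrow> 'l set" where
  "adjoin A y = {poly p y |p. \<forall>i. coeff p i \<in> A}"

context
  fixes A :: "'l::field set"
  assumes A: "is_subring A"
begin

lemma subring_1: "1 \<in> A"
  and subring_diff: "x \<in> A \<Longrightarrow> y \<in> A \<Longrightarrow> x - y \<in> A"
  and subring_mult: "x \<in> A \<Longrightarrow> y \<in> A \<Longrightarrow> x * y \<in> A"
  using A by (auto simp: is_subring_def)

lemma subring_0: "0 \<in> A"
  using subring_diff[OF subring_1 subring_1] by simp

lemma subring_minus: "x \<in> A \<Longrightarrow> - x \<in> A"
  using subring_diff[OF subring_0] by force

lemma subring_add: "x \<in> A \<Longrightarrow> y \<in> A \<Longrightarrow> x + y \<in> A"
  using subring_diff[of x "- y"] subring_minus[of y] by simp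

lemma subring_sum: "(\<And>i. i \<in> I \<Longrightarrow> f i \<in> A) \<Longrightarrow> sum f I \<in> A"
  by (induction I rule: infinite_finite_induct) (auto intro: subring_0 subring_add)

lemma subring_prod: "(\<And>i. i \<in> I \<Longrightarrow> f i \<in> A) \<Longrightarrow> prod f I \<in> A"
  by (induction I rule: infinite_finite_induct) (auto intro: subring_1 subring_mult)

lemma subring_power: "x \<in> A \<Longrightarrow> x ^ m \<in> A"
  by (induction m) (auto intro: subring_1 subring_mult)

lemma subset_adjoin: "A \<subseteq> adjoin A y"
proof
  fix a assume "a \<in> A"
  then show "a \<in> adjoin A y"
    unfolding adjoin_def by (intro CollectI exI[of _ "[:a:]"]) (auto simp: coeff_pCons subring_0 split: nat.split)
qed

lemma self_in_adjoin: "y \<in> adjoin A y"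
  unfolding adjoin_def
  by (intro CollectI exI[of _ "[:0, 1:]"]) (auto simp: coeff_pCons subring_0 subring_1 split: nat.split)

lemma is_subring_adjoin: "is_subring (adjoin A y)"
proof -
  have "poly p y - poly q y \<in> adjoin A y \<and> poly p y * poly q y \<in> adjoin A y"
    if "\<forall>i. coeff p i \<in> A" "\<forall>i. coeff q i \<in> A" for p q
  proof
    show "poly p y - poly q y \<in> adjoin A y"
      unfolding adjoin_def using that by (intro CollectI exI[of _ "p - q"]) (auto intro: subring_diff)
    show "poly p y * poly q y \<in> adjoin A y"
      unfolding adjoin_def using that
      by (intro CollectI exI[of _ "p * q"]) (auto simp: coeff_mult intro!: subring_sum subring_mult)
  qed
  moreover have "1 \<in> adjoin A y" using subset_adjoin subring_1 by blast
  ultimately show ?thesis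
    unfolding is_subring_def by (auto simp: adjoin_def)
qed

text \<open>With \<open>d\<close> the degree of \<open>p\<close>, multiplying
  \<open>x = p(1/x)\<close> by \<open>x ^ d\<close> gives a monic equation of degree
  \<open>d + 1\<close>.\<close>

lemma integral_over_if_in_adjoin_inverse:
  assumes "x \<noteq> 0" "x \<in> adjoin A (inverse x)"
  shows "integral_over A x"
proof -
  obtain p where p: "\<forall>i. coeff p i \<in> A" "x = poly p (inverse x)"
    using assms(2) by (auto simp: adjoin_def)
  define d where "d = degree p"
  have "x ^ Suc d = poly p (inverse x) * x ^ d"
    using p(2) by simp
  also have "\<dots> = (\<Sum>i<Suc d. coeff p i * (inverse x ^ i * x ^ d))"
    by (simp add: poly_altdef d_def sum_distrib_right mult.assoc lessThan_Suc_atMost del: sum.lessThan_Suc)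
  also have "\<dots> = (\<Sum>i<Suc d. coeff p i * x ^ (d - i))"
    using assms(1) by (intro sum.cong refl) (simp add: power_diff field_simps)
  also have "\<dots> = (\<Sum>i<Suc d. coeff p (d - i) * x ^ i)"
    by (subst sum.nat_diff_reindex[symmetric]) (intro sum.cong, auto)
  finally show ?thesis
    unfolding integral_over_def using p(1) by (intro exI[of _ "Suc d"] exI[of _ "\<lambda>i. coeff p (d - i)"]) simp
qed

end

text \<open>
  The terms \<open>u * a\<close> with \<open>a \<in> A\<close> behave like a proper ideal inside the Jacobson radical: a relation
  expressing 1 by powers of \<open>y\<close> and one by powers of \<open>1 / y\<close> can be played against each other to
  lower the degree.
\<close>

lemma relation_degree_reduction:
  fixes A :: "'l::field set"
  assumes A: "is_subring A" and u: "u \<in> A"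
    and unit: "\<And>a. a \<in> A \<Longrightarrow> 1 - u * a \<noteq> 0 \<and> inverse (1 - u * a) \<in> A"
    and yz: "y * z = 1"
    and a: "\<forall>i. a i \<in> A" "(\<Sum>i\<le>Suc m. u * a i * y ^ i) = 1"
    and b: "\<forall>i. b i \<in> A" "(\<Sum>i\<le>Suc m. u * b i * z ^ i) = 1"
  shows "\<exists>c. (\<forall>i. c i \<in> A) \<and> (\<Sum>i\<le>m. u * c i * y ^ i) = 1"
proof -
  \<comment> \<open>Multiplied by \<open>s * y ^ Suc m\<close>, the relation in \<open>z\<close>
    expresses \<open>y ^ Suc m\<close> by lower powers of \<open>y\<close> with coefficients in
    \<open>u * A\<close>. Substituting this in the relation for \<open>y\<close> removes its top
    term.\<close>
  define s where "s = inverse (1 - u * b 0)"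
  have s: "s \<in> A" "(1 - u * b 0) * s = 1"
    using unit[of "b 0"] b(1) by (simp_all add: s_def)
  have "1 - u * b 0 = (\<Sum>i\<le>m. u * b (Suc i) * z ^ Suc i)"
    using b(2) by (simp add: sum.atMost_Suc_shift algebra_simps del: sum.atMost_Suc)
  then have "y ^ Suc m * ((1 - u * b 0) * s) = s * (\<Sum>i\<le>m. u * b (Suc i) * (z ^ Suc i * y ^ Suc m))"
    by (simp add: sum_distrib_left sum_distrib_right mult_ac del: power_Suc)
  also have "(\<Sum>i\<le>m. u * b (Suc i) * (z ^ Suc i * y ^ Suc m)) = (\<Sum>i\<le>m. u * b (Suc i) * y ^ (m - i))"
  proof (intro sum.cong refl)
    fix i assume "i \<in> {..m}"
    then have "y ^ Suc m = y ^ Suc i * y ^ (m - i)"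
      unfolding power_add[symmetric] by simp
    then have "z ^ Suc i * y ^ Suc m = (y * z) ^ Suc i * y ^ (m - i)"
      unfolding power_mult_distrib by (metis mult.assoc mult.commute)
    then show "u * b (Suc i) * (z ^ Suc i * y ^ Suc m) = u * b (Suc i) * y ^ (m - i)"
      by (simp add: yz)
  qed
  also have "\<dots> = (\<Sum>i\<le>m. u * b (Suc (m - i)) * y ^ i)"
    unfolding lessThan_Suc_atMost[symmetric]
    by (subst sum.nat_diff_reindex[symmetric]) (intro sum.cong, auto)
  finally have ym: "y ^ Suc m = (\<Sum>i\<le>m. u * (s * b (Suc (m - i))) * y ^ i)"
    unfolding s(2) by (simp add: sum_distrib_left mult_ac)
  define c where "c = (\<lambda>i. a i + a (Suc m) * (u * (s * b (Suc (m - i)))))"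
  have "(\<Sum>i\<le>m. u * c i * y ^ i) = (\<Sum>i\<le>m. u * a i * y ^ i) + u * a (Suc m) * y ^ Suc m"
    unfolding ym c_def by (simp add: ring_distribs sum.distrib sum_distrib_left mult_ac)
  also have "\<dots> = 1"
    using a(2) by simp
  finally have "(\<Sum>i\<le>m. u * c i * y ^ i) = 1" .
  moreover have "\<forall>i. c i \<in> A"
    using a b s u unfolding c_def by (auto intro!: subring_add[OF A] subring_mult[OF A])
  ultimately show ?thesis by blast
qed

text \<open>The heart of Chevalley's theorem. By maximality, \<open>x\<close> lies in
  \<open>A[z]\<close> for every \<open>z\<close> outside \<open>A\<close>; multiplied by
  \<open>u = 1 / x\<close> this expresses 1 by powers of \<open>z\<close> with coefficients in
  \<open>u * A\<close>. If both \<open>y\<close> and \<open>1 / y\<close> were outside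
  \<open>A\<close>, two such relations would reduce each other to degree 0 and put \<open>x\<close>
  into \<open>A\<close>.\<close>

lemma maximal_subring_is_valuation_ring:
  fixes A :: "'l::field set"
  assumes A: "is_subring A" and x: "x \<noteq> 0" "x \<notin> A" "inverse x \<in> A"
    and max: "\<And>B. is_subring B \<Longrightarrow> A \<subseteq> B \<Longrightarrow> x \<notin> B \<Longrightarrow> B = A"
    and y: "y \<noteq> 0"
  shows "y \<in> A \<or> inverse y \<in> A"
proof -
  define u where "u = inverse x"
  have u: "u \<in> A" "x * u = 1" "u * x = 1" "u \<noteq> 0" using x by (simp_all add: u_def)
  have in_adjoin: "x \<in> adjoin A z" if "z \<notin> A" for z
    using max[OF is_subring_adjoin[OF A, of z] subset_adjoin[OF A]] self_in_adjoin[OF A, of z] that by auto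
  \<comment> \<open>If the inverse of \<open>v = 1 - u * a\<close> were outside \<open>A\<close>,
    then \<open>x\<close> would be a polynomial in \<open>1 / v\<close>, so \<open>x * v ^ d\<close>
    would lie in \<open>A\<close>. As \<open>v ^ d\<close> is again of the form
    \<open>1 - u * b\<close>, so would \<open>x = x * v ^ d + b\<close>.\<close>
  have unit: "1 - u * a \<noteq> 0 \<and> inverse (1 - u * a) \<in> A" if a: "a \<in> A" for a
  proof -
    define v where "v = 1 - u * a"
    have "x * u * a \<noteq> x"
      using x a by (auto simp: u)
    then have v0: "v \<noteq> 0"
      by (auto simp: v_def mult.assoc)
    have v: "v \<in> A" unfolding v_def using a u A by (intro subring_diff subring_1 subring_mult) auto
    have "inverse v \<in> A"
    proof (rule ccontr)
      assume "inverse v \<notin> A"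
      then obtain p where p: "\<forall>i. coeff p i \<in> A" "x = poly p (inverse v)"
        using in_adjoin[of "inverse v"] by (auto simp: adjoin_def)
      define d where "d = degree p"
      have "x * v ^ d = (\<Sum>i\<le>d. coeff p i * (inverse v ^ i * v ^ d))"
        by (simp add: p(2) poly_altdef d_def sum_distrib_right mult.assoc)
      also have "\<dots> = (\<Sum>i\<le>d. coeff p i * v ^ (d - i))"
        using v0 by (intro sum.cong refl) (simp add: power_diff field_simps)
      also have "\<dots> \<in> A"
        using p(1) v by (intro subring_sum[OF A] subring_mult[OF A] subring_power[OF A]) auto
      finally have xv: "x * v ^ d \<in> A" .
      have "\<exists>b\<in>A. v ^ d = 1 - u * b" for d
      proof (induction d)
        case 0
        show ?case by (intro bexI[of _ 0]) (auto simp: subring_0[OF A])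
      next
        case (Suc d)
        then obtain b where b: "b \<in> A" "v ^ d = 1 - u * b" by blast
        show ?case
        proof (intro bexI)
          show "v ^ Suc d = 1 - u * (a + b - u * a * b)"
            by (simp add: b) (simp add: v_def algebra_simps)
          show "a + b - u * a * b \<in> A"
            using a b u by (intro subring_diff[OF A] subring_add[OF A] subring_mult[OF A])
        qed
      qed
      then obtain b where b: "b \<in> A" "v ^ d = 1 - u * b" by blast
      have "x = x * v ^ d + b"
        by (simp add: b algebra_simps) (simp add: u flip: mult.assoc)
      with xv b(1) x(2) subring_add[OF A] show False by metis
    qed
    with v0 show ?thesis by (simp add: v_def)
  qed
  define P where "P = (\<lambda>m z. \<exists>a. (\<forall>i. a i \<in> A) \<and> (\<Sum>i\<le>m. u * a i * z ^ i) = 1)"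
  have ex: "\<exists>m. P m z" if z: "z \<notin> A" for z
  proof -
    obtain p where p: "\<forall>i. coeff p i \<in> A" "x = poly p z"
      using in_adjoin[OF z] by (auto simp: adjoin_def)
    have "(\<Sum>i\<le>degree p. u * coeff p i * z ^ i) = u * poly p z"
      by (simp add: poly_altdef sum_distrib_left mult.assoc)
    with p u show ?thesis unfolding P_def by metis
  qed
  have mono: "P m' z" if P: "P m z" and m: "m \<le> m'" for m m' z
  proof -
    obtain a where a: "\<forall>i. a i \<in> A" "(\<Sum>i\<le>m. u * a i * z ^ i) = 1"
      using P unfolding P_def by blast
    have "(\<Sum>i\<le>m'. u * (if i \<le> m then a i else 0) * z ^ i) = (\<Sum>i\<le>m. u * a i * z ^ i)"
      using m by (intro sum.mono_neutral_cong_right) auto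
    with a show ?thesis
      unfolding P_def by (intro exI[of _ "\<lambda>i. if i \<le> m then a i else 0"]) (auto intro: subring_0[OF A])
  qed
  show ?thesis
  proof (rule ccontr)
    assume "\<not> ?thesis"
    then obtain k l where "P k y" "P l (inverse y)" using ex by blast
    \<comment> \<open>Both relations are padded with zeros to a common degree, because the reduction
      lowers the two degrees together.\<close>
    then have *: "P (max k l) y \<and> P (max k l) (inverse y)"
      by (meson mono max.cobounded1 max.cobounded2)
    have "P m y \<and> P m (inverse y) \<Longrightarrow> P 0 y" for m
    proof (induction m)
      case (Suc m)
      then obtain a b where "\<forall>i. a i \<in> A" "(\<Sum>i\<le>Suc m. u * a i * y ^ i) = 1"
        "\<forall>i. b i \<in> A" "(\<Sum>i\<le>Suc m. u * b i * inverse y ^ i) = 1"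
        unfolding P_def by blast
      then have "P m y" "P m (inverse y)"
        unfolding P_def
        using relation_degree_reduction[OF A u(1) unit, of y "inverse y" a m b]
          relation_degree_reduction[OF A u(1) unit, of "inverse y" y b m a] y by simp_all
      then show ?case using Suc.IH by blast
    qed blast
    from this[OF *] obtain a where "a \<in> A" "u * a = 1"
      unfolding P_def by auto
    then have "x = x * u * a" by (simp add: mult.assoc)
    with u(2) have "x = a" by simp
    with \<open>a \<in> A\<close> x(2) show False by simp
  qed
qed

text \<open>Zorn's lemma among the subrings that contain \<open>A[1/x]\<close> and omit
  \<open>x\<close>. Non-integrality of \<open>x\<close> ensures that \<open>A[1/x]\<close> itself is
  one of them.\<close>

lemma ex_valuation_ring:
  fixes A :: "'l::field set"
  assumes A: "is_subring A" and x: "\<not> integral_over A x"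
  shows "\<exists>V. is_subring V \<and> A \<subseteq> V \<and> x \<notin> V \<and> (\<forall>y. y \<noteq> 0 \<longrightarrow> y \<in> V \<or> inverse y \<in> V)"
proof -
  have "integral_over A 0"
    unfolding integral_over_def using subring_0[OF A] by (intro exI[of _ 1] exI[of _ "\<lambda>_. 0"]) simp
  with x have x0: "x \<noteq> 0" by auto
  define F where "F = {B. is_subring B \<and> adjoin A (inverse x) \<subseteq> B \<and> x \<notin> B}"
  have "adjoin A (inverse x) \<in> F"
    using integral_over_if_in_adjoin_inverse[OF A x0] x by (auto simp: F_def is_subring_adjoin[OF A])
  then have "F \<noteq> {}" by blast
  moreover have "\<Union>C \<in> F" if C: "C \<noteq> {}" "subset.chain F C" for C
  proof -
    have CF: "C \<subseteq> F" and lin: "B \<subseteq> B' \<or> B' \<subseteq> B" if "B \<in> C" "B' \<in> C" for B B'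
      using C(2) that by (auto simp: subset.chain_def)
    have "y - z \<in> \<Union>C \<and> y * z \<in> \<Union>C" if yz: "y \<in> \<Union>C" "z \<in> \<Union>C" for y z
    proof -
      obtain B B' where "B \<in> C" "B' \<in> C" "y \<in> B" "z \<in> B'" using yz by blast
      then obtain B where B: "B \<in> C" "y \<in> B" "z \<in> B" using lin by blast
      then have "is_subring B" using C(2) by (auto simp: F_def subset.chain_def)
      with B show ?thesis by (auto simp: is_subring_def)
    qed
    moreover obtain B where B: "B \<in> C" using C(1) by blast
    moreover have "B \<in> F" using B C(2) by (auto simp: subset.chain_def)
    moreover have "x \<notin> \<Union>C" using C(2) by (auto simp: F_def subset.chain_def)
    ultimately show ?thesis
      unfolding F_def is_subring_def by blast
  qed
  ultimately obtain V where V: "V \<in> F" and max: "\<forall>B\<in>F. V \<subseteq> B \<longrightarrow> B = V"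
    using subset_Zorn_nonempty[of F] by blast
  have VA: "A \<subseteq> V" "inverse x \<in> V" "is_subring V" "x \<notin> V"
    using V subset_adjoin[OF A, of "inverse x"] self_in_adjoin[OF A, of "inverse x"] by (auto simp: F_def)
  moreover have "y \<in> V \<or> inverse y \<in> V" if "y \<noteq> 0" for y
  proof (rule maximal_subring_is_valuation_ring[of V x y])
    fix B assume "is_subring B" "V \<subseteq> B" "x \<notin> B"
    with V have "B \<in> F" by (auto simp: F_def)
    with max \<open>V \<subseteq> B\<close> show "B = V" by blast
  qed (use x0 VA that in auto)
  ultimately show ?thesis by blast
qed

section \<open>Discrete valuations\<close>

definition val_ge :: "('l::field \<Rightarrow> int) \<Rightarrow> 'l \<Rightarrow> int \<Rightarrow> bool" where
  "val_ge w x m \<longleftrightarrow> x = 0 \<or> m \<le> w x"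

lemma val_ge_0 [simp]: "val_ge w 0 m"
  by (simp add: val_ge_def)

lemma val_ge_mono: "val_ge w x m \<Longrightarrow> m' \<le> m \<Longrightarrow> val_ge w x m'"
  by (auto simp: val_ge_def)

locale discrete_val =
  fixes w :: "'l::field \<Rightarrow> int"
  assumes discrete_valuation: "discrete_valuation w"
begin

lemma val_mult: "x \<noteq> 0 \<Longrightarrow> y \<noteq> 0 \<Longrightarrow> w (x * y) = w x + w y"
  and val_add_ge: "x \<noteq> 0 \<Longrightarrow> y \<noteq> 0 \<Longrightarrow> x + y \<noteq> 0 \<Longrightarrow> min (w x) (w y) \<le> w (x + y)"
  using discrete_valuation by (auto simp: discrete_valuation_def)

lemma ex_val_eq: "\<exists>x. x \<noteq> 0 \<and> w x = m"
proof -
  have "m \<in> w ` (UNIV - {0})"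
    using discrete_valuation by (simp add: discrete_valuation_def)
  then show ?thesis by auto
qed

lemma val_1 [simp]: "w 1 = 0"
  using val_mult[of 1 1] by simp

lemma val_inverse: "x \<noteq> 0 \<Longrightarrow> w (inverse x) = - w x"
  using val_mult[of x "inverse x"] by simp

lemma val_divide: "x \<noteq> 0 \<Longrightarrow> y \<noteq> 0 \<Longrightarrow> w (x / y) = w x - w y"
  by (simp add: divide_inverse val_mult val_inverse)

lemma val_power: "x \<noteq> 0 \<Longrightarrow> w (x ^ m) = int m * w x"
  by (induction m) (simp_all add: val_mult algebra_simps)

lemma val_powi: "x \<noteq> 0 \<Longrightarrow> w (x powi m) = m * w x"
  by (auto simp: power_int_def val_power val_inverse)

lemma val_minus: "w (- x) = w x"
proof (cases "x = 0")
  case False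
  have "w (-1) = 0"
    using val_mult[of "-1" "-1"] by simp
  with False show ?thesis
    using val_mult[of "-1" x] by simp
qed simp

lemma val_ge_minus: "val_ge w (- x) m \<longleftrightarrow> val_ge w x m"
  by (simp add: val_ge_def val_minus)

lemma val_ge_add:
  assumes "val_ge w x m" "val_ge w y m"
  shows "val_ge w (x + y) m"
  using assms val_add_ge[of x y]
  by (cases "x = 0"; cases "y = 0"; cases "x + y = 0") (auto simp: val_ge_def)

lemma val_ge_diff: "val_ge w x m \<Longrightarrow> val_ge w y m \<Longrightarrow> val_ge w (x - y) m"
  using val_ge_add[of x m "- y"] by (simp add: val_ge_minus)

lemma val_ge_sum: "(\<And>i. i \<in> I \<Longrightarrow> val_ge w (f i) m) \<Longrightarrow> val_ge w (sum f I) m"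
  by (induction I rule: infinite_finite_induct) (auto intro: val_ge_add)

lemma val_ge_mult: "val_ge w x m \<Longrightarrow> val_ge w y l \<Longrightarrow> val_ge w (x * y) (m + l)"
  by (cases "x = 0"; cases "y = 0") (auto simp: val_ge_def val_mult)

lemma val_ge_1: "val_ge w 1 0"
  by (simp add: val_ge_def)

lemma val_ge_power: "val_ge w x 0 \<Longrightarrow> val_ge w (x ^ m) 0"
  by (cases "x = 0"; cases m) (auto simp: val_ge_def val_power val_mult)

text \<open>The equality case of the ultrametric inequality: if \<open>x + y\<close> had larger
  valuation than \<open>x\<close>, then so would \<open>x = (x + y) - y\<close>.\<close>

lemma val_add_eq:
  assumes "x \<noteq> 0" "val_ge w y (w x + 1)"
  shows "x + y \<noteq> 0" "w (x + y) = w x"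
proof -
  show nz: "x + y \<noteq> 0"
  proof
    assume "x + y = 0"
    then have "y = - x" by (simp add: eq_neg_iff_add_eq_0 add.commute)
    with assms show False by (simp add: val_ge_def val_minus)
  qed
  have "val_ge w (x + y) (w x)"
    using assms by (intro val_ge_add) (auto simp: val_ge_def)
  moreover have "\<not> val_ge w (x + y) (w x + 1)"
    using val_ge_diff[of "x + y" "w x + 1" y] assms by (auto simp: val_ge_def)
  ultimately show "w (x + y) = w x"
    using nz by (simp add: val_ge_def)
qed

end

section \<open>Places above infinity\<close>

locale alg_function_field = function_field emb
  for emb :: "'k::alg_closed_field poly fract \<Rightarrow> 'l::field" +
  assumes finite_extension: finite_extension
begin

sublocale finite_field_extension emb
  by unfold_locales (rule finite_extension)

definition inf_ring :: "'l set" where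
  "inf_ring = {emb q |q. deg_le q 0}"

text \<open>Fixing the irrelevant value at 0 makes a place a single function, so that
  \<open>places\<close> can be finite and sums over it count every place once.\<close>

definition places :: "('l \<Rightarrow> int) set" where
  "places = {w. w 0 = 0 \<and> (\<exists>e. place_above_infinity w e)}"

text \<open>The ramification index can be read off from \<open>T\<close>, whose degree is 1.\<close>

definition ram :: "('l \<Rightarrow> int) \<Rightarrow> nat" where
  "ram w = nat (- w (emb fract_T))"

lemma place_above_infinity_ram: "place_above_infinity w e \<Longrightarrow> ram w = e"
  by (simp add: ram_def place_above_infinity_def)

lemma
  assumes "w \<in> places"
  shows places_valuation: "discrete_val w"
    and ram_pos: "ram w > 0"
    and val_emb: "q \<noteq> 0 \<Longrightarrow> w (emb q) = - int (ram w) * fract_degree q"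
    and place_above_infinity: "place_above_infinity w (ram w)"
  using assms place_above_infinity_ram[of w]
  by (auto simp: places_def place_above_infinity_def discrete_val_def)

lemma places_eqI:
  assumes "v \<in> places" "w \<in> places" "\<And>x. x \<noteq> 0 \<Longrightarrow> v x = w x"
  shows "v = w"
proof
  fix x show "v x = w x"
    using assms by (cases "x = 0") (auto simp: places_def)
qed

lemma val_ge_emb:
  assumes "w \<in> places" "deg_le q d"
  shows "val_ge w (emb q) (- int (ram w) * d)"
  using assms by (cases "q = 0") (auto simp: val_ge_def deg_le_def val_emb intro!: mult_left_mono)

lemma emb_powi: "emb (q powi m) = emb q powi m"
  by (simp add: power_int_def hom_power hom_inverse)

lemma is_subring_inf_ring: "is_subring inf_ring"
proof -
  have "emb p - emb q \<in> inf_ring \<and> emb p * emb q \<in> inf_ring" if "deg_le p 0" "deg_le q 0" for p q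
    using deg_le_diff[OF that] deg_le_mult[OF that]
    by (auto simp: inf_ring_def simp flip: hom_minus hom_mult)
  moreover have "1 \<in> inf_ring"
    unfolding inf_ring_def using deg_le_1 hom_one by fastforce
  ultimately show ?thesis
    by (auto simp: is_subring_def inf_ring_def)
qed

lemma span_powers:
  assumes "y \<in> span ((\<lambda>i. x ^ i) ` {..<m})"
  shows "\<exists>a. y = (\<Sum>i<m. emb (a i) * x ^ i)"
  using assms
proof (induction rule: span_induct_alt)
  case base
  show ?case by (intro exI[of _ "\<lambda>_. 0"]) simp
next
  case (step c y z)
  then obtain j a where j: "j < m" "y = x ^ j" and a: "z = (\<Sum>i<m. emb (a i) * x ^ i)" by blast
  define b where "b = (\<lambda>i. if i = j then c else 0)"
  have "(\<Sum>i<m. emb (b i) * x ^ i) = (\<Sum>i<m. if i = j then emb c * x ^ j else 0)"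
    by (intro sum.cong) (auto simp: b_def)
  also have "\<dots> = emb c * y" using j by simp
  finally have "emb c * y + z = (\<Sum>i<m. emb (b i + a i) * x ^ i)"
    by (simp add: hom_add ring_distribs sum.distrib a)
  then show ?case by (intro exI[of _ "\<lambda>i. b i + a i"])
qed

text \<open>Take the first power in the span of its predecessors. The bound on \<open>m\<close> is
  what later makes \<open>fact ext_degree\<close> a common multiple of all differences of
  exponents.\<close>

lemma ex_power_relation: "\<exists>m a. 0 < m \<and> m \<le> ext_degree \<and> x ^ m = (\<Sum>i<m. emb (a i) * x ^ i)"
proof -
  define S where "S = (\<lambda>m. (\<lambda>i. x ^ i) ` {..<m})"
  have "\<exists>m\<le>ext_degree. x ^ m \<in> span (S m)"
  proof (rule ccontr)
    assume *: "\<not> ?thesis"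
    have "independent (S m) \<and> card (S m) = m" if "m \<le> Suc ext_degree" for m
      using that
    proof (induction m)
      case (Suc m)
      have "S (Suc m) = insert (x ^ m) (S m)"
        by (auto simp: S_def lessThan_Suc)
      moreover have "x ^ m \<notin> span (S m)" using * Suc.prems by auto
      moreover have "x ^ m \<notin> S m" using \<open>x ^ m \<notin> span (S m)\<close> span_base by blast
      ultimately show ?case
        using Suc by (auto simp: independent_insertI) (simp add: S_def)
    qed (simp add: S_def independent_empty)
    from this[of "Suc ext_degree"] independent_card_le[of "S (Suc ext_degree)"] show False by simp
  qed
  then obtain m where m: "m \<le> ext_degree" "x ^ m \<in> span (S m)" by blast
  obtain a where a: "x ^ m = (\<Sum>i<m. emb (a i) * x ^ i)"
    using span_powers[of "x ^ m" x m] m(2) unfolding S_def by blast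
  then have "m \<noteq> 0" by (intro notI) simp
  with m(1) a show ?thesis by blast
qed

section \<open>The discrete valuation of a valuation ring above infinity\<close>

context
  fixes V :: "'l set"
  assumes V: "is_subring V" and inf_V: "inf_ring \<subseteq> V"
    and total: "\<And>y. y \<noteq> 0 \<Longrightarrow> y \<in> V \<or> inverse y \<in> V"
begin

definition val_unit :: "'l \<Rightarrow> bool" where
  "val_unit y \<longleftrightarrow> y \<in> V \<and> inverse y \<in> V \<and> y \<noteq> 0"

lemma val_unit_1: "val_unit 1"
  and val_unit_mult: "val_unit x \<Longrightarrow> val_unit y \<Longrightarrow> val_unit (x * y)"
  and val_unit_inverse: "val_unit x \<Longrightarrow> val_unit (inverse x)"
  using subring_1[OF V] subring_mult[OF V] by (auto simp: val_unit_def)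

lemma val_unit_power: "val_unit x \<Longrightarrow> val_unit (x ^ m)"
  by (induction m) (auto intro: val_unit_1 val_unit_mult)

lemma val_unit_emb: "q \<noteq> 0 \<Longrightarrow> fract_degree q = 0 \<Longrightarrow> val_unit (emb q)"
  using inf_V by (force simp: val_unit_def inf_ring_def deg_le_def fract_degree_inverse simp flip: hom_inverse)

text \<open>Dividing the equation by \<open>x ^ (m - 1)\<close> writes \<open>x\<close> as a
  polynomial in \<open>1 / x\<close>.\<close>

lemma valuation_ring_integrally_closed:
  assumes "integral_over V x"
  shows "x \<in> V"
proof (rule ccontr)
  assume x: "x \<notin> V"
  then have x0: "x \<noteq> 0" using subring_0[OF V] by auto
  with x have inv: "inverse x \<in> V" using total by blast
  obtain m a where a: "\<forall>i. a i \<in> V" "x ^ m = (\<Sum>i<m. a i * x ^ i)"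
    using assms by (auto simp: integral_over_def)
  then obtain l where l: "m = Suc l" using x0 by (cases m) auto
  have "x = x ^ m * inverse x ^ l"
    using x0 by (simp add: l power_inverse field_simps)
  also have "\<dots> = (\<Sum>i<m. a i * inverse x ^ (l - i))"
    unfolding a(2) sum_distrib_right
  proof (intro sum.cong refl)
    fix i assume "i \<in> {..<m}"
    then have "inverse x ^ l = inverse x ^ i * inverse x ^ (l - i)"
      unfolding power_add[symmetric] by (simp add: l)
    then have "x ^ i * inverse x ^ l = inverse x ^ (l - i)"
      using x0 by (simp add: power_inverse)
    then show "a i * x ^ i * inverse x ^ l = a i * inverse x ^ (l - i)"
      by (simp only: mult.assoc)
  qed
  also have "\<dots> \<in> V"
    using a(1) inv by (intro subring_sum[OF V] subring_mult[OF V] subring_power[OF V]) auto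
  finally show False using x by contradiction
qed

text \<open>If \<open>T\<close> were in \<open>V\<close>, then \<open>V\<close> would contain all of
  \<open>k(T)\<close>; as \<open>x\<close> is algebraic over \<open>k(T)\<close> and
  \<open>V\<close> is integrally closed, \<open>x\<close> would be in \<open>V\<close>.\<close>

lemma emb_T_notin_valuation_ring:
  assumes "x \<notin> V"
  shows "emb fract_T \<notin> V"
proof
  assume T: "emb fract_T \<in> V"
  have "emb q \<in> V" for q
  proof (cases "q = 0")
    case False
    define s where "s = nat (fract_degree q)"
    have "deg_le (fract_T powi (- int s) * q) 0"
      unfolding deg_le_T_powi_mult_iff by (simp add: deg_le_def s_def)
    then have "emb (fract_T powi (- int s) * q) \<in> V"
      using inf_V by (auto simp: inf_ring_def)
    then have "emb fract_T ^ s * emb (fract_T powi (- int s) * q) \<in> V"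
      using T by (intro subring_mult[OF V] subring_power[OF V])
    also have "emb fract_T ^ s * emb (fract_T powi (- int s) * q) = emb (fract_T ^ s * (fract_T powi (- int s) * q))"
      by (simp add: hom_mult hom_power)
    also have "fract_T ^ s * (fract_T powi (- int s) * q) = q"
      by (simp add: power_int_minus)
    finally show ?thesis .
  qed (simp add: subring_0[OF V])
  moreover obtain m a where "x ^ m = (\<Sum>i<m. emb (a i) * x ^ i)"
    using ex_power_relation by blast
  ultimately have "integral_over V x"
    unfolding integral_over_def by (intro exI[of _ m] exI[of _ "\<lambda>i. emb (a i)"]) simp
  with assms valuation_ring_integrally_closed show False by blast
qed

text \<open>A valuation ring is local: if \<open>a / b\<close> lies in \<open>V\<close> and
  \<open>a + b\<close> is a unit, then \<open>1 / b = (1 + a / b) / (a + b)\<close> lies in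
  \<open>V\<close>.\<close>

lemma nonunit_add:
  assumes "a \<in> V" "\<not> val_unit a" "b \<in> V" "\<not> val_unit b"
  shows "\<not> val_unit (a + b)"
proof
  assume ab: "val_unit (a + b)"
  have *: False if "a \<in> V" "b \<in> V" "\<not> val_unit b" "a / b \<in> V" "b \<noteq> 0" "val_unit (a + b)" for a b
  proof -
    have "inverse b = (1 + a / b) * inverse (a + b)"
    proof -
      have "a + b = (1 + a / b) * b" using that(5) by (simp add: ring_distribs)
      then have "inverse (a + b) = inverse (1 + a / b) * inverse b" by simp
      moreover have "1 + a / b \<noteq> 0"
        using that(6) \<open>a + b = (1 + a / b) * b\<close> by (auto simp: val_unit_def)
      ultimately show ?thesis by simp
    qed
    also have "\<dots> \<in> V"
      using that by (intro subring_mult[OF V] subring_add[OF V] subring_1[OF V]) (auto simp: val_unit_def)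
    finally show False using that by (auto simp: val_unit_def)
  qed
  have "a \<noteq> 0" "b \<noteq> 0" using ab assms by auto
  then have "a / b \<in> V \<or> b / a \<in> V"
    using total[of "a / b"] by simp
  with *[of a b] *[of b a] assms ab \<open>a \<noteq> 0\<close> \<open>b \<noteq> 0\<close> show False by (auto simp: add.commute)
qed

lemma nonunit_sum:
  assumes "\<And>i. i \<in> I \<Longrightarrow> f i \<in> V \<and> \<not> val_unit (f i)"
  shows "sum f I \<in> V \<and> \<not> val_unit (sum f I)"
  using assms
proof (induction I rule: infinite_finite_induct)
  case (insert i I)
  then show ?case using nonunit_add by (auto intro: subring_add[OF V])
qed (auto simp: subring_0[OF V], auto simp: val_unit_def)

lemma ex_dominant:
  assumes "finite I" "I \<noteq> {}" "\<And>i. i \<in> I \<Longrightarrow> z i \<noteq> 0"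
  shows "\<exists>i\<in>I. \<forall>j\<in>I. z j / z i \<in> V"
  using assms
proof (induction rule: finite_ne_induct)
  case (singleton i)
  then show ?case using subring_1[OF V] by simp
next
  case (insert k I)
  then obtain i where i: "i \<in> I" "\<forall>j\<in>I. z j / z i \<in> V" by auto
  have nz: "z i \<noteq> 0" "z k \<noteq> 0" using insert.prems i by auto
  then have "z k / z i \<in> V \<or> z i / z k \<in> V"
    using total[of "z k / z i"] by simp
  then show ?case
  proof
    assume "z k / z i \<in> V"
    with i show ?case by auto
  next
    assume *: "z i / z k \<in> V"
    have "z j / z k \<in> V" if "j \<in> I" for j
    proof -
      have "z j / z k = (z j / z i) * (z i / z k)" using nz by simp
      with subring_mult[OF V, of "z j / z i" "z i / z k"] i(2) that * show ?thesis by metis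
    qed
    moreover have "z k / z k \<in> V" using nz subring_1[OF V] by simp
    ultimately show ?case by blast
  qed
qed

text \<open>In the algebraic equation of \<open>x\<close> the dominant term cannot stand alone, so
  two terms agree up to a unit. Their quotient is an element of \<open>k(T)\<close> times a power of
  \<open>x\<close> with exponent at most \<open>n\<close>, and elements of \<open>k(T)\<close> are
  powers of \<open>T\<close> up to units. A further power raises the exponent of \<open>x\<close> to
  \<open>fact ext_degree\<close>, uniformly in \<open>x\<close>.\<close>

lemma ex_unit_power:
  assumes "x \<noteq> 0"
  shows "\<exists>l. val_unit (x ^ fact ext_degree * emb fract_T powi l)"
proof -
  obtain m a where m: "0 < m" "m \<le> ext_degree" "x ^ m = (\<Sum>i<m. emb (a i) * x ^ i)"
    using ex_power_relation by blast
  define c where "c = (\<lambda>i. if i = m then - 1 else a i)"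
  define z where "z = (\<lambda>i. emb (c i) * x ^ i)"
  define I where "I = {i. i \<le> m \<and> c i \<noteq> 0}"
  have "(\<Sum>i\<le>m. z i) = (\<Sum>i<m. emb (a i) * x ^ i) - x ^ m"
    by (simp add: z_def c_def hom_uminus flip: lessThan_Suc_atMost)
  then have "(\<Sum>i\<le>m. z i) = 0"
    by (simp add: m(3))
  also have "(\<Sum>i\<le>m. z i) = (\<Sum>i\<in>I. z i)"
    by (intro sum.mono_neutral_right) (auto simp: I_def z_def)
  finally have sum0: "(\<Sum>i\<in>I. z i) = 0" .
  have I: "finite I" "m \<in> I" by (auto simp: I_def c_def)
  have z0: "z i \<noteq> 0" if "i \<in> I" for i
    using that assms by (simp add: I_def z_def)
  obtain i where i: "i \<in> I" "\<forall>j\<in>I. z j / z i \<in> V"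
    using ex_dominant[of I z] I z0 by blast
  obtain j where j: "j \<in> I" "j \<noteq> i" "val_unit (z j / z i)"
  proof (rule ccontr)
    assume "\<not> thesis"
    with that have "\<forall>j\<in>I - {i}. \<not> val_unit (z j / z i)" by blast
    with i have "\<not> val_unit (\<Sum>j\<in>I - {i}. z j / z i)"
      using nonunit_sum[of "I - {i}" "\<lambda>j. z j / z i"] by blast
    moreover have "(\<Sum>j\<in>I - {i}. z j / z i) = - 1"
    proof -
      have "(\<Sum>j\<in>I - {i}. z j) = - z i"
        using sum0 i(1) I(1) by (simp add: sum.remove eq_neg_iff_add_eq_0 add.commute)
      then show ?thesis using z0[OF i(1)] by (simp flip: sum_divide_distrib)
    qed
    moreover have "val_unit (- 1)"
      using subring_minus[OF V subring_1[OF V]] by (simp add: val_unit_def)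
    ultimately show False by simp
  qed
  have key: "\<exists>l. val_unit (x ^ fact ext_degree * emb fract_T powi l)"
    if ij: "i < j" "i \<in> I" "j \<in> I" and u: "val_unit (z j / z i)" for i j
  proof -
    define s where "s = j - i"
    have s: "0 < s" "s \<le> ext_degree" "j = i + s"
      using ij m(2) by (auto simp: s_def I_def)
    then obtain t where t: "fact ext_degree = s * t"
      using dvd_fact[of s ext_degree] by (auto simp: dvd_def)
    define q where "q = c j / c i"
    define d where "d = fract_degree q"
    have q: "q \<noteq> 0" using ij by (simp add: q_def I_def)
    have "z j / z i = emb q * x ^ s"
      using assms by (simp add: z_def q_def hom_div s(3) power_add)
    moreover have "q = (q * fract_T powi (- d)) * fract_T powi d"
      by (simp add: power_int_minus)
    then have "emb q = emb (q * fract_T powi (- d)) * emb fract_T powi d"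
      by (simp flip: emb_powi hom_mult)
    moreover have un: "val_unit (emb (q * fract_T powi (- d)))"
      using q by (intro val_unit_emb) (auto simp: fract_degree_mult d_def)
    ultimately have "z j / z i * inverse (emb (q * fract_T powi (- d))) = x ^ s * emb fract_T powi d"
      by (simp add: val_unit_def)
    with u un have "val_unit (x ^ s * emb fract_T powi d)"
      by (metis val_unit_mult val_unit_inverse)
    then have "val_unit ((x ^ s * emb fract_T powi d) ^ t)"
      by (rule val_unit_power)
    also have "(x ^ s * emb fract_T powi d) ^ t = x ^ fact ext_degree * emb fract_T powi (d * int t)"
      by (simp add: t power_mult power_mult_distrib power_int_mult)
    finally show ?thesis by blast
  qed
  have "val_unit (z i / z j)"
    using val_unit_inverse[OF j(3)] by simp
  with key[of i j] key[of j i] i j show ?thesis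
    by (cases "i < j") auto
qed

text \<open>The valuation of \<open>V\<close>, scaled so that \<open>1 / T\<close> has value
  \<open>fact ext_degree\<close>. This makes all values integers, but they may form a proper
  subgroup.\<close>

definition pre_val :: "'l \<Rightarrow> int" where
  "pre_val x = (THE l. val_unit (x ^ fact ext_degree * emb fract_T powi l))"

context
  assumes T_notin: "emb fract_T \<notin> V"
begin

lemma T_powi_unit:
  assumes "val_unit (emb fract_T powi l)"
  shows "l = 0"
proof -
  have *: False if "l > 0" "val_unit (emb fract_T powi l)" for l :: int
  proof -
    have inv: "inverse (emb fract_T) \<in> V" using total[of "emb fract_T"] T_notin by simp
    have "emb fract_T = emb fract_T powi l * inverse (emb fract_T) ^ nat (l - 1)"
    proof -
      have "inverse (emb fract_T) ^ nat (l - 1) = emb fract_T powi (- (l - 1))"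
        using that(1) by (auto simp: power_int_def)
      then have "emb fract_T powi l * inverse (emb fract_T) ^ nat (l - 1) = emb fract_T powi (l + (- (l - 1)))"
        by (subst power_int_add) auto
      then show ?thesis by simp
    qed
    also have "\<dots> \<in> V"
      using that(2) inv by (intro subring_mult[OF V] subring_power[OF V]) (auto simp: val_unit_def)
    finally show False using T_notin by contradiction
  qed
  show ?thesis
  proof (cases "l = 0")
    case False
    have "val_unit (emb fract_T powi (- l))"
      using val_unit_inverse[OF assms] by (simp add: power_int_minus)
    with * assms False show ?thesis by (metis neg_0_less_iff_less not_less_iff_gr_or_eq)
  qed
qed

lemma pre_val_unique:
  assumes "x \<noteq> 0" "val_unit (x ^ fact ext_degree * emb fract_T powi l)"
  shows "pre_val x = l"
  unfolding pre_val_def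
proof (rule the_equality)
  fix l' assume "val_unit (x ^ fact ext_degree * emb fract_T powi l')"
  with assms have "val_unit (x ^ fact ext_degree * emb fract_T powi l' *
      inverse (x ^ fact ext_degree * emb fract_T powi l))"
    using val_unit_mult val_unit_inverse by blast
  also have "x ^ fact ext_degree * emb fract_T powi l' * inverse (x ^ fact ext_degree * emb fract_T powi l)
      = emb fract_T powi (l' + (- l))"
    using assms(1) by (subst power_int_add) (auto simp: power_int_minus field_simps)
  finally show "l' = l" using T_powi_unit by fastforce
qed (rule assms)

lemma pre_val_unit: "x \<noteq> 0 \<Longrightarrow> val_unit (x ^ fact ext_degree * emb fract_T powi pre_val x)"
  using ex_unit_power[of x] pre_val_unique by blast

lemma pre_val_mult:
  assumes "x \<noteq> 0" "y \<noteq> 0"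
  shows "pre_val (x * y) = pre_val x + pre_val y"
proof (rule pre_val_unique)
  have "(x * y) ^ fact ext_degree * emb fract_T powi (pre_val x + pre_val y) =
      (x ^ fact ext_degree * emb fract_T powi pre_val x) * (y ^ fact ext_degree * emb fract_T powi pre_val y)"
    by (subst power_int_add) (auto simp: power_mult_distrib)
  then show "val_unit ((x * y) ^ fact ext_degree * emb fract_T powi (pre_val x + pre_val y))"
    using assms by (simp add: val_unit_mult pre_val_unit)
qed (use assms in simp)

lemma pre_val_1: "pre_val 1 = 0"
  using pre_val_mult[of 1 1] by simp

lemma pre_val_inverse: "x \<noteq> 0 \<Longrightarrow> pre_val (inverse x) = - pre_val x"
  using pre_val_mult[of x "inverse x"] pre_val_1 by simp

lemma pre_val_power: "x \<noteq> 0 \<Longrightarrow> pre_val (x ^ m) = int m * pre_val x"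
  by (induction m) (simp_all add: pre_val_1 pre_val_mult algebra_simps)

lemma pre_val_powi: "x \<noteq> 0 \<Longrightarrow> pre_val (x powi m) = m * pre_val x"
  by (auto simp: power_int_def pre_val_power pre_val_inverse)

lemma pre_val_nonneg:
  assumes "x \<noteq> 0" "x \<in> V"
  shows "pre_val x \<ge> 0"
proof (rule ccontr)
  define l where "l = nat (- pre_val x)"
  define v where "v = x ^ fact ext_degree * emb fract_T powi pre_val x"
  assume *: "\<not> pre_val x \<ge> 0"
  have v: "val_unit v" unfolding v_def by (rule pre_val_unit[OF assms(1)])
  have "emb fract_T powi (- pre_val x) = x ^ fact ext_degree * inverse v"
    using assms(1) by (simp add: v_def power_int_minus)
  also have "\<dots> \<in> V"
    using assms(2) v by (intro subring_mult[OF V] subring_power[OF V]) (auto simp: val_unit_def)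
  finally have T: "emb fract_T powi (- pre_val x) \<in> V" .
  have "inverse (emb fract_T) \<in> V" using total[of "emb fract_T"] T_notin by simp
  then have "inverse (emb fract_T) ^ l \<in> V" by (intro subring_power[OF V])
  also have "inverse (emb fract_T) ^ l = inverse (emb fract_T powi (- pre_val x))"
    using * by (simp add: power_int_def l_def power_inverse)
  finally have "val_unit (emb fract_T powi (- pre_val x))"
    using T by (simp add: val_unit_def)
  from T_powi_unit[OF this] * show False by simp
qed

text \<open>The delicate case is value 0: then \<open>x ^ fact ext_degree\<close> is a unit, and if
  \<open>1 / x\<close> lies in \<open>V\<close>, multiplying by powers of \<open>1 / x\<close> leads
  back to \<open>x\<close>.\<close>

lemma pre_val_nonneg_iff:
  assumes "x \<noteq> 0"
  shows "pre_val x \<ge> 0 \<longleftrightarrow> x \<in> V"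
proof
  assume *: "pre_val x \<ge> 0"
  show "x \<in> V"
  proof (rule ccontr)
    assume x: "x \<notin> V"
    then have inv: "inverse x \<in> V" using total assms by blast
    then have "pre_val (inverse x) \<ge> 0" using assms by (intro pre_val_nonneg) auto
    with * have "pre_val x = 0" using assms by (simp add: pre_val_inverse)
    with pre_val_unit[OF assms] have "val_unit (x ^ fact ext_degree)" by simp
    then have xN: "x ^ fact ext_degree \<in> V" by (simp add: val_unit_def)
    obtain m where m: "fact ext_degree = Suc m" by (metis fact_nonzero not0_implies_Suc)
    have "x ^ fact ext_degree * inverse x ^ m \<in> V"
      using subring_mult[OF V xN subring_power[OF V inv]] .
    also have "x ^ fact ext_degree * inverse x ^ m = x"
      using assms by (simp add: m power_inverse)
    finally show False using x by contradiction
  qed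
qed (use assms pre_val_nonneg in blast)

lemma pre_val_emb:
  assumes "q \<noteq> 0"
  shows "pre_val (emb q) = - fact ext_degree * fract_degree q"
proof (rule pre_val_unique)
  define l where "l = - fact ext_degree * fract_degree q"
  have "val_unit (emb (q ^ fact ext_degree * fract_T powi l))"
    using assms by (intro val_unit_emb) (auto simp: fract_degree_mult fract_degree_power l_def)
  then show "val_unit (emb q ^ fact ext_degree * emb fract_T powi (- fact ext_degree * fract_degree q))"
    by (simp add: hom_mult hom_power emb_powi l_def)
qed (use assms in simp)

lemma ex_place_of_valuation_ring:
  "\<exists>w\<in>places. \<forall>x. x \<noteq> 0 \<longrightarrow> (w x \<ge> 0 \<longleftrightarrow> x \<in> V)"
proof -
  define N where "N = (fact ext_degree :: int)"
  have N: "N > 0" by (simp add: N_def)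
  define P where "P = (\<lambda>k::nat. k > 0 \<and> (\<exists>t. t \<noteq> 0 \<and> pre_val t = int k))"
  have T: "pre_val (inverse (emb fract_T)) = N"
    by (simp add: pre_val_inverse pre_val_emb N_def)
  then have "P (nat N)"
    using N unfolding P_def by (intro conjI exI[of _ "inverse (emb fract_T)"]) auto
  \<comment> \<open>The values form a subgroup of the integers. Its least positive element
    \<open>k\<close> generates it, and division by \<open>k\<close> normalizes the
    valuation.\<close>
  define k where "k = (LEAST k. P k)"
  have "P k" unfolding k_def using \<open>P (nat N)\<close> by (rule LeastI)
  then obtain t where k: "k > 0" and t: "t \<noteq> 0" "pre_val t = int k" by (auto simp: P_def)
  have dvd: "int k dvd pre_val x" if x: "x \<noteq> 0" for x
  proof (rule ccontr)
    assume nd: "\<not> int k dvd pre_val x"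
    define y where "y = x * t powi (- (pre_val x div int k))"
    have y: "y \<noteq> 0" "pre_val y = pre_val x mod int k"
      using x t by (simp_all add: y_def pre_val_mult pre_val_powi minus_div_mult_eq_mod)
    have "0 < pre_val x mod int k" "pre_val x mod int k < int k"
      using nd k by (simp_all add: dvd_eq_mod_eq_0 order.not_eq_order_implies_strict)
    then have "P (nat (pre_val y))" "nat (pre_val y) < k"
      unfolding P_def using y by auto
    then show False
      unfolding k_def using not_less_Least by blast
  qed
  define w where "w = (\<lambda>x. if x = 0 then 0 else pre_val x div int k)"
  have w_eq: "pre_val x = int k * w x" if "x \<noteq> 0" for x
    using dvd[OF that] that by (simp add: w_def)
  have w_nonneg: "w x \<ge> 0 \<longleftrightarrow> x \<in> V" if "x \<noteq> 0" for x
    using w_eq[OF that] pre_val_nonneg_iff[OF that] k by (simp add: zero_le_mult_iff)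
  have w_mult: "w (x * y) = w x + w y" if "x \<noteq> 0" "y \<noteq> 0" for x y
  proof -
    have "int k * w (x * y) = int k * (w x + w y)"
      using that by (simp add: distrib_left pre_val_mult flip: w_eq)
    with k show ?thesis by simp
  qed
  have w_add: "w x \<le> w (x + y)" if "x \<noteq> 0" "y \<noteq> 0" "x + y \<noteq> 0" "w x \<le> w y" for x y
  proof -
    have "w y = w (y / x) + w x" using w_mult[of "y / x" x] that by simp
    with that have "y / x \<in> V" using w_nonneg[of "y / x"] by simp
    then have "1 + y / x \<in> V" by (intro subring_add[OF V] subring_1[OF V])
    moreover have eq: "(1 + y / x) * x = x + y" using that by (simp add: ring_distribs)
    ultimately have "w (1 + y / x) \<ge> 0" using w_nonneg[of "1 + y / x"] that by fastforce
    moreover have "1 + y / x \<noteq> 0" using eq that by auto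
    ultimately show ?thesis
      using w_mult[of "1 + y / x" x] that unfolding eq by simp
  qed
  have "discrete_valuation w"
    unfolding discrete_valuation_def
  proof (intro conjI allI impI)
    fix x y :: 'l assume "x \<noteq> 0" "y \<noteq> 0" "x + y \<noteq> 0"
    then show "min (w x) (w y) \<le> w (x + y)"
      using w_add[of x y] w_add[of y x] by (cases "w x \<le> w y") (auto simp: add.commute)
  next
    have "w (t powi m) = m \<and> t powi m \<noteq> 0" for m
      using k t by (simp add: w_def pre_val_powi)
    then have "m \<in> w ` (UNIV - {0})" for m
      by (intro image_eqI[of _ _ "t powi m"]) auto
    then show "w ` (UNIV - {0}) = UNIV" by blast
  qed (rule w_mult)
  moreover have wT: "w (inverse (emb fract_T)) > 0"
    using w_eq[of "inverse (emb fract_T)"] T N by (auto simp: zero_less_mult_iff)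
  moreover have "w (emb q) = int (nat (w (inverse (emb fract_T)))) * (- fract_degree q)" if "q \<noteq> 0" for q
  proof -
    have "int k * w (emb q) = int k * (w (inverse (emb fract_T)) * (- fract_degree q))"
      using w_eq[of "emb q"] w_eq[of "inverse (emb fract_T)"] that T
      by (simp add: pre_val_emb N_def mult.assoc[symmetric])
    then have "w (emb q) = w (inverse (emb fract_T)) * (- fract_degree q)"
      using k by (simp only: mult_cancel_left) simp
    with wT show ?thesis by simp
  qed
  ultimately have "place_above_infinity w (nat (w (inverse (emb fract_T))))"
    by (simp add: place_above_infinity_def)
  then have "w \<in> places" unfolding places_def by (auto simp: w_def)
  with w_nonneg show ?thesis by blast
qed

end

end

text \<open>Contrapositively, integrality at all places implies integrality over the valuation ring
  at infinity. The place comes from a valuation ring that contains the latter but not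
  \<open>x\<close>.\<close>

lemma ex_place_negative:
  assumes "\<not> integral_over inf_ring x"
  shows "\<exists>w\<in>places. x \<noteq> 0 \<and> w x < 0"
proof -
  obtain V where V: "is_subring V" "inf_ring \<subseteq> V" "x \<notin> V" "\<And>y. y \<noteq> 0 \<Longrightarrow> y \<in> V \<or> inverse y \<in> V"
    using ex_valuation_ring[OF is_subring_inf_ring assms] by blast
  have "emb fract_T \<notin> V"
    using V by (intro emb_T_notin_valuation_ring[of V x]) auto
  then obtain w where w: "w \<in> places" "\<forall>x. x \<noteq> 0 \<longrightarrow> (w x \<ge> 0 \<longleftrightarrow> x \<in> V)"
    using ex_place_of_valuation_ring[of V] V by blast
  moreover have "x \<noteq> 0" using V subring_0[OF V(1)] by auto
  ultimately show ?thesis using V(3) by (intro bexI[of _ w]) force+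
qed

end

section \<open>Residues and weak approximation\<close>

context alg_function_field
begin

definition const :: "'k \<Rightarrow> 'l" where
  "const c = emb (fract_const c)"

lemma const_field_hom: "field_hom const"
  by unfold_locales (simp_all add: const_def fract_const_add fract_const_mult hom_add hom_mult)

lemma val_const: "w \<in> places \<Longrightarrow> c \<noteq> 0 \<Longrightarrow> w (const c) = 0"
  by (simp add: const_def val_emb)

lemma val_ge_const: "w \<in> places \<Longrightarrow> val_ge w (const c) 0"
  using val_const[of w c] by (cases "c = 0") (auto simp: val_ge_def const_def)

text \<open>Over the algebraically closed \<open>k\<close> the polynomial splits into linear
  factors, and a product of positive valuation has a factor of positive valuation unless all factors
  are units, as for constants.\<close>

lemma ex_residue_of_root:
  assumes w: "w \<in> places"
    and "p \<noteq> 0" "val_ge w (poly (map_poly const p) x) 1"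
  shows "\<exists>c. val_ge w (x - const c) 1"
  using assms(2,3)
proof (induction "degree p" arbitrary: p rule: less_induct)
  case (less p)
  interpret c: field_hom const by (rule const_field_hom)
  interpret w: discrete_val w by (rule places_valuation[OF w])
  show ?case
  proof (cases "degree p = 0")
    case True
    then obtain b where "p = [:b:]" by (metis degree_0_id)
    with less.prems val_const[OF w, of b] show ?thesis
      by (simp add: val_ge_def)
  next
    case False
    then obtain c where "poly p c = 0" using alg_closed_imp_poly_has_root[of p] by auto
    then obtain q where q: "p = [:- c, 1:] * q"
      by (metis dvdE poly_eq_0_iff_dvd)
    have ev: "poly (map_poly const p) x = (x - const c) * poly (map_poly const q) x"
    proof -
      interpret m: map_poly_comm_ring_hom const ..
      show ?thesis unfolding q by (simp only: m.hom_mult) (simp add: c.hom_uminus algebra_simps)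
    qed
    show ?thesis
    proof (cases "val_ge w (x - const c) 1")
      case False
      have "val_ge w (poly (map_poly const q) x) 1"
      proof (rule ccontr)
        assume "\<not> ?thesis"
        with False less.prems(2) show False
          unfolding ev by (auto simp: val_ge_def w.val_mult)
      qed
      moreover have "q \<noteq> 0" using less.prems(1) q by auto
      moreover from this have "degree q < degree p" unfolding q by (subst degree_mult_eq) auto
      ultimately show ?thesis using less.hyps by blast
    qed blast
  qed
qed

text \<open>Residue degree 1. An equation of \<open>x\<close> over \<open>k(T)\<close>, scaled so
  that its largest coefficient has degree 0, reduces to a nonzero equation with constant
  coefficients, so the residue is algebraic over \<open>k\<close>.\<close>

lemma ex_residue:
  assumes w: "w \<in> places" and x: "val_ge w x 0"
  shows "\<exists>c. val_ge w (x - const c) 1"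
proof -
  interpret w: discrete_val w by (rule places_valuation[OF w])
  obtain m a where m: "0 < m" "x ^ m = (\<Sum>i<m. emb (a i) * x ^ i)"
    using ex_power_relation by blast
  define c where "c = (\<lambda>i. if i = m then - 1 else a i)"
  have sum0: "(\<Sum>i\<le>m. emb (c i) * x ^ i) = 0"
    by (simp add: c_def hom_uminus m(2) flip: lessThan_Suc_atMost)
  define S where "S = {i. i \<le> m \<and> c i \<noteq> 0}"
  have S: "finite S" "m \<in> S" by (auto simp: S_def c_def)
  define d where "d = Max ((\<lambda>i. fract_degree (c i)) ` S)"
  have d_ge: "deg_le (c i) d" if "i \<le> m" for i
    using that S unfolding d_def deg_le_def by (cases "c i = 0") (auto simp: S_def intro!: Max_ge)
  have "d \<in> (\<lambda>i. fract_degree (c i)) ` S"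
    unfolding d_def using S by (intro Max_in) auto
  then obtain j where j: "j \<le> m" "c j \<noteq> 0" "fract_degree (c j) = d"
    by (auto simp: S_def)
  have "\<exists>b. deg_le (fract_T powi (- d) * c i - fract_const b) (-1)" if "i \<le> m" for i
    using d_ge[OF that] by (intro ex_leading_const) (simp add: deg_le_T_powi_mult_iff)
  then obtain b where b: "\<And>i. i \<le> m \<Longrightarrow> deg_le (fract_T powi (- d) * c i - fract_const (b i)) (-1)"
    by metis
  have "b j \<noteq> 0"
  proof
    assume "b j = 0"
    with b[OF j(1)] j show False by (simp add: deg_le_def fract_degree_mult)
  qed
  define p where "p = (\<Sum>i\<le>m. monom (b i) i)"
  have coeff_p: "coeff p i = (if i \<le> m then b i else 0)" for i
    by (simp add: p_def coeff_sum)
  have "p \<noteq> 0"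
    using coeff_p[of j] j(1) \<open>b j \<noteq> 0\<close> by auto
  have const_0: "const 0 = 0" by (simp add: const_def)
  have "degree p \<le> m"
    using coeff_p by (intro degree_le) auto
  then have "poly (map_poly const p) x = (\<Sum>i\<le>m. const (b i) * x ^ i)"
    by (subst poly_as_sum_of_monoms'[of _ m, symmetric])
       (auto simp: poly_sum poly_monom coeff_map_poly const_0 coeff_p intro: order_trans[OF degree_map_poly_le])
  also have "\<dots> = emb (fract_T powi (- d)) * (\<Sum>i\<le>m. emb (c i) * x ^ i)
      - (\<Sum>i\<le>m. emb (fract_T powi (- d) * c i - fract_const (b i)) * x ^ i)"
    by (simp add: hom_minus hom_mult ring_distribs sum_subtractf sum_distrib_left const_def mult.assoc)
  also have "\<dots> = - (\<Sum>i\<le>m. emb (fract_T powi (- d) * c i - fract_const (b i)) * x ^ i)"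
    by (simp add: sum0)
  finally have eq: "poly (map_poly const p) x = - (\<Sum>i\<le>m. emb (fract_T powi (- d) * c i - fract_const (b i)) * x ^ i)" .
  have "val_ge w (poly (map_poly const p) x) 1"
    unfolding eq w.val_ge_minus
  proof (intro w.val_ge_sum)
    fix i assume "i \<in> {..m}"
    then have "val_ge w (emb (fract_T powi (- d) * c i - fract_const (b i))) (- int (ram w) * (-1))"
      by (intro val_ge_emb[OF w] b) simp
    then have "val_ge w (emb (fract_T powi (- d) * c i - fract_const (b i))) 1"
      by (rule val_ge_mono) (use ram_pos[OF w] in simp)
    from w.val_ge_mult[OF this w.val_ge_power[OF x, of i]]
    show "val_ge w (emb (fract_T powi (- d) * c i - fract_const (b i)) * x ^ i) 1" by simp
  qed
  with ex_residue_of_root[OF w \<open>p \<noteq> 0\<close>] show ?thesis by blast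
qed

text \<open>If \<open>w\<close> were nonnegative wherever \<open>v\<close> is, it would be a
  multiple of \<open>v\<close>, and normalization would force equality. So each place is nonnegative
  at some element where the other is negative; the quotient of two such elements has strict signs at
  both.\<close>

lemma ex_place_separating:
  assumes v: "v \<in> places" and w: "w \<in> places" and ne: "v \<noteq> w"
  shows "\<exists>x. x \<noteq> 0 \<and> v x > 0 \<and> w x < 0"
proof -
  have *: "\<exists>x. x \<noteq> 0 \<and> v x \<ge> 0 \<and> w x < 0" if v: "v \<in> places" and w: "w \<in> places" and ne: "v \<noteq> w" for v w
  proof (rule ccontr)
    interpret v: discrete_val v by (rule places_valuation[OF v])
    interpret w: discrete_val w by (rule places_valuation[OF w])
    assume "\<not> ?thesis"
    then have le: "x \<noteq> 0 \<Longrightarrow> v x \<ge> 0 \<Longrightarrow> w x \<ge> 0" for x by force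
    obtain t where t: "t \<noteq> 0" "v t = 1" using v.ex_val_eq by blast
    have eq: "w x = v x * w t" if x: "x \<noteq> 0" for x
    proof -
      define u where "u = x * t powi (- v x)"
      have u: "u \<noteq> 0" "v u = 0" using x t by (simp_all add: u_def v.val_mult v.val_powi)
      then have "w u \<ge> 0" "w (inverse u) \<ge> 0"
        using le[of u] le[of "inverse u"] by (simp_all add: v.val_inverse)
      with u have "w u = 0" by (simp add: w.val_inverse)
      with x t show ?thesis by (simp add: u_def w.val_mult w.val_powi)
    qed
    have "w t \<ge> 0" using le[of t] t by simp
    moreover obtain y where "y \<noteq> 0" "w y = 1" using w.ex_val_eq by blast
    then have "v y * w t = 1" using eq by metis
    ultimately have "w t = 1" by (auto simp: zmult_eq_1_iff)
    then have "v = w" using eq places_eqI[OF v w] by simp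
    with ne show False by contradiction
  qed
  obtain x where x: "x \<noteq> 0" "v x \<ge> 0" "w x < 0" using * v w ne by blast
  obtain y where y: "y \<noteq> 0" "w y \<ge> 0" "v y < 0" using * v w ne by blast
  interpret v: discrete_val v by (rule places_valuation[OF v])
  interpret w: discrete_val w by (rule places_valuation[OF w])
  show ?thesis
    using x y by (intro exI[of _ "x / y"]) (auto simp: v.val_divide w.val_divide)
qed

text \<open>Induction on the set of other places. Let \<open>x\<close> serve for \<open>F\<close>
  and let \<open>y\<close> separate the new place \<open>v\<close> from \<open>w\<close>. If
  \<open>v x = 0\<close>, then \<open>x ^ m * y\<close> works for large \<open>m\<close>. If
  \<open>v x < 0\<close>, then \<open>x ^ m\<close> is first divided by \<open>x ^ m + 1\<close>,
  which makes it a unit at \<open>v\<close> and \<open>w\<close> and keeps its valuations on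
  \<open>F\<close>.\<close>

lemma ex_pole_only_at:
  assumes "finite F" "F \<subseteq> places - {w}" "w \<in> places"
  shows "\<exists>x. x \<noteq> 0 \<and> w x < 0 \<and> (\<forall>v\<in>F. v x > 0)"
  using assms(1,2)
proof (induction rule: finite_induct)
  case empty
  interpret w: discrete_val w by (rule places_valuation[OF assms(3)])
  show ?case using w.ex_val_eq[of "-1"] by (auto intro: exI[of _ "_ :: 'l"])
next
  case (insert v F)
  interpret w: discrete_val w by (rule places_valuation[OF assms(3)])
  have v: "v \<in> places" using insert.prems by auto
  interpret v: discrete_val v by (rule places_valuation[OF v])
  obtain x where x: "x \<noteq> 0" "w x < 0" "\<forall>u\<in>F. u x > 0" using insert by auto
  obtain y where y: "y \<noteq> 0" "v y > 0" "w y < 0"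
    using ex_place_separating[OF v assms(3)] insert.prems by auto
  \<comment> \<open>Large enough for the zeros of \<open>x ^ m\<close> on \<open>F\<close> to
    outweigh any poles of \<open>y\<close> there.\<close>
  define m where "m = Suc (nat (\<Sum>u\<in>F. \<bar>u y\<bar>))"
  have big: "u (x ^ m * y) > 0" if u: "u \<in> F" for u
  proof -
    interpret u: discrete_val u using u insert.prems by (intro places_valuation) auto
    have "\<bar>u y\<bar> \<le> (\<Sum>u\<in>F. \<bar>u y\<bar>)" using u insert.hyps(1) by (intro member_le_sum) auto
    then have "\<bar>u y\<bar> < int m" by (simp add: m_def)
    also have "int m \<le> int m * u x"
      using x u by (simp add: mult_le_cancel_left1) fastforce
    finally show ?thesis using x y by (simp add: u.val_mult u.val_power)
  qed
  have m: "m > 0" by (simp add: m_def)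
  show ?case
  proof (cases "v x > 0")
    case True
    with x show ?thesis by auto
  next
    case False
    show ?thesis
    proof (cases "v x = 0")
      case True
      have "w (x ^ m * y) < 0" using x y m by (simp add: w.val_mult w.val_power mult_pos_neg add_neg_neg)
      moreover have "v (x ^ m * y) > 0" using x y True by (simp add: v.val_mult v.val_power)
      ultimately show ?thesis using big x y by (intro exI[of _ "x ^ m * y"]) auto
    next
      case vx: False
      with False have vx: "v x < 0" by simp
      have one: "x ^ m + 1 \<noteq> 0 \<and> u (x ^ m + 1) = u (x ^ m)" if "u \<in> places" "u x < 0" for u
      proof -
        interpret u: discrete_val u by (rule places_valuation[OF that(1)])
        have "u (x ^ m) < 0" using that x m by (simp add: u.val_power mult_pos_neg)
        then show ?thesis using u.val_add_eq[of "x ^ m" 1] x by (simp add: val_ge_def)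
      qed
      have nz: "x ^ m + 1 \<noteq> 0" using one[OF assms(3) x(2)] by simp
      define z where "z = x ^ m * y / (x ^ m + 1)"
      have "z \<noteq> 0" using nz x y by (simp add: z_def)
      moreover have "w z < 0" using one[OF assms(3) x(2)] x y by (simp add: z_def w.val_divide w.val_mult)
      moreover have "v z > 0" using one[OF v vx] x y by (simp add: z_def v.val_divide v.val_mult)
      moreover have "u z > 0" if u: "u \<in> F" for u
      proof -
        have up: "u \<in> places" using u insert.prems by auto
        interpret u: discrete_val u by (rule places_valuation[OF up])
        have "u (x ^ m) > 0" using x u m by (simp add: u.val_power)
        then have "u (1 + x ^ m) = 0" using u.val_add_eq[of 1 "x ^ m"] by (simp add: val_ge_def)
        then show ?thesis using big[OF u] nz x y by (simp add: z_def u.val_divide add.commute)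
      qed
      ultimately show ?thesis by auto
    qed
  qed
qed

text \<open>The quotient \<open>x ^ l / (1 + x ^ l)\<close> tends to 1 where \<open>x\<close> has a
  pole and to 0 where \<open>x\<close> has a zero.\<close>

lemma ex_approx_idempotent:
  assumes F: "finite F" "F \<subseteq> places - {w}" and w: "w \<in> places"
  shows "\<exists>h. val_ge w (h - 1) m \<and> (\<forall>v\<in>F. val_ge v h m)"
proof -
  obtain x where x: "x \<noteq> 0" "w x < 0" "\<forall>v\<in>F. v x > 0" using ex_pole_only_at[OF assms] by blast
  define l where "l = Suc (nat m)"
  have l: "int l > 0" "m \<le> int l" by (auto simp: l_def)
  interpret w: discrete_val w by (rule places_valuation[OF w])
  have wl: "w (x ^ l) \<le> - int l"
    using x l mult_left_mono[of "w x" "-1" "int l"] by (simp add: w.val_power)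
  then have wx: "1 + x ^ l \<noteq> 0" "w (1 + x ^ l) = w (x ^ l)"
    using w.val_add_eq[of "x ^ l" 1] l x by (simp_all add: val_ge_def add.commute)
  define h where "h = x ^ l / (1 + x ^ l)"
  have "h - 1 = - (1 / (1 + x ^ l))"
    using wx(1) by (simp add: h_def field_simps)
  then have "val_ge w (h - 1) m"
    using wx wl l by (simp add: val_ge_def w.val_minus w.val_divide)
  moreover have "val_ge v h m" if v: "v \<in> F" for v
  proof -
    interpret v: discrete_val v using v F by (intro places_valuation) auto
    have vl: "v (x ^ l) \<ge> int l"
      using x v l mult_left_mono[of 1 "v x" "int l"] by (fastforce simp: v.val_power)
    then have "v (1 + x ^ l) = 0" using v.val_add_eq[of 1 "x ^ l"] l by (simp add: val_ge_def)
    with vl l x wx(1) show ?thesis by (simp add: val_ge_def h_def v.val_divide)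
  qed
  ultimately show ?thesis by blast
qed

text \<open>Since \<open>1 / T\<close> has valuation \<open>int (ram v)\<close> at \<open>v\<close>,
  the element \<open>\<beta> (w, s)\<close> is divisible by \<open>1 / T\<close> at the other places
  of \<open>F\<close>, while at \<open>w\<close> the exponents \<open>s\<close> run through the
  residues modulo the ramification index.\<close>

definition local_basis :: "('l \<Rightarrow> int) set \<Rightarrow> (('l \<Rightarrow> int) \<times> nat \<Rightarrow> 'l) \<Rightarrow> bool" where
  "local_basis F \<beta> \<longleftrightarrow> (\<forall>w\<in>F. \<forall>s<ram w. \<beta> (w, s) \<noteq> 0 \<and> w (\<beta> (w, s)) = int s \<and>
      (\<forall>v\<in>F - {w}. val_ge v (\<beta> (w, s)) (int (ram v))))"

definition local_index :: "('l \<Rightarrow> int) set \<Rightarrow> (('l \<Rightarrow> int) \<times> nat) set" where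
  "local_index F = Sigma F (\<lambda>w. {..<ram w})"

lemma finite_local_index: "finite F \<Longrightarrow> finite (local_index F)"
  by (simp add: local_index_def)

lemma ex_local_basis:
  assumes F: "finite F" "F \<subseteq> places"
  shows "\<exists>\<beta>. local_basis F \<beta>"
proof -
  have "\<exists>b. b \<noteq> 0 \<and> w b = int s \<and> (\<forall>v\<in>F - {w}. val_ge v b (int (ram v)))" if w: "w \<in> F" for w s
  proof -
    have wp: "w \<in> places" using w F by auto
    interpret w: discrete_val w by (rule places_valuation[OF wp])
    obtain t where t: "t \<noteq> 0" "w t = int s" using w.ex_val_eq by blast
    \<comment> \<open>The precision has to compensate the possible poles of \<open>t\<close> at the
      other places.\<close>
    define m where "m = 1 + (\<Sum>v\<in>F. int (ram v) + \<bar>v t\<bar>)"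
    have m1: "m \<ge> 1" by (auto simp: m_def intro!: sum_nonneg)
    obtain h where h: "val_ge w (h - 1) m" "\<forall>v\<in>F - {w}. val_ge v h m"
      using ex_approx_idempotent[of "F - {w}" w m] F wp by auto
    have "h \<noteq> 0 \<and> w h = 0"
      using w.val_add_eq[of 1 "h - 1"] val_ge_mono[OF h(1)] m1 by simp
    then have "h * t \<noteq> 0" "w (h * t) = int s" using t by (simp_all add: w.val_mult)
    moreover have "val_ge v (h * t) (int (ram v))" if v: "v \<in> F - {w}" for v
    proof -
      interpret v: discrete_val v using v F by (intro places_valuation) auto
      have "val_ge v (h * t) (m + v t)"
        using h(2) v by (intro v.val_ge_mult) (auto simp: val_ge_def)
      moreover have "int (ram v) + \<bar>v t\<bar> \<le> (\<Sum>v\<in>F. int (ram v) + \<bar>v t\<bar>)"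
        using v F by (intro member_le_sum) auto
      ultimately show ?thesis by (elim val_ge_mono) (simp add: m_def)
    qed
    ultimately show ?thesis by blast
  qed
  then obtain b where "\<And>w s. w \<in> F \<Longrightarrow> b w s \<noteq> 0 \<and> w (b w s) = int s \<and> (\<forall>v\<in>F - {w}. val_ge v (b w s) (int (ram v)))"
    by metis
  then show ?thesis
    unfolding local_basis_def by (intro exI[of _ "\<lambda>(w, s). b w s"] ballI allI impI) (unfold split_conv, blast)
qed

text \<open>Among the terms whose coefficient has the largest degree \<open>M\<close>, take a place
  \<open>w\<close> and the least \<open>s\<close> occurring there. At \<open>w\<close> this is the
  unique term of least valuation: terms from other places or of lower degree gain at least
  \<open>ram w\<close>, which exceeds \<open>s\<close>, and the remaining ones have larger
  \<open>s\<close>. So nothing cancels, and the valuation of the sum bounds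
  \<open>M\<close>.\<close>

lemma local_basis_orthogonal:
  assumes F: "finite F" "F \<subseteq> places" and \<beta>: "local_basis F \<beta>"
    and z: "\<And>w. w \<in> F \<Longrightarrow> val_ge w (\<Sum>i\<in>local_index F. emb (q i) * \<beta> i) (- int (ram w) * d)"
    and i: "i \<in> local_index F"
  shows "deg_le (q i) d"
proof (rule ccontr)
  assume bad: "\<not> deg_le (q i) d"
  define S where "S = {i \<in> local_index F. q i \<noteq> 0}"
  define M where "M = Max ((\<lambda>i. fract_degree (q i)) ` S)"
  have S: "finite S" "i \<in> S" using bad i F by (auto simp: S_def finite_local_index)
  have M_ge: "j \<in> S \<Longrightarrow> fract_degree (q j) \<le> M" for j
    unfolding M_def using S by (intro Max_ge) auto
  have dM: "d < M" using M_ge[OF S(2)] bad by (simp add: deg_le_def)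
  have "M \<in> (\<lambda>i. fract_degree (q i)) ` S"
    unfolding M_def using S by (intro Max_in) auto
  then obtain w s0 where ws0: "(w, s0) \<in> S" "fract_degree (q (w, s0)) = M" by auto
  define s where "s = (LEAST s. (w, s) \<in> S \<and> fract_degree (q (w, s)) = M)"
  have s: "(w, s) \<in> S" "fract_degree (q (w, s)) = M"
    unfolding s_def using LeastI[of "\<lambda>s. (w, s) \<in> S \<and> fract_degree (q (w, s)) = M"] ws0 by auto
  have s_min: "s \<le> s'" if "(w, s') \<in> S" "fract_degree (q (w, s')) = M" for s'
    unfolding s_def using that by (intro Least_le) auto
  have w: "w \<in> F" "w \<in> places" "s < ram w" using s(1) F by (auto simp: S_def local_index_def)
  interpret w: discrete_val w by (rule places_valuation[OF w(2)])
  define e where "e = int (ram w)"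
  have e: "e > 0" "int s < e" using ram_pos[OF w(2)] w(3) by (simp_all add: e_def)
  have \<beta>w: "\<beta> (w, s') \<noteq> 0 \<and> w (\<beta> (w, s')) = int s'" if "s' < ram w" for s'
    using \<beta> w(1) that by (auto simp: local_basis_def)
  define t where "t = emb (q (w, s)) * \<beta> (w, s)"
  have t: "t \<noteq> 0" "w t = - e * M + int s"
    using s \<beta>w[OF w(3)] by (auto simp: t_def w.val_mult val_emb[OF w(2)] e_def S_def)
  define r where "r = (\<Sum>i\<in>local_index F - {(w, s)}. emb (q i) * \<beta> i)"
  have eq: "(\<Sum>i\<in>local_index F. emb (q i) * \<beta> i) = t + r"
    unfolding r_def t_def using s(1) F by (intro sum.remove) (simp_all add: S_def finite_local_index)
  have "val_ge w r (w t + 1)"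
    unfolding r_def
  proof (intro w.val_ge_sum)
    fix j assume j: "j \<in> local_index F - {(w, s)}"
    show "val_ge w (emb (q j) * \<beta> j) (w t + 1)"
    proof (cases "j \<in> S")
      case False
      with j show ?thesis by (auto simp: S_def)
    next
      case True
      obtain v s' where vs: "j = (v, s')" by (cases j)
      have dj: "fract_degree (q j) \<le> M" using M_ge True by blast
      have emb_ge: "val_ge w (emb (q j)) (- e * fract_degree (q j))"
        unfolding e_def by (rule val_ge_emb[OF w(2)]) (simp add: deg_le_def)
      show ?thesis
      proof (cases "v = w")
        case False
        then have "val_ge w (\<beta> j) e"
          using \<beta> w(1) j by (auto simp: local_basis_def local_index_def vs e_def)
        from w.val_ge_mult[OF emb_ge this] show ?thesis
        proof (rule val_ge_mono)
          have "e * fract_degree (q j) \<le> e * M" using dj e by (intro mult_left_mono) auto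
          with t e show "w t + 1 \<le> - e * fract_degree (q j) + e" by linarith
        qed
      next
        case vw: True
        have s': "s' < ram w" using j by (simp add: vs vw local_index_def)
        have "val_ge w (\<beta> j) (int s')"
          using \<beta>w[OF s'] by (simp add: vs vw val_ge_def)
        from w.val_ge_mult[OF emb_ge this] show ?thesis
        proof (rule val_ge_mono)
          show "w t + 1 \<le> - e * fract_degree (q j) + int s'"
          proof (cases "fract_degree (q j) = M")
            case True
            then have "s \<le> s'" using s_min \<open>j \<in> S\<close> by (simp add: vs vw)
            moreover have "s \<noteq> s'" using j by (auto simp: vs vw)
            ultimately show ?thesis using t True by simp
          next
            case False
            with dj have "fract_degree (q j) \<le> M - 1" by simp
            then have "e * fract_degree (q j) \<le> e * (M - 1)" using e by (intro mult_left_mono) auto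
            then show ?thesis using t e by (simp add: algebra_simps)
          qed
        qed
      qed
    qed
  qed
  from w.val_add_eq[OF t(1) this] have "t + r \<noteq> 0" "w (t + r) = w t" by auto
  with z[OF w(1)] have "- e * d \<le> - e * M + int s"
    unfolding eq using t by (simp add: val_ge_def e_def)
  moreover have "e * (d + 1) \<le> e * M" using dM e by (intro mult_left_mono) auto
  ultimately show False using e by (simp add: algebra_simps)
qed

lemma local_basis_independent:
  assumes F: "finite F" "F \<subseteq> places" and \<beta>: "local_basis F \<beta>"
    and z: "(\<Sum>i\<in>local_index F. emb (q i) * \<beta> i) = 0" and i: "i \<in> local_index F"
  shows "q i = 0"
proof (rule ccontr)
  assume "q i \<noteq> 0"
  moreover have "deg_le (q i) (fract_degree (q i) - 1)"
    using local_basis_orthogonal[OF F \<beta> _ i] z by simp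
  ultimately show False by (simp add: deg_le_def)
qed

lemma local_basis_inj_independent:
  assumes F: "finite F" "F \<subseteq> places" and \<beta>: "local_basis F \<beta>"
  shows "inj_on \<beta> (local_index F)" "independent (\<beta> ` local_index F)"
proof -
  show inj: "inj_on \<beta> (local_index F)"
  proof (rule inj_onI, rule ccontr)
    fix i j assume ij: "i \<in> local_index F" "j \<in> local_index F" "\<beta> i = \<beta> j" "i \<noteq> j"
    define q :: "_ \<Rightarrow> 'k poly fract" where "q = (\<lambda>k. if k = i then 1 else if k = j then - 1 else 0)"
    have "(\<Sum>k\<in>local_index F. emb (q k) * \<beta> k) = (\<Sum>k\<in>{i, j}. emb (q k) * \<beta> k)"
      using ij F by (intro sum.mono_neutral_right) (auto simp: q_def finite_local_index)
    also have "\<dots> = 0" using ij by (simp add: q_def hom_uminus)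
    finally have "q i = 0" using local_basis_independent[OF F \<beta> _ ij(1)] by blast
    then show False by (simp add: q_def)
  qed
  show "independent (\<beta> ` local_index F)"
  proof (rule independent_if_scalars_zero)
    fix f x assume *: "(\<Sum>x\<in>\<beta> ` local_index F. emb (f x) * x) = 0" and x: "x \<in> \<beta> ` local_index F"
    have "(\<Sum>i\<in>local_index F. emb (f (\<beta> i)) * \<beta> i) = 0"
      using * by (simp add: sum.reindex[OF inj])
    from local_basis_independent[OF F \<beta> this] x show "f x = 0" by auto
  qed (simp add: F finite_local_index)
qed

text \<open>A finite set of places yields at least as many independent elements, one
  \<open>\<beta> (w, 0)\<close> for each place.\<close>

lemma finite_places: "finite places"
proof -
  have "card F \<le> ext_degree" if F: "finite F" "F \<subseteq> places" for F
  proof -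
    obtain \<beta> where \<beta>: "local_basis F \<beta>" using ex_local_basis[OF F] by blast
    have "card F = card ((\<lambda>w. (w, 0::nat)) ` F)"
      by (intro card_image[symmetric] inj_onI) simp
    also have "\<dots> \<le> card (local_index F)"
      using F ram_pos by (intro card_mono) (auto simp: local_index_def)
    also have "\<dots> = card (\<beta> ` local_index F)"
      using local_basis_inj_independent(1)[OF F \<beta>] by (simp add: card_image)
    also have "\<dots> \<le> ext_degree"
      using independent_card_le local_basis_inj_independent(2)[OF F \<beta>] by blast
    finally show ?thesis .
  qed
  then show ?thesis
    using finite_if_finite_subsets_card_bdd[of places ext_degree] by simp
qed

end

section \<open>Integral elements have bounded powers\<close>

lemma det_in_subring:
  assumes A: "is_subring A" and M: "M \<in> carrier_mat n n"
    and entries: "\<And>i j. i < n \<Longrightarrow> j < n \<Longrightarrow> M $$ (i, j) \<in> A"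
  shows "det M \<in> A"
  unfolding det_def'[OF M]
proof (intro subring_sum[OF A])
  fix p assume "p \<in> {p. p permutes {0..<n}}"
  then have "(\<Prod>i = 0..<n. M $$ (i, p i)) \<in> A"
    using entries permutes_in_image[of p] by (intro subring_prod[OF A]) auto
  then show "signof p * (\<Prod>i = 0..<n. M $$ (i, p i)) \<in> A"
    using subring_minus[OF A] by (cases rule: sign_cases[of p]) auto
qed

lemma ex_common_denominator:
  assumes A: "is_subring A" and denom: "\<And>q. \<exists>D\<in>A. D \<noteq> 0 \<and> D * q \<in> A" and "finite S"
  shows "\<exists>D\<in>A. D \<noteq> 0 \<and> (\<forall>q\<in>S. D * q \<in> A)"
  using assms(3)
proof induction
  case empty
  show ?case using subring_1[OF A] by (intro bexI[of _ 1]) auto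
next
  case (insert q S)
  then obtain D where D: "D \<in> A" "D \<noteq> 0" "\<forall>q\<in>S. D * q \<in> A" by blast
  obtain E where E: "E \<in> A" "E \<noteq> 0" "E * q \<in> A" using denom by blast
  have "D * E * r \<in> A" if "r \<in> insert q S" for r
  proof (cases "r = q")
    case True
    then show ?thesis using subring_mult[OF A D(1) E(3)] by (simp add: mult.assoc)
  next
    case False
    with D(3) that have "E * (D * r) \<in> A" using subring_mult[OF A E(1)] by auto
    then show ?thesis by (simp add: mult_ac)
  qed
  then show ?case
    using D E subring_mult[OF A] by (intro bexI[of _ "D * E"]) auto
qed

lemma nonpos_if_multiples_bounded:
  fixes c d :: int
  assumes "\<And>m::nat. c + int m * d \<le> 0"
  shows "d \<le> 0"
proof (rule ccontr)
  assume "\<not> d \<le> 0"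
  define k where "k = nat (\<bar>c\<bar> + 1)"
  have "int k * 1 \<le> int k * d"
    using \<open>\<not> d \<le> 0\<close> by (intro mult_left_mono) auto
  with assms[of k] have "c + int k \<le> 0" by linarith
  then show False by (simp add: k_def)
qed

lemma ex_max_on:
  fixes f :: "'i \<Rightarrow> int"
  assumes "finite S" "S \<noteq> {}"
  shows "\<exists>x\<in>S. \<forall>y\<in>S. f y \<le> f x"
proof -
  have "Max (f ` S) \<in> f ` S" using assms by simp
  then obtain x where "x \<in> S" "f x = Max (f ` S)" by force
  with assms show ?thesis by (intro bexI[of _ x]) auto
qed

context finite_field_extension
begin

text \<open>Almost integrality over \<open>A\<close>: one denominator serves the multiplication
  matrices of all powers of \<open>x\<close>.\<close>

definition bounded_powers :: "'f set \<Rightarrow> 'l list \<Rightarrow> 'l \<Rightarrow> bool" where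
  "bounded_powers A bs x \<longleftrightarrow> (\<exists>D\<in>A. D \<noteq> 0 \<and>
     (\<forall>m. \<forall>i<length bs. \<forall>j<length bs. D * coord bs (x ^ m * bs ! j) i \<in> A))"

text \<open>A common denominator for the powers below the degree \<open>d\<close> of the integral
  equation serves all higher powers by recursion.\<close>

lemma integral_bounded_powers:
  assumes A: "is_subring A" and denom: "\<And>q. \<exists>D\<in>A. D \<noteq> 0 \<and> D * q \<in> A"
    and bs: "basis_list bs" and x: "integral_over (emb ` A) x"
  shows "bounded_powers A bs x"
proof -
  obtain d a where a: "\<forall>i. a i \<in> emb ` A" "x ^ d = (\<Sum>i<d. a i * x ^ i)"
    using x by (auto simp: integral_over_def)
  then obtain b where b: "\<And>i. b i \<in> A" "\<And>i. a i = emb (b i)"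
    by (auto simp: image_iff) metis
  let ?S = "(\<lambda>(k, i, j). coord bs (x ^ k * bs ! j) i) ` ({..<d} \<times> {..<length bs} \<times> {..<length bs})"
  obtain D where D: "D \<in> A" "D \<noteq> 0" "\<forall>q\<in>?S. D * q \<in> A"
    using ex_common_denominator[OF A denom, of ?S] by blast
  have "D * coord bs (x ^ m * bs ! j) i \<in> A" if ij: "i < length bs" "j < length bs" for m i j
  proof (induction m rule: less_induct)
    case (less m)
    show ?case
    proof (cases "m < d")
      case True
      with ij D(3) show ?thesis by force
    next
      case False
      then have "x ^ m = (\<Sum>k<d. emb (b k) * x ^ (k + (m - d)))"
      proof -
        have "x ^ m = x ^ d * x ^ (m - d)"
          using False by (simp flip: power_add)
        then show ?thesis
          by (simp only: a(2) b sum_distrib_right mult.assoc power_add)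
      qed
      then have "D * coord bs (x ^ m * bs ! j) i = (\<Sum>k<d. b k * (D * coord bs (x ^ (k + (m - d)) * bs ! j) i))"
        by (simp add: sum_distrib_right mult.assoc coord_sum[OF bs] coord_scale[OF bs] sum_distrib_left)
           (simp add: mult.left_commute)
      also have "\<dots> \<in> A"
        by (intro subring_sum[OF A] subring_mult[OF A b(1)] less.IH) (use False in auto)
      finally show ?thesis .
    qed
  qed
  with D show ?thesis unfolding bounded_powers_def by blast
qed

text \<open>The norm of \<open>x ^ m\<close> is a determinant, so a fixed power of the common
  denominator works for all \<open>m\<close>. Control of all powers up to a fixed factor is enough
  to determine the sign of a degree.\<close>

lemma bounded_powers_norm:
  assumes A: "is_subring A" and bs: "basis_list bs" and x: "bounded_powers A bs x"
  shows "\<exists>D. D \<noteq> 0 \<and> (\<forall>m. D * ext_norm x ^ m \<in> A)"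
proof -
  obtain D where D: "D \<noteq> 0"
    "\<And>m i j. i < length bs \<Longrightarrow> j < length bs \<Longrightarrow> D * coord bs (x ^ m * bs ! j) i \<in> A"
    using x by (auto simp: bounded_powers_def)
  have "D ^ length bs * ext_norm x ^ m \<in> A" for m
  proof -
    have "D ^ length bs * ext_norm x ^ m = det (D \<cdot>\<^sub>m mult_mat bs (x ^ m))"
      unfolding det_smult ext_norm_eq_det[OF bs, symmetric] ext_norm_power
      by (simp add: mult_mat_def)
    also have "\<dots> \<in> A"
      using D(2) by (intro det_in_subring[OF A, of _ "length bs"]) (auto simp: mult_mat_def coord_def)
    finally show ?thesis .
  qed
  with D(1) show ?thesis by (intro exI[of _ "D ^ length bs"]) auto
qed

lemma basis_list_update:
  assumes bs: "basis_list bs" and i: "i < length bs" "q i \<noteq> 0"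
  shows "basis_list (bs[i := lin_comb bs q])"
proof (rule basis_listI)
  fix f k assume f: "lin_comb (bs[i := lin_comb bs q]) f = 0" and k: "k < length (bs[i := lin_comb bs q])"
  define g where "g = (\<lambda>j. (if j = i then 0 else f j) + f i * q j)"
  have "lin_comb (bs[i := lin_comb bs q]) f =
      (\<Sum>j<length bs. emb (if j = i then 0 else f j) * bs ! j + (if j = i then emb (f i) * lin_comb bs q else 0))"
    unfolding lin_comb_def[of "bs[i := lin_comb bs q]"] length_list_update
    by (intro sum.cong refl) (auto simp: nth_list_update)
  also have "\<dots> = lin_comb bs (\<lambda>j. if j = i then 0 else f j) + emb (f i) * lin_comb bs q"
    using i by (simp add: sum.distrib lin_comb_def)
  also have "\<dots> = lin_comb bs g"
    by (simp add: g_def lin_comb_add lin_comb_scale)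
  finally have "lin_comb bs g = 0" using f by simp
  then have g: "g j = 0" if "j < length bs" for j
    using coord_lin_comb[OF bs that, of g] by (simp add: coord_0)
  from g[OF i(1)] i(2) have "f i = 0" by (simp add: g_def)
  with g[of k] k show "f k = 0" by (auto simp: g_def split: if_splits)
qed (use bs in \<open>simp add: length_basis_list\<close>)

end

section \<open>Reduced bases\<close>

lemma to_fract_power: "to_fract (p ^ m) = to_fract p ^ m"
  by (induction m) simp_all

lemma fract_const_T_powi_in_range:
  assumes "m \<ge> 0"
  shows "fract_const c * fract_T powi m \<in> range to_fract"
proof -
  have "fract_const c * fract_T powi m = to_fract ([:c:] * [:0, 1:] ^ nat m)"
    unfolding to_fract_mult to_fract_power
    using assms by (simp add: fract_const_def fract_T_def power_int_def)
  then show ?thesis by blast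
qed

lemma is_subring_polys: "is_subring (range (to_fract :: 'a::field poly \<Rightarrow> _))"
  unfolding is_subring_def
  by (auto simp flip: to_fract_diff to_fract_mult) (metis rangeI to_fract_1)

lemma is_subring_deg_le_0: "is_subring {q :: 'a::field poly fract. deg_le q 0}"
  unfolding is_subring_def using deg_le_mult[of _ 0 _ 0] by (auto intro: deg_le_diff)

context alg_function_field
begin

text \<open>
  \<open>M\<close> is discrete and \<open>R\<close> is the unit ball of a norm. A basis of \<open>K\<close> inside \<open>M\<close> whose elements have
  the smallest possible sum of norms generates \<open>M\<close> and is orthogonal: otherwise some basis element could
  be replaced by an element of \<open>M\<close> of smaller norm.
\<close>

lemma ex_reduced_basis:
  assumes M_add: "\<And>x y. x \<in> M \<Longrightarrow> y \<in> M \<Longrightarrow> x + y \<in> M"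
    and M_scale: "\<And>p x. x \<in> M \<Longrightarrow> emb (to_fract p) * x \<in> M"
    and R_add: "\<And>x y. x \<in> R \<Longrightarrow> y \<in> R \<Longrightarrow> x + y \<in> R"
    and R_scale: "\<And>q x. x \<in> R \<Longrightarrow> deg_le q 0 \<Longrightarrow> emb q * x \<in> R"
    and R_absorb: "\<And>x. \<exists>s. emb (fract_T powi (- s)) * x \<in> R"
    and basis: "basis_list bs" "set bs \<subseteq> M"
    and bound: "\<And>x s. x \<in> M \<Longrightarrow> x \<noteq> 0 \<Longrightarrow> emb (fract_T powi (- s)) * x \<in> R \<Longrightarrow> B \<le> s"
  shows "\<exists>ys a. basis_list ys \<and>
    (\<forall>q. lin_comb ys q \<in> M \<longleftrightarrow> (\<forall>i<length ys. q i \<in> range to_fract)) \<and>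
    (\<forall>q. lin_comb ys q \<in> R \<longleftrightarrow> (\<forall>i<length ys. deg_le (q i) (- a i)))"
proof -
  \<comment> \<open>\<open>L s x\<close> expresses that the norm with unit ball \<open>R\<close> is
    at most \<open>s\<close> at \<open>x\<close>.\<close>
  define L where "L = (\<lambda>s x. emb (fract_T powi (- s)) * x \<in> R)"
  have L0: "L s 0" for s
    using R_absorb[of 0] by (simp add: L_def)
  have L_add: "L s x \<Longrightarrow> L s y \<Longrightarrow> L s (x + y)" for s x y
    by (simp add: L_def ring_distribs R_add)
  have L_scale: "L s' (emb q * x)" if "L s x" "deg_le q (s' - s)" for s s' q x
  proof -
    have "emb (fract_T powi (- s')) * (emb q * x)
        = emb (fract_T powi (s - s') * q) * (emb (fract_T powi (- s)) * x)"
    proof -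
      have "fract_T powi (- s') = (fract_T powi (s - s') * fract_T powi (- s) :: 'k poly fract)"
        using power_int_add[of "fract_T :: 'k poly fract" "s - s'" "- s"] by simp
      then have "fract_T powi (- s') * q = (fract_T powi (s - s') * q) * fract_T powi (- s)"
        by (simp only: mult_ac)
      then show ?thesis by (metis hom_mult mult.assoc)
    qed
    moreover have "deg_le (fract_T powi (s - s') * q) 0"
      using that(2) by (simp add: deg_le_T_powi_mult_iff)
    ultimately show ?thesis using that(1) R_scale unfolding L_def by metis
  qed
  have L_mono: "L s' x" if "L s x" "s \<le> s'" for s s' x
    using L_scale[of s x 1 s'] that by (simp add: deg_le_def)
  have L_sum: "(\<And>i. i \<in> I \<Longrightarrow> L s (f i)) \<Longrightarrow> L s (sum f I)" for s I and f :: "nat \<Rightarrow> 'l"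
    by (induction I rule: infinite_finite_induct) (auto simp: L0 intro: L_add)
  \<comment> \<open>The norm, counted from \<open>B\<close> so as to be a natural number. On nonzero
    elements of \<open>M\<close> this truncation loses nothing.\<close>
  define k where "k = (\<lambda>x. LEAST k. L (B + int k) x)"
  define r where "r = (\<lambda>x. B + int (k x))"
  have L_r: "L (r x) x" for x
  proof -
    obtain s where "L s x" using R_absorb[of x] by (auto simp: L_def)
    then have "L (B + int (nat (s - B))) x" by (rule L_mono) simp
    then show ?thesis unfolding r_def k_def by (rule LeastI)
  qed
  have r_le: "r x \<le> s" if "x \<in> M" "x \<noteq> 0" "L s x" for x s
  proof -
    have "B \<le> s" using bound that by (simp add: L_def)
    then have "k x \<le> nat (s - B)"
      unfolding k_def using that by (intro Least_le) simp
    then show ?thesis using \<open>B \<le> s\<close> by (simp add: r_def)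
  qed
  define size where "size = (\<lambda>ys. \<Sum>i<length ys. k (ys ! i))"
  obtain ys where ys: "basis_list ys" "set ys \<subseteq> M"
    and min: "\<And>zs. basis_list zs \<Longrightarrow> set zs \<subseteq> M \<Longrightarrow> size ys \<le> size zs"
    using ex_has_least_nat[of "\<lambda>ys. basis_list ys \<and> set ys \<subseteq> M" bs size] basis by blast
  define n where "n = length ys"
  have ysM: "i < n \<Longrightarrow> ys ! i \<in> M" for i
    using ys(2) by (auto simp: n_def)
  have M0: "0 \<in> M"
    using M_scale[of "ys ! 0" 0] ysM[of 0] length_basis_list[OF ys(1)] ext_degree_pos by (simp add: n_def)
  have M_sum: "(\<And>i. i \<in> I \<Longrightarrow> f i \<in> M) \<Longrightarrow> sum f I \<in> M" for I and f :: "nat \<Rightarrow> 'l"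
    by (induction I rule: infinite_finite_induct) (auto simp: M0 intro: M_add)
  have M_comb: "lin_comb ys q \<in> M" if "\<And>i. i < n \<Longrightarrow> q i \<in> range to_fract" for q
    unfolding lin_comb_def
  proof (intro M_sum)
    fix i assume "i \<in> {..<length ys}"
    then have "i < n" by (simp add: n_def)
    with that obtain p where "q i = to_fract p" by blast
    then show "emb (q i) * ys ! i \<in> M" using M_scale[OF ysM[OF \<open>i < n\<close>]] by simp
  qed
  define a where "a = (\<lambda>i. r (ys ! i))"
  \<comment> \<open>Replacing \<open>ys ! i\<close> by a combination in which it occurs gives
    another basis inside \<open>M\<close>, so by minimality the combination has no smaller norm than
    \<open>ys ! i\<close>.\<close>
  have exchange: "a i \<le> s" if y: "lin_comb ys q \<in> M" "i < n" "q i \<noteq> 0" "L s (lin_comb ys q)" for q i s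
  proof -
    let ?y = "lin_comb ys q"
    have y0: "?y \<noteq> 0"
      using coord_lin_comb[OF ys(1), of i q] y(2,3) by (auto simp: n_def coord_0)
    have "size ys \<le> size (ys[i := ?y])"
      using ys y by (intro min basis_list_update) (auto simp: n_def dest: subsetD[OF set_update_subset_insert])
    also have "size (ys[i := ?y]) = (\<Sum>j\<in>{..<n} - {i}. k (ys ! j)) + k ?y"
      using y(2) unfolding size_def by (subst sum.remove[of _ i]) (auto simp: n_def)
    also have "size ys = (\<Sum>j\<in>{..<n} - {i}. k (ys ! j)) + k (ys ! i)"
      using y(2) unfolding size_def by (subst sum.remove[of _ i]) (auto simp: n_def)
    finally have "a i \<le> r ?y" by (simp add: a_def r_def)
    also have "\<dots> \<le> s" using y y0 by (intro r_le)
    finally show ?thesis .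
  qed
  have L_comb: "L s (lin_comb ys q)" if "\<And>i. i < n \<Longrightarrow> deg_le (q i) (s - a i)" for s q
    unfolding lin_comb_def
  proof (intro L_sum)
    fix i assume "i \<in> {..<length ys}"
    then show "L s (emb (q i) * ys ! i)"
      using that[of i] L_scale[OF L_r[of "ys ! i"], of "q i" s] by (simp add: n_def a_def)
  qed
  have gen: "q i \<in> range to_fract" if q: "lin_comb ys q \<in> M" and i: "i < n" for q i
  proof -
    have "\<forall>i. \<exists>p. deg_le (q i - to_fract p) (-1)"
      using ex_poly_part by blast
    then obtain p where p: "\<And>i. deg_le (q i - to_fract (p i)) (-1)"
      by metis
    define f where "f = (\<lambda>i. q i - to_fract (p i))"
    have "lin_comb ys f = lin_comb ys q + lin_comb ys (\<lambda>i. to_fract (- p i))"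
      unfolding lin_comb_add[symmetric] by (simp add: f_def)
    moreover have "lin_comb ys (\<lambda>i. to_fract (- p i)) \<in> M" by (intro M_comb) blast
    ultimately have fM: "lin_comb ys f \<in> M" using q M_add by simp
    have "f i = 0"
    proof (rule ccontr)
      assume "f i \<noteq> 0"
      then have "\<exists>j\<in>{i. i < n \<and> f i \<noteq> 0}. \<forall>i\<in>{i. i < n \<and> f i \<noteq> 0}. a i \<le> a j"
        using i by (intro ex_max_on) auto
      then obtain j where j: "j < n" "f j \<noteq> 0" "\<And>i. i < n \<Longrightarrow> f i \<noteq> 0 \<Longrightarrow> a i \<le> a j"
        by auto
      \<comment> \<open>All coefficients of \<open>f\<close> have degree at most -1, and
        \<open>a j\<close> is the largest norm of a basis element that occurs.\<close>
      have "L (a j - 1) (lin_comb ys f)"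
      proof (intro L_comb)
        fix i assume "i < n"
        then show "deg_le (f i) (a j - 1 - a i)"
          using p[of i] j(3)[of i] by (cases "f i = 0") (auto simp: f_def elim: deg_le_mono)
      qed
      from exchange[OF fM j(1,2) this] show False by simp
    qed
    then show ?thesis by (auto simp: f_def)
  qed
  have orth: "deg_le (q i) (- a i)" if q: "lin_comb ys q \<in> R" and i: "i < n" for q i
  proof (rule ccontr)
    assume bad: "\<not> deg_le (q i) (- a i)"
    define S0 where "S0 = {j. j < n \<and> q j \<noteq> 0}"
    define s where "s = Max ((\<lambda>j. fract_degree (q j) + a j) ` S0)"
    have S0: "finite S0" "i \<in> S0" using bad i by (auto simp: S0_def)
    have s_ge: "j \<in> S0 \<Longrightarrow> fract_degree (q j) + a j \<le> s" for j
      unfolding s_def using S0 by (intro Max_ge) auto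
    have s1: "s \<ge> 1" using s_ge[OF S0(2)] bad by (simp add: deg_le_def)
    define S where "S = {j \<in> S0. fract_degree (q j) + a j = s}"
    have "s \<in> (\<lambda>j. fract_degree (q j) + a j) ` S0"
      unfolding s_def using S0 by (intro Max_in) auto
    then have "S \<noteq> {}" "finite S" using S0 by (auto simp: S_def)
    \<comment> \<open>Among the terms of largest norm, the one with largest \<open>a l\<close> has
      the coefficient of smallest degree \<open>d\<close>. Dividing the leading terms by
      \<open>T ^ d\<close> therefore leaves them polynomial.\<close>
    then obtain l where l: "l \<in> S" "\<And>j. j \<in> S \<Longrightarrow> a j \<le> a l"
      using ex_max_on[of S a] by blast
    have "\<exists>c. c \<noteq> 0 \<and> deg_le (q j - fract_const c * fract_T powi fract_degree (q j)) (fract_degree (q j) - 1)"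
      if "j \<in> S" for j
      using that by (intro ex_leading_term) (auto simp: S_def S0_def)
    then obtain c where c: "\<And>j. j \<in> S \<Longrightarrow> c j \<noteq> 0"
      "\<And>j. j \<in> S \<Longrightarrow> deg_le (q j - fract_const (c j) * fract_T powi fract_degree (q j)) (fract_degree (q j) - 1)"
      by metis
    define d where "d = fract_degree (q l)"
    have da: "d + a l = s" using l by (simp add: S_def d_def)
    define f where "f = (\<lambda>j. if j \<in> S then fract_const (c j) * fract_T powi (fract_degree (q j) - d) else 0)"
    define g where "g = (\<lambda>j. fract_T powi (- d) * q j - f j)"
    have fM: "lin_comb ys f \<in> M"
    proof (intro M_comb)
      fix j
      have "fract_degree (q j) - d \<ge> 0" if "j \<in> S"
        using l(2)[OF that] that da by (simp add: S_def)
      then show "f j \<in> range to_fract"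
        unfolding f_def using fract_const_T_powi_in_range[of "fract_degree (q j) - d" "c j"]
        by (cases "j \<in> S") (auto intro: range_eqI[of _ _ 0])
    qed
    \<comment> \<open>After division by \<open>T ^ d\<close> the given element has norm at most
      \<open>- d = a l - s\<close>, which is below \<open>a l\<close>, and so has the part
      \<open>g\<close> without the leading terms. Hence the leading terms alone form an element of
      \<open>M\<close> that contradicts minimality.\<close>
    have "L (a l - 1) (lin_comb ys g)"
    proof (intro L_comb)
      fix j assume j: "j < n"
      show "deg_le (g j) (a l - 1 - a j)"
      proof (cases "j \<in> S")
        case True
        have "g j = fract_T powi (- d) * (q j - fract_const (c j) * fract_T powi fract_degree (q j))"
        proof -
          have "fract_T powi (fract_degree (q j) - d) = (fract_T powi (- d) * fract_T powi fract_degree (q j) :: 'k poly fract)"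
            using power_int_add[of "fract_T :: 'k poly fract" "- d" "fract_degree (q j)"] by simp
          with True show ?thesis
            by (simp only: g_def f_def if_True right_diff_distrib mult.left_commute)
        qed
        then show ?thesis
          using True c(2)[OF True] da by (auto simp: deg_le_T_powi_mult_iff S_def elim!: deg_le_mono)
      next
        case False
        show ?thesis
        proof (cases "q j = 0")
          case False
          then have "fract_degree (q j) + a j \<le> s - 1"
            using s_ge[of j] j \<open>j \<notin> S\<close> by (auto simp: S_def S0_def)
          with \<open>j \<notin> S\<close> da show ?thesis
            by (simp add: g_def f_def deg_le_T_powi_mult_iff) (simp add: deg_le_def)
        qed (use False in \<open>simp add: g_def f_def\<close>)
      qed
    qed
    then have "L (a l - 1) (emb (- 1) * lin_comb ys g)"
      by (rule L_scale) (simp add: hom_uminus)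
    moreover have "L (a l - 1) (emb (fract_T powi (- d)) * lin_comb ys q)"
      by (rule L_scale[of 0]) (use q s1 da in \<open>simp_all add: L_def deg_le_def\<close>)
    ultimately have "L (a l - 1) (emb (fract_T powi (- d)) * lin_comb ys q + emb (- 1) * lin_comb ys g)"
      by (intro L_add)
    also have "emb (fract_T powi (- d)) * lin_comb ys q + emb (- 1) * lin_comb ys g = lin_comb ys f"
      by (simp add: g_def lin_comb_diff lin_comb_scale hom_uminus)
    finally have "a l \<le> a l - 1"
      using l c(1)[OF l(1)] by (intro exchange[OF fM, of l]) (auto simp: f_def S_def S0_def)
    then show False by simp
  qed
  have "lin_comb ys q \<in> R" if "\<And>i. i < n \<Longrightarrow> deg_le (q i) (- a i)" for q
    using L_comb[of q 0] that by (simp add: L_def)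
  with ys(1) M_comb gen orth show ?thesis
    unfolding n_def by blast
qed

end

section \<open>The ring of integers and its analogue at infinity\<close>

lemma subring_of_nat: "is_subring A \<Longrightarrow> of_nat m \<in> A"
  by (induction m) (auto intro: subring_0 subring_add subring_1)

context finite_field_extension
begin

lemma bounded_powers_scale:
  assumes A: "is_subring A" and bs: "basis_list bs" and c: "c \<in> A" and x: "bounded_powers A bs x"
  shows "bounded_powers A bs (emb c * x)"
proof -
  obtain D where D: "D \<in> A" "D \<noteq> 0"
    "\<And>m i j. i < length bs \<Longrightarrow> j < length bs \<Longrightarrow> D * coord bs (x ^ m * bs ! j) i \<in> A"
    using x by (auto simp: bounded_powers_def)
  have "D * coord bs ((emb c * x) ^ m * bs ! j) i \<in> A" if "i < length bs" "j < length bs" for m i j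
  proof -
    have "(emb c * x) ^ m * bs ! j = emb (c ^ m) * (x ^ m * bs ! j)"
      by (simp only: power_mult_distrib hom_power mult.assoc)
    then have "coord bs ((emb c * x) ^ m * bs ! j) i = c ^ m * coord bs (x ^ m * bs ! j) i"
      by (simp only: coord_scale[OF bs])
    then have "D * coord bs ((emb c * x) ^ m * bs ! j) i = c ^ m * (D * coord bs (x ^ m * bs ! j) i)"
      by (simp only: mult.left_commute)
    then show ?thesis
      using subring_mult[OF A subring_power[OF A c] D(3)[OF that]] by (simp only:)
  qed
  with D show ?thesis unfolding bounded_powers_def by blast
qed

text \<open>Both closure properties rest on one fact: \<open>D * E\<close> is a denominator for all
  products \<open>x ^ k * y ^ m\<close> at once.\<close>

lemma
  assumes A: "is_subring A" and bs: "basis_list bs" and x: "bounded_powers A bs x" and y: "bounded_powers A bs y"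
  shows bounded_powers_mult: "bounded_powers A bs (x * y)"
    and bounded_powers_add: "bounded_powers A bs (x + y)"
proof -
  obtain D where D: "D \<in> A" "D \<noteq> 0"
    "\<And>m i j. i < length bs \<Longrightarrow> j < length bs \<Longrightarrow> D * coord bs (x ^ m * bs ! j) i \<in> A"
    using x by (auto simp: bounded_powers_def)
  obtain E where E: "E \<in> A" "E \<noteq> 0"
    "\<And>m i j. i < length bs \<Longrightarrow> j < length bs \<Longrightarrow> E * coord bs (y ^ m * bs ! j) i \<in> A"
    using y by (auto simp: bounded_powers_def)
  have DE: "D * E \<in> A" "D * E \<noteq> 0" using D E subring_mult[OF A] by auto
  have xy: "D * E * coord bs (x ^ k * y ^ m * bs ! j) i \<in> A" if ij: "i < length bs" "j < length bs" for k m i j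
  proof -
    have "D * E * coord bs (x ^ k * y ^ m * bs ! j) i =
        (\<Sum>l<length bs. (D * coord bs (x ^ k * bs ! l) i) * (E * coord bs (y ^ m * bs ! j) l))"
    proof -
      have "coord bs (x ^ k * y ^ m * bs ! j) i =
          (\<Sum>l<length bs. coord bs (x ^ k * bs ! l) i * coord bs (y ^ m * bs ! j) l)"
        unfolding mult.assoc[of "x ^ k" "y ^ m"] coord_mult[OF bs ij(1), of "x ^ k" "y ^ m * bs ! j"]
        using ij by (intro sum.cong refl) (simp add: mult_mat_index)
      then show ?thesis by (simp only: sum_distrib_left mult_ac)
    qed
    also have "\<dots> \<in> A"
      by (intro subring_sum[OF A] subring_mult[OF A _ E(3)] D(3)) (use ij in auto)
    finally show ?thesis .
  qed
  have "D * E * coord bs ((x * y) ^ m * bs ! j) i \<in> A" if "i < length bs" "j < length bs" for m i j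
    using xy[OF that, of m m] by (simp add: power_mult_distrib)
  with DE show "bounded_powers A bs (x * y)"
    unfolding bounded_powers_def by blast
  have "D * E * coord bs ((x + y) ^ m * bs ! j) i \<in> A" if ij: "i < length bs" "j < length bs" for m i j
  proof -
    have "(x + y) ^ m * bs ! j = (\<Sum>k\<le>m. emb (of_nat (m choose k)) * (x ^ k * y ^ (m - k) * bs ! j))"
      unfolding binomial_ring sum_distrib_right by (simp only: hom_of_nat mult.assoc)
    then have "D * E * coord bs ((x + y) ^ m * bs ! j) i =
        (\<Sum>k\<le>m. of_nat (m choose k) * (D * E * coord bs (x ^ k * y ^ (m - k) * bs ! j) i))"
      by (simp only: coord_sum[OF bs] coord_scale[OF bs] sum_distrib_left mult.left_commute[of "D * E"])
    also have "\<dots> \<in> A"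
      by (intro subring_sum[OF A] subring_mult[OF A subring_of_nat[OF A] xy[OF ij]])
    finally show ?thesis .
  qed
  with DE show "bounded_powers A bs (x + y)"
    unfolding bounded_powers_def by blast
qed

lemma basis_list_scale:
  assumes bs: "basis_list bs" and c: "\<And>i. i < length bs \<Longrightarrow> c i \<noteq> 0"
    and cs: "length cs = length bs" "\<And>i. i < length bs \<Longrightarrow> cs ! i = emb (c i) * bs ! i"
  shows "basis_list cs"
proof (rule basis_listI)
  fix f i assume f: "lin_comb cs f = 0" and i: "i < length cs"
  have "lin_comb cs f = lin_comb bs (\<lambda>i. f i * c i)"
    unfolding lin_comb_def cs(1) by (intro sum.cong refl) (simp add: cs(2) hom_mult mult.assoc)
  with f i cs(1) have "f i * c i = 0"
    using coord_lin_comb[OF bs, of i "\<lambda>i. f i * c i"] by (simp add: coord_0)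
  with c i cs(1) show "f i = 0" by simp
qed (use bs cs in \<open>simp add: length_basis_list\<close>)

end

context alg_function_field
begin

text \<open>The ring \<open>R\<close> of the overview.\<close>

definition inf_integers :: "'l set" where
  "inf_integers = {x. \<forall>w\<in>places. val_ge w x 0}"

lemma inf_integersD: "x \<in> inf_integers \<Longrightarrow> w \<in> places \<Longrightarrow> val_ge w x 0"
  by (simp add: inf_integers_def)

lemma inf_integers_add: "x \<in> inf_integers \<Longrightarrow> y \<in> inf_integers \<Longrightarrow> x + y \<in> inf_integers"
  using discrete_val.val_ge_add[OF places_valuation] by (auto simp: inf_integers_def)

lemma inf_integers_mult: "x \<in> inf_integers \<Longrightarrow> y \<in> inf_integers \<Longrightarrow> x * y \<in> inf_integers"
  using discrete_val.val_ge_mult[OF places_valuation, of _ x 0 y 0] by (auto simp: inf_integers_def)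

lemma inf_integers_emb: "deg_le q 0 \<Longrightarrow> emb q \<in> inf_integers"
  using val_ge_emb[of _ q 0] by (auto simp: inf_integers_def)

lemma inf_integers_absorb: "\<exists>s. emb (fract_T powi (- s)) * x \<in> inf_integers"
proof -
  define s where "s = (\<Sum>w\<in>places. \<bar>w x\<bar>)"
  have "val_ge w (emb (fract_T powi (- s)) * x) 0" if w: "w \<in> places" for w
  proof (cases "x = 0")
    case False
    interpret w: discrete_val w by (rule places_valuation[OF w])
    have "\<bar>w x\<bar> \<le> s" unfolding s_def using w finite_places by (intro member_le_sum) auto
    moreover have "s * 1 \<le> s * int (ram w)"
      using ram_pos[OF w] by (intro mult_left_mono) (auto simp: s_def intro: sum_nonneg)
    ultimately have "w x + int (ram w) * s \<ge> 0" by (simp add: mult.commute)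
    with False show ?thesis
      by (simp add: val_ge_def w.val_mult val_emb[OF w])
  qed simp
  then show ?thesis by (auto simp: inf_integers_def)
qed

lemma inf_integers_integral:
  assumes "x \<in> inf_integers"
  shows "integral_over inf_ring x"
  using ex_place_negative[of x] assms by (force simp: inf_integers_def val_ge_def)

text \<open>Integrality bounds the degrees of all powers of the norm by one constant, which a norm
  of positive degree would violate.\<close>

lemma norm_inf_integers:
  assumes "x \<in> inf_integers"
  shows "deg_le (ext_norm x) 0"
proof -
  obtain bs where bs: "basis_list bs" using ex_basis_list by blast
  define A where "A = {q :: 'k poly fract. deg_le q 0}"
  have A: "is_subring A" unfolding A_def by (rule is_subring_deg_le_0)
  have denom: "\<exists>D\<in>A. D \<noteq> 0 \<and> D * q \<in> A" for q
  proof -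
    define s where "s = \<bar>fract_degree q\<bar>"
    have "fract_T powi (- s) \<in> A" unfolding A_def mem_Collect_eq by (rule deg_le_mono[OF deg_le_T_powi]) (simp add: s_def)
    moreover have "fract_T powi (- s) * q \<in> A"
      by (cases "q = 0") (auto simp: A_def deg_le_def fract_degree_mult s_def)
    ultimately show ?thesis by (intro bexI[of _ "fract_T powi (- s)"]) auto
  qed
  have "inf_ring = emb ` A" by (auto simp: inf_ring_def A_def)
  with inf_integers_integral[OF assms] have "integral_over (emb ` A) x" by simp
  then obtain D where D: "D \<noteq> 0" "\<forall>m. D * ext_norm x ^ m \<in> A"
    using bounded_powers_norm[OF A bs integral_bounded_powers[OF A denom bs]] by blast
  show ?thesis
  proof (cases "ext_norm x = 0")
    case False
    have "fract_degree D + int m * fract_degree (ext_norm x) \<le> 0" for m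
      using D(2)[rule_format, of m] D(1) False
      by (simp add: A_def deg_le_def fract_degree_mult fract_degree_power)
    then show ?thesis using nonpos_if_multiples_bounded by (auto simp: deg_le_def)
  qed simp
qed

section \<open>The ring of integers as a lattice\<close>

definition base_list :: "'l list" where
  "base_list = (SOME bs. basis_list bs)"

lemma basis_base_list: "basis_list base_list"
  unfolding base_list_def by (rule some_basis_list)

text \<open>
  This turns out to be the ring of integers; unlike for integrality, closure under sums and products is
  immediate for boundedness.
\<close>

definition bounded_integers :: "'l set" where
  "bounded_integers = {x. bounded_powers (range to_fract) base_list x}"

lemma poly_denominator: "\<exists>D\<in>range to_fract. D \<noteq> 0 \<and> D * q \<in> range (to_fract :: 'k poly \<Rightarrow> _)"
proof (cases q)
  case (Fract a b)
  then have "to_fract b * q = to_fract a"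
    by (simp add: Fract_conv_to_fract)
  with Fract show ?thesis by (intro bexI[of _ "to_fract b"]) auto
qed

lemma bounded_integers_integral:
  "integral_over (emb ` range to_fract) x \<Longrightarrow> x \<in> bounded_integers"
  using integral_bounded_powers[OF is_subring_polys poly_denominator basis_base_list]
  by (simp add: bounded_integers_def)

lemma bounded_integers_add: "x \<in> bounded_integers \<Longrightarrow> y \<in> bounded_integers \<Longrightarrow> x + y \<in> bounded_integers"
  and bounded_integers_mult: "x \<in> bounded_integers \<Longrightarrow> y \<in> bounded_integers \<Longrightarrow> x * y \<in> bounded_integers"
  and bounded_integers_scale: "x \<in> bounded_integers \<Longrightarrow> emb (to_fract p) * x \<in> bounded_integers"
  by (auto simp: bounded_integers_def
      intro: bounded_powers_add[OF is_subring_polys basis_base_list]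
        bounded_powers_mult[OF is_subring_polys basis_base_list]
        bounded_powers_scale[OF is_subring_polys basis_base_list])

lemma ring_of_integers_subset_bounded: "ring_of_integers \<subseteq> bounded_integers"
proof
  fix x assume "x \<in> ring_of_integers"
  then obtain p :: "'k poly poly" where p: "lead_coeff p = 1" "poly (map_poly (\<lambda>a. emb (to_fract a)) p) x = 0"
    by (auto simp: ring_of_integers_def)
  define d where "d = degree p"
  define a where "a = (\<lambda>i. emb (to_fract (- coeff p i)))"
  let ?p = "map_poly (\<lambda>a. emb (to_fract a)) p"
  have "0 = poly (\<Sum>i\<le>d. monom (coeff ?p i) i) x"
    using p(2) degree_map_poly_le[of "\<lambda>a. emb (to_fract a)" p]
    by (simp add: poly_as_sum_of_monoms' d_def)
  also have "\<dots> = (\<Sum>i\<le>d. emb (to_fract (coeff p i)) * x ^ i)"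
    by (simp add: poly_sum poly_monom coeff_map_poly)
  also have "\<dots> = (\<Sum>i<d. emb (to_fract (coeff p i)) * x ^ i) + x ^ d"
    using p(1) by (simp add: d_def flip: lessThan_Suc_atMost)
  finally have "x ^ d = (\<Sum>i<d. a i * x ^ i)"
    by (simp add: a_def hom_uminus sum_negf eq_neg_iff_add_eq_0 add.commute)
  then have "integral_over (emb ` range to_fract) x"
    unfolding integral_over_def by (intro exI[of _ d] exI[of _ a]) (auto simp: a_def simp del: to_fract_uminus)
  then show "x \<in> bounded_integers" by (rule bounded_integers_integral)
qed

lemma ex_multiple_in_bounded_integers: "\<exists>c. c \<noteq> 0 \<and> emb c * x \<in> bounded_integers"
proof -
  obtain m a where m: "x ^ m = (\<Sum>i<m. emb (a i) * x ^ i)"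
    using ex_power_relation by blast
  have "\<exists>D\<in>range to_fract. D \<noteq> 0 \<and> (\<forall>q\<in>a ` {..<m}. D * q \<in> range to_fract)"
    by (intro ex_common_denominator[OF is_subring_polys poly_denominator]) simp
  then obtain D where D: "D \<in> range to_fract" "D \<noteq> 0" "\<And>i. i < m \<Longrightarrow> D * a i \<in> range to_fract"
    by blast
  \<comment> \<open>The coefficients of the equation of \<open>emb D * x\<close>. Since
    \<open>i < m\<close>, at least one factor \<open>D\<close> is available to clear the denominator
    of \<open>a i\<close>.\<close>
  define b where "b = (\<lambda>i. if i < m then D ^ (m - i) * a i else 0)"
  have b: "b i \<in> range to_fract" for i
  proof (cases "i < m")
    case True
    then have "b i = D ^ (m - Suc i) * (D * a i)"
      by (simp add: b_def Suc_diff_Suc flip: power_Suc2 mult.assoc)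
    also have "\<dots> \<in> range to_fract"
      by (rule subring_mult[OF is_subring_polys subring_power[OF is_subring_polys D(1)] D(3)[OF True]])
    finally show ?thesis .
  qed (auto simp: b_def intro: range_eqI[of _ _ 0])
  have "(emb D * x) ^ m = (\<Sum>i<m. emb (D ^ m * a i) * x ^ i)"
    by (simp add: power_mult_distrib m sum_distrib_left hom_mult hom_power mult.assoc)
  also have "\<dots> = (\<Sum>i<m. emb (b i) * (emb D * x) ^ i)"
  proof (intro sum.cong refl)
    fix i assume i: "i \<in> {..<m}"
    then have "D ^ m * a i = b i * D ^ i"
      by (simp add: b_def mult.left_commute mult.commute[of "a i"] flip: power_add)
    then show "emb (D ^ m * a i) * x ^ i = emb (b i) * (emb D * x) ^ i"
      by (simp only: hom_mult hom_power power_mult_distrib mult.assoc)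
  qed
  finally have "integral_over (emb ` range to_fract) (emb D * x)"
    unfolding integral_over_def using b by (intro exI[of _ m] exI[of _ "\<lambda>i. emb (b i)"]) auto
  with D(2) show ?thesis using bounded_integers_integral by blast
qed

lemma ex_basis_in_bounded_integers: "\<exists>bs. basis_list bs \<and> set bs \<subseteq> bounded_integers"
proof -
  obtain c where c: "\<And>x. c x \<noteq> 0" "\<And>x. emb (c x) * x \<in> bounded_integers"
    using ex_multiple_in_bounded_integers by metis
  define bs where "bs = map (\<lambda>x. emb (c x) * x) base_list"
  have "basis_list bs"
    using c(1) by (intro basis_list_scale[OF basis_base_list, of "\<lambda>i. c (base_list ! i)"]) (auto simp: bs_def)
  with c(2) show ?thesis by (intro exI[of _ bs]) (auto simp: bs_def)
qed

text \<open>All products \<open>D * ext_norm x ^ m\<close> are nonzero polynomials and so have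
  nonnegative degree, which excludes a norm of negative degree.\<close>

lemma norm_bounded_integers:
  assumes "x \<in> bounded_integers" "x \<noteq> 0"
  shows "fract_degree (ext_norm x) \<ge> 0"
proof -
  obtain D where D: "D \<noteq> 0" "\<forall>m. D * ext_norm x ^ m \<in> range to_fract"
    using bounded_powers_norm[OF is_subring_polys basis_base_list, of x] assms(1)
    unfolding bounded_integers_def by blast
  have N: "ext_norm x \<noteq> 0" using ext_norm_nonzero[OF assms(2)] .
  have "- fract_degree D + int m * (- fract_degree (ext_norm x)) \<le> 0" for m
  proof -
    obtain p where p: "D * ext_norm x ^ m = to_fract p" using D(2) by blast
    have "p \<noteq> 0"
    proof
      assume "p = 0"
      with p D(1) N show False by simp
    qed
    then have "fract_degree (D * ext_norm x ^ m) \<ge> 0" by (simp add: p)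
    then show ?thesis using D(1) N by (simp add: fract_degree_mult fract_degree_power)
  qed
  from nonpos_if_multiples_bounded[OF this] show ?thesis by simp
qed

lemma ex_reduced_basis_bounded_integers:
  assumes g: "g \<noteq> 0"
  shows "\<exists>ys a. basis_list ys \<and>
    (\<forall>q. lin_comb ys q \<in> bounded_integers \<longleftrightarrow> (\<forall>i<length ys. q i \<in> range to_fract)) \<and>
    (\<forall>q. lin_comb ys q / g \<in> inf_integers \<longleftrightarrow> (\<forall>i<length ys. deg_le (q i) (- a i)))"
proof -
  define R where "R = {x. x / g \<in> inf_integers}"
  obtain bs where bs: "basis_list bs" "set bs \<subseteq> bounded_integers"
    using ex_basis_in_bounded_integers by blast
  have absorb: "\<exists>s. emb (fract_T powi (- s)) * x \<in> R" for x
    using inf_integers_absorb[of "x / g"] by (simp add: R_def)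
  \<comment> \<open>Discreteness through norms: a nonzero element of the lattice has norm of degree
    at least 0, elements of \<open>g R\<close> have norm of degree at most that of
    \<open>ext_norm g\<close>, and scaling by \<open>fract_T powi (- s)\<close> shifts the degree by
    \<open>- n * s\<close>.\<close>
  have bound: "- \<bar>fract_degree (ext_norm g)\<bar> \<le> s"
    if x: "x \<in> bounded_integers" "x \<noteq> 0" "emb (fract_T powi (- s)) * x \<in> R" for x s
  proof -
    have N: "ext_norm x \<noteq> 0" "ext_norm g \<noteq> 0" using ext_norm_nonzero x g by auto
    have "ext_norm (emb (fract_T powi (- s)) * x / g) = (fract_T powi (- s)) ^ ext_degree * ext_norm x / ext_norm g"
      by (simp only: divide_inverse ext_norm_mult ext_norm_inverse ext_norm_emb)
    moreover have "deg_le (ext_norm (emb (fract_T powi (- s)) * x / g)) 0"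
      using x(3) by (intro norm_inf_integers) (simp add: R_def)
    ultimately have "deg_le ((fract_T powi (- s)) ^ ext_degree * ext_norm x / ext_norm g) 0" by simp
    then have "- (int ext_degree * s) + fract_degree (ext_norm x) - fract_degree (ext_norm g) \<le> 0"
      using N by (simp add: deg_le_def fract_degree_divide fract_degree_mult fract_degree_power)
    with norm_bounded_integers[OF x(1,2)] have ns: "int ext_degree * s \<ge> - \<bar>fract_degree (ext_norm g)\<bar>" by linarith
    show ?thesis
    proof (cases "s \<ge> 0")
      case False
      then have "int ext_degree * s \<le> 1 * s"
        using ext_degree_pos by (intro mult_right_mono_neg) auto
      with ns show ?thesis by simp
    qed simp
  qed
  have "x \<in> R \<Longrightarrow> y \<in> R \<Longrightarrow> x + y \<in> R" for x y
    using inf_integers_add by (simp add: R_def add_divide_distrib)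
  moreover have "emb q * x \<in> R" if "x \<in> R" "deg_le q 0" for q x
    using inf_integers_mult[OF inf_integers_emb[OF that(2)], of "x / g"] that(1) by (simp add: R_def)
  ultimately have "\<exists>ys a. basis_list ys \<and>
    (\<forall>q. lin_comb ys q \<in> bounded_integers \<longleftrightarrow> (\<forall>i<length ys. q i \<in> range to_fract)) \<and>
    (\<forall>q. lin_comb ys q \<in> R \<longleftrightarrow> (\<forall>i<length ys. deg_le (q i) (- a i)))"
    using bounded_integers_add bounded_integers_scale absorb bs bound
    by (intro ex_reduced_basis) (assumption | blast)+
  then show ?thesis by (simp add: R_def)
qed

text \<open>Multiplication by \<open>x\<close> has a polynomial matrix in a basis of the lattice,
  and \<open>x\<close> is an eigenvalue of it. Hence \<open>x\<close> is a root of its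
  characteristic polynomial, which is monic.\<close>

lemma ring_of_integers_eq: "ring_of_integers = bounded_integers"
proof (intro equalityI ring_of_integers_subset_bounded subsetI)
  fix x assume x: "x \<in> bounded_integers"
  obtain ys where ys: "basis_list ys"
    "\<And>q. lin_comb ys q \<in> bounded_integers \<longleftrightarrow> (\<forall>i<length ys. q i \<in> range to_fract)"
    using ex_reduced_basis_bounded_integers[of 1] by auto
  define n where "n = length ys"
  have n: "n > 0" using ext_degree_pos length_basis_list[OF ys(1)] by (simp add: n_def)
  have "coord ys (x * ys ! j) i \<in> range to_fract" if ij: "i < n" "j < n" for i j
  proof -
    have "ys ! j = lin_comb ys (\<lambda>k. if k = j then 1 else 0)"
      using ij by (simp add: lin_comb_def n_def if_distrib if_distribR cong: if_cong)
    moreover have "lin_comb ys (\<lambda>k. if k = j then 1 else 0) \<in> bounded_integers"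
      unfolding ys(2) using subring_0[OF is_subring_polys[where 'a = 'k]] subring_1[OF is_subring_polys[where 'a = 'k]] by simp
    ultimately have "ys ! j \<in> bounded_integers" by simp
    then have "lin_comb ys (coord ys (x * ys ! j)) \<in> bounded_integers"
      unfolding lin_comb_coord[OF ys(1)] using x by (intro bounded_integers_mult)
    with ys(2) ij show ?thesis by (simp add: n_def)
  qed
  then have "\<exists>p. i < n \<longrightarrow> j < n \<longrightarrow> coord ys (x * ys ! j) i = to_fract p" for i j
    by blast
  then obtain p where p: "\<And>i j. i < n \<Longrightarrow> j < n \<Longrightarrow> coord ys (x * ys ! j) i = to_fract (p i j)"
    by metis
  \<comment> \<open>The transpose of the multiplication matrix, so that the column of basis elements
    is an eigenvector.\<close>
  define P where "P = mat n n (\<lambda>(j, i). p i j)"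
  define hom where "hom = (\<lambda>a::'k poly. emb (to_fract a))"
  interpret hom: comm_ring_hom hom
    by unfold_locales (auto simp: hom_def hom_add hom_mult)
  define A where "A = map_mat hom P"
  have PA: "P \<in> carrier_mat n n" "A \<in> carrier_mat n n" by (simp_all add: P_def A_def)
  define v where "v = vec n (\<lambda>i. ys ! i)"
  have "A *\<^sub>v v = x \<cdot>\<^sub>v v"
  proof (intro eq_vecI)
    fix j assume "j < dim_vec (x \<cdot>\<^sub>v v)"
    then have j: "j < n" by (simp add: v_def)
    have "(A *\<^sub>v v) $ j = (\<Sum>i<n. hom (p i j) * ys ! i)"
      using j by (simp add: A_def P_def v_def scalar_prod_def atLeast0LessThan)
    also have "\<dots> = lin_comb ys (coord ys (x * ys ! j))"
      using j by (simp add: lin_comb_def n_def[symmetric] p hom_def)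
    finally show "(A *\<^sub>v v) $ j = (x \<cdot>\<^sub>v v) $ j"
      using j by (simp add: lin_comb_coord[OF ys(1)] v_def)
  qed (simp add: A_def P_def v_def)
  moreover have "v \<noteq> 0\<^sub>v n"
  proof
    assume "v = 0\<^sub>v n"
    then have "v $ 0 = 0" using n by simp
    then have "ys ! 0 = 0" using n by (simp add: v_def)
    moreover have "coord ys (ys ! 0) 0 = 1" using n by (simp add: coord_nth[OF ys(1)] n_def)
    ultimately show False by (simp add: coord_0)
  qed
  ultimately have "eigenvalue A x"
    unfolding eigenvalue_def eigenvector_def using PA by (intro exI[of _ v]) (auto simp: v_def)
  then have "poly (char_poly A) x = 0"
    using eigenvalue_root_char_poly[OF PA(2)] by simp
  then have "poly (map_poly hom (char_poly P)) x = 0"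
    unfolding A_def hom.char_poly_hom[OF PA(1)] .
  moreover have "lead_coeff (char_poly P) = 1"
    using degree_monic_char_poly[OF PA(1)] by simp
  ultimately show "x \<in> ring_of_integers"
    unfolding ring_of_integers_def hom_def by blast
qed

end

section \<open>Norm and trace at infinity\<close>

lemma fract_const_of_nat: "fract_const (of_nat m) = of_nat m"
  by (induction m) (simp_all add: fract_const_add)

context alg_function_field
begin

text \<open>Without places every element would belong to \<open>R\<close>, even \<open>T\<close>,
  whose norm has degree \<open>n > 0\<close>.\<close>

lemma places_nonempty: "places \<noteq> {}"
proof
  assume "places = {}"
  then have "emb fract_T \<in> inf_integers" by (simp add: inf_integers_def)
  from norm_inf_integers[OF this] show False
    using ext_degree_pos by (simp add: ext_norm_emb deg_le_def fract_degree_power)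
qed

lemma ex_linear_functional:
  assumes B: "independent B" and b: "b \<notin> span B"
  shows "\<exists>\<phi>. (\<forall>x y. \<phi> (x + y) = \<phi> x + \<phi> y) \<and> (\<forall>c x. \<phi> (emb c * x) = c * \<phi> x) \<and>
    (\<forall>x\<in>B. \<phi> x = 0) \<and> \<phi> b \<noteq> 0"
proof -
  define C where "C = extend_basis (insert b B)"
  have ind: "independent (insert b B)" using assms by (intro independent_insertI)
  have C: "independent C" "span C = UNIV" "insert b B \<subseteq> C"
    unfolding C_def using extend_basis_superset[OF ind] independent_extend_basis[OF ind]
      span_extend_basis[OF ind] by auto
  have "b \<notin> B" using b span_base by blast
  then have "\<forall>x\<in>B. representation C x b = 0" "representation C b b \<noteq> 0"
    using C(3) by (auto simp: representation_basis[OF C(1)])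
  then show ?thesis
    by (intro exI[of _ "\<lambda>x. representation C x b"])
       (simp add: representation_add[OF C(1)] representation_scale[OF C(1)] C(2))
qed

text \<open>A digit expansion along the valuations below \<open>r\<close>; residue degree 1 makes
  every digit a constant.\<close>

lemma ex_local_expansion:
  assumes w: "w \<in> places" and v: "val_ge w v 0"
    and \<beta>: "\<And>s. s < r \<Longrightarrow> \<beta> s \<noteq> 0 \<and> w (\<beta> s) = int s"
  shows "\<exists>c. val_ge w (v - (\<Sum>s<r. const (c s) * \<beta> s)) (int r)"
  using \<beta>
proof (induction r)
  case 0
  show ?case using v by simp
next
  case (Suc r)
  interpret w: discrete_val w by (rule places_valuation[OF w])
  obtain c where c: "val_ge w (v - (\<Sum>s<r. const (c s) * \<beta> s)) (int r)"
    using Suc by auto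
  define y where "y = v - (\<Sum>s<r. const (c s) * \<beta> s)"
  have \<beta>r: "\<beta> r \<noteq> 0" "w (\<beta> r) = int r" using Suc.prems by auto
  have "val_ge w (y / \<beta> r) 0"
    using c \<beta>r unfolding y_def[symmetric]
    by (cases "y = 0") (auto simp: val_ge_def w.val_divide)
  then obtain a where a: "val_ge w (y / \<beta> r - const a) 1" using ex_residue[OF w] by blast
  have "val_ge w ((y / \<beta> r - const a) * \<beta> r) (1 + int r)"
    using a \<beta>r by (intro w.val_ge_mult) (simp_all add: val_ge_def)
  also have "(y / \<beta> r - const a) * \<beta> r = v - (\<Sum>s<Suc r. const ((c(r := a)) s) * \<beta> s)"
  proof -
    have "(y / \<beta> r - const a) * \<beta> r = y - const a * \<beta> r"
      using \<beta>r by (simp only: left_diff_distrib) simp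
    then show ?thesis by (simp add: y_def)
  qed
  finally show ?case by (intro exI[of _ "c(r := a)"]) simp
qed

lemma sum_local_index:
  "finite F \<Longrightarrow> (\<Sum>i\<in>local_index F. f i) = (\<Sum>w\<in>F. \<Sum>s<ram w. f (w, s))"
  unfolding local_index_def by (subst sum.Sigma) auto

text \<open>The local expansions do not disturb each other, because basis elements belonging to
  other places vanish modulo \<open>1 / T\<close>.\<close>

lemma ex_global_expansion:
  assumes \<beta>: "local_basis places \<beta>" and v: "v \<in> inf_integers"
  shows "\<exists>c. emb fract_T * (v - (\<Sum>i\<in>local_index places. const (c i) * \<beta> i)) \<in> inf_integers"
proof -
  have \<beta>w: "\<beta> (w, s) \<noteq> 0 \<and> w (\<beta> (w, s)) = int s" if "w \<in> places" "s < ram w" for w s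
    using \<beta> that by (auto simp: local_basis_def)
  have "\<exists>c. val_ge w (v - (\<Sum>s<ram w. const (c s) * \<beta> (w, s))) (int (ram w))" if w: "w \<in> places" for w
    using ex_local_expansion[OF w inf_integersD[OF v w], of "ram w" "\<lambda>s. \<beta> (w, s)"] \<beta>w[OF w] by blast
  then obtain c where c: "\<And>w. w \<in> places \<Longrightarrow>
      val_ge w (v - (\<Sum>s<ram w. const (c w s) * \<beta> (w, s))) (int (ram w))" by metis
  let ?f = "\<lambda>i. const (case_prod c i) * \<beta> i"
  have "val_ge w (emb fract_T * (v - (\<Sum>i\<in>local_index places. ?f i))) 0" if w: "w \<in> places" for w
  proof -
    interpret w: discrete_val w by (rule places_valuation[OF w])
    have "(\<Sum>i\<in>local_index places. ?f i) =
        (\<Sum>s<ram w. ?f (w, s)) + (\<Sum>u\<in>places - {w}. \<Sum>s<ram u. ?f (u, s))"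
      unfolding sum_local_index[OF finite_places] using w finite_places by (intro sum.remove)
    then have eq: "v - (\<Sum>i\<in>local_index places. ?f i) =
        (v - (\<Sum>s<ram w. const (c w s) * \<beta> (w, s))) - (\<Sum>u\<in>places - {w}. \<Sum>s<ram u. ?f (u, s))"
      by simp
    have "val_ge w (?f (u, s)) (int (ram w))" if "u \<in> places - {w}" "s < ram u" for u s
    proof -
      have "val_ge w (\<beta> (u, s)) (int (ram w))" using \<beta> that w by (auto simp: local_basis_def)
      from w.val_ge_mult[OF val_ge_const[OF w] this] show ?thesis by simp
    qed
    then have "val_ge w (v - (\<Sum>i\<in>local_index places. ?f i)) (int (ram w))"
      unfolding eq by (intro w.val_ge_diff c[OF w] w.val_ge_sum) auto
    moreover have "val_ge w (emb fract_T) (- int (ram w))"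
      by (simp add: val_ge_def val_emb[OF w])
    ultimately show ?thesis
      using w.val_ge_mult[of "emb fract_T" "- int (ram w)"] by fastforce
  qed
  then show ?thesis unfolding inf_integers_def by blast
qed

text \<open>A form of Nakayama's argument. If a functional \<open>\<phi>\<close> vanishes on the
  local basis, subtracting the expansion of \<open>v\<close> and multiplying by \<open>T\<close>
  gives an element \<open>u\<close> of \<open>R\<close> with \<open>\<phi> u = T * \<phi> v\<close>,
  so a nonzero \<open>\<phi>\<close> would have unbounded degree on \<open>R\<close>. A reduced
  basis bounds coordinates on \<open>R\<close>, and hence \<open>\<phi>\<close>.\<close>

lemma span_local_basis:
  assumes \<beta>: "local_basis places \<beta>"
  shows "span (\<beta> ` local_index places) = UNIV"
proof (rule ccontr)
  define B where "B = \<beta> ` local_index places"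
  assume "span (\<beta> ` local_index places) \<noteq> UNIV"
  then obtain b where b: "b \<notin> span B" unfolding B_def by blast
  have "independent B"
    unfolding B_def using local_basis_inj_independent(2)[OF finite_places _ \<beta>] by simp
  then obtain \<phi> where add: "\<And>x y. \<phi> (x + y) = \<phi> x + \<phi> y" and scale: "\<And>c x. \<phi> (emb c * x) = c * \<phi> x"
    and B0: "\<And>x. x \<in> B \<Longrightarrow> \<phi> x = 0" and b0: "\<phi> b \<noteq> 0"
    using ex_linear_functional[OF _ b] by blast
  have "\<phi> 0 = 0" using scale[of 0 0] by simp
  then have sum: "\<phi> (sum f I) = (\<Sum>i\<in>I. \<phi> (f i))" for I and f :: "'i \<Rightarrow> 'l"
    by (induction I rule: infinite_finite_induct) (simp_all add: add)
  obtain ys a where ys: "basis_list ys"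
    "\<And>q. lin_comb ys q / 1 \<in> inf_integers \<longleftrightarrow> (\<forall>i<length ys. deg_le (q i) (- a i))"
    using ex_reduced_basis_bounded_integers[of 1] by (metis zero_neq_one)
  have "\<exists>C. \<forall>i\<in>{..<length ys}. deg_le (fract_T powi (- a i) * \<phi> (ys ! i)) C"
    by (intro ex_deg_le_finite) simp
  then obtain C where C: "\<And>i. i < length ys \<Longrightarrow> deg_le (\<phi> (ys ! i)) (C + a i)"
    by (auto simp: deg_le_T_powi_mult_iff)
  have bound: "deg_le (\<phi> v) C" if v: "v \<in> inf_integers" for v
  proof -
    have "\<phi> v = (\<Sum>i<length ys. coord ys v i * \<phi> (ys ! i))"
      by (subst lin_comb_coord[OF ys(1), of v, symmetric]) (simp add: lin_comb_def sum scale)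
    moreover have "deg_le (coord ys v i) (- a i)" if "i < length ys" for i
      using ys(2)[of "coord ys v"] v that by (simp add: lin_comb_coord[OF ys(1)])
    ultimately show ?thesis
      using deg_le_mult[OF _ C] by (fastforce intro: deg_le_sum)
  qed
  obtain s where s: "emb (fract_T powi (- s)) * b \<in> inf_integers" using inf_integers_absorb by blast
  define P where "P = (\<lambda>v. v \<in> inf_integers \<and> \<phi> v \<noteq> 0)"
  have "P (emb (fract_T powi (- s)) * b)"
    using s b0 by (simp add: P_def scale)
  then obtain v where v: "P v" and min: "\<And>u. P u \<Longrightarrow> nat (C - fract_degree (\<phi> v)) \<le> nat (C - fract_degree (\<phi> u))"
    using ex_has_least_nat[of P _ "\<lambda>v. nat (C - fract_degree (\<phi> v))"] by blast
  have vR: "v \<in> inf_integers" "\<phi> v \<noteq> 0" using v by (simp_all add: P_def)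
  obtain c where c: "emb fract_T * (v - (\<Sum>i\<in>local_index places. const (c i) * \<beta> i)) \<in> inf_integers"
    using ex_global_expansion[OF \<beta> vR(1)] by blast
  define u where "u = emb fract_T * (v - (\<Sum>i\<in>local_index places. const (c i) * \<beta> i))"
  have "\<phi> (\<Sum>i\<in>local_index places. const (c i) * \<beta> i) = 0"
    unfolding sum const_def scale using B0 by (intro sum.neutral) (auto simp: B_def)
  moreover have "\<phi> v = \<phi> (v - (\<Sum>i\<in>local_index places. const (c i) * \<beta> i)) +
      \<phi> (\<Sum>i\<in>local_index places. const (c i) * \<beta> i)"
    by (simp flip: add)
  ultimately have \<phi>u: "\<phi> u = fract_T * \<phi> v" by (simp add: u_def scale)
  then have "P u" using c vR by (simp add: P_def u_def)
  moreover have "fract_degree (\<phi> u) = 1 + fract_degree (\<phi> v)"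
    using vR by (simp add: \<phi>u fract_degree_mult)
  moreover have "fract_degree (\<phi> u) \<le> C"
    using bound[of u] \<open>P u\<close> by (simp add: P_def deg_le_def)
  ultimately show False using min[of u] by simp
qed

section \<open>The basis at infinity and norms of local parameters\<close>

definition inf_basis :: "('l \<Rightarrow> int) \<times> nat \<Rightarrow> 'l" where
  "inf_basis = (SOME \<beta>. local_basis places \<beta>)"

definition inf_index :: "(('l \<Rightarrow> int) \<times> nat) list" where
  "inf_index = (SOME is. distinct is \<and> set is = local_index places)"

definition inf_list :: "'l list" where
  "inf_list = map inf_basis inf_index"

lemma local_basis_inf_basis: "local_basis places inf_basis"
  unfolding inf_basis_def using ex_local_basis[OF finite_places order_refl] by (rule someI_ex)

lemma inf_index: "distinct inf_index" "set inf_index = local_index places"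
proof -
  have "\<exists>is. distinct is \<and> set is = local_index places"
    using finite_distinct_list[OF finite_local_index[OF finite_places]] by blast
  from someI_ex[OF this] show "distinct inf_index" "set inf_index = local_index places"
    by (simp_all add: inf_index_def)
qed

lemma inj_inf_basis: "inj_on inf_basis (local_index places)"
  using local_basis_inj_independent(1)[OF finite_places _ local_basis_inf_basis] by simp

lemma basis_inf_list: "basis_list inf_list"
  unfolding basis_list_def inf_list_def
  using span_local_basis[OF local_basis_inf_basis] inf_index inj_inf_basis
    local_basis_inj_independent(2)[OF finite_places _ local_basis_inf_basis]
  by (simp add: distinct_map)

lemma length_inf_index: "length inf_index = ext_degree"
  using length_basis_list[OF basis_inf_list] by (simp add: inf_list_def)

lemma nth_inf_list: "j < ext_degree \<Longrightarrow> inf_list ! j = inf_basis (inf_index ! j)"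
  by (simp add: inf_list_def length_inf_index)

text \<open>The fundamental identity, all residue degrees being 1.\<close>

lemma sum_ram: "(\<Sum>w\<in>places. ram w) = ext_degree"
proof -
  have "(\<Sum>w\<in>places. ram w) = card (local_index places)"
    unfolding local_index_def using finite_places by (subst card_SigmaI) auto
  also have "\<dots> = ext_degree"
    using inf_index length_inf_index distinct_card by metis
  finally show ?thesis .
qed

lemma coord_inf_list:
  assumes x: "\<And>w. w \<in> places \<Longrightarrow> val_ge w x (- int (ram w) * d)" and j: "j < ext_degree"
  shows "deg_le (coord inf_list x j) d"
proof -
  define q where "q = (\<lambda>i. representation (set inf_list) x (inf_basis i))"
  have "(\<Sum>b\<in>set inf_list. emb (representation (set inf_list) x b) * b) = x"
    using basis_inf_list by (intro sum_representation_eq) (auto simp: basis_list_def)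
  then have x_eq: "(\<Sum>i\<in>local_index places. emb (q i) * inf_basis i) = x"
    by (simp add: inf_list_def inf_index(2) sum.reindex[OF inj_inf_basis] q_def)
  have "inf_index ! j \<in> local_index places"
    using j inf_index(2) length_inf_index nth_mem by metis
  then have "deg_le (q (inf_index ! j)) d"
    using local_basis_orthogonal[OF finite_places order_refl local_basis_inf_basis, of q d] x x_eq by simp
  then show ?thesis by (simp add: coord_def q_def nth_inf_list[OF j])
qed

lemma inf_index_nth:
  assumes "j < ext_degree" "inf_index ! j = (w, s)"
  shows "w \<in> places" "s < ram w" "w (inf_list ! j) = int s" "inf_list ! j \<noteq> 0"
    "\<And>v. v \<in> places - {w} \<Longrightarrow> val_ge v (inf_list ! j) (int (ram v))" "inf_list ! j \<in> inf_integers"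
proof -
  have "(w, s) \<in> local_index places"
    using assms inf_index(2) length_inf_index nth_mem by metis
  then show *: "w \<in> places" "s < ram w" by (auto simp: local_index_def)
  then show **: "w (inf_list ! j) = int s" "inf_list ! j \<noteq> 0"
    "\<And>v. v \<in> places - {w} \<Longrightarrow> val_ge v (inf_list ! j) (int (ram v))"
    using local_basis_inf_basis assms by (auto simp: local_basis_def nth_inf_list)
  have "val_ge v (inf_list ! j) 0" if "v \<in> places" for v
    using **(1) **(3)[of v] that by (cases "v = w") (auto simp: val_ge_def)
  then show "inf_list ! j \<in> inf_integers" by (simp add: inf_integers_def)
qed

text \<open>In the basis at infinity the matrix of \<open>z\<close> has entries of degree at most 0.
  The column belonging to valuation \<open>ram w - 1\<close> at \<open>w\<close> is better by one:
  that basis element times \<open>z\<close> is divisible by \<open>1 / T\<close> at every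
  place.\<close>

lemma norm_neg_if_val_pos:
  assumes z: "z \<in> inf_integers" and w: "w \<in> places" "val_ge w z 1"
  shows "deg_le (ext_norm z) (- 1)"
proof -
  have "(w, ram w - 1) \<in> set inf_index"
    using w ram_pos[OF w(1)] by (simp add: inf_index local_index_def)
  then obtain j0 where j0: "j0 < ext_degree" "inf_index ! j0 = (w, ram w - 1)"
    by (metis in_set_conv_nth length_inf_index)
  define d :: "nat \<Rightarrow> int" where "d = (\<lambda>j. if j = j0 then - 1 else 0)"
  have len: "length inf_list = ext_degree" by (rule length_basis_list[OF basis_inf_list])
  have "deg_le (det (mult_mat inf_list z)) (\<Sum>j<ext_degree. d j)"
  proof (rule deg_le_det)
    show "mult_mat inf_list z \<in> carrier_mat ext_degree ext_degree"
      using mult_mat_carrier[of inf_list z] len by simp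
    fix i j assume ij: "i < ext_degree" "j < ext_degree"
    obtain v s where vs: "inf_index ! j = (v, s)" by (cases "inf_index ! j")
    have "deg_le (coord inf_list (z * inf_list ! j) i) (d j)"
    proof (rule coord_inf_list[OF _ ij(1)])
      fix u assume u: "u \<in> places"
      interpret u: discrete_val u by (rule places_valuation[OF u])
      show "val_ge u (z * inf_list ! j) (- int (ram u) * d j)"
      proof (cases "j = j0")
        case False
        have "z * inf_list ! j \<in> inf_integers"
          using inf_integers_mult[OF z inf_index_nth(6)[OF ij(2) vs]] .
        with False u show ?thesis by (simp add: d_def inf_integersD)
      next
        case True
        show ?thesis
        proof (cases "u = w")
          case True
          have "val_ge u (inf_list ! j0) (int (ram w) - 1)"
            using inf_index_nth(3)[OF j0] True ram_pos[OF w(1)] by (simp add: val_ge_def of_nat_diff)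
          from u.val_ge_mult[OF _ this, of z 1] w(2) True \<open>j = j0\<close> show ?thesis by (simp add: d_def)
        next
          case False
          then have "val_ge u (inf_list ! j0) (int (ram u))"
            using inf_index_nth(5)[OF j0] u by blast
          from u.val_ge_mult[OF inf_integersD[OF z u] this] \<open>j = j0\<close> show ?thesis by (simp add: d_def)
        qed
      qed
    qed
    then show "deg_le (mult_mat inf_list z $$ (i, j)) (d j)"
      using ij len by (simp add: mult_mat_index)
  qed
  also have "(\<Sum>j<ext_degree. d j) = - 1" using j0(1) by (simp add: d_def)
  finally show ?thesis by (simp add: ext_norm_eq_det[OF basis_inf_list])
qed

lemma norm_unit_at_infinity:
  assumes "x \<noteq> 0" "\<And>w. w \<in> places \<Longrightarrow> w x = 0"
  shows "fract_degree (ext_norm x) = 0"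
proof -
  have "val_ge w x 0 \<and> val_ge w (inverse x) 0" if "w \<in> places" for w
    using assms(2)[OF that] discrete_val.val_inverse[OF places_valuation[OF that] assms(1)] by (simp add: val_ge_def)
  then have "x \<in> inf_integers" "inverse x \<in> inf_integers"
    by (simp_all add: inf_integers_def)
  then have "deg_le (ext_norm x) 0" "deg_le (ext_norm (inverse x)) 0"
    using norm_inf_integers by blast+
  with ext_norm_nonzero[OF assms(1)] show ?thesis
    by (simp add: deg_le_def ext_norm_inverse fract_degree_inverse)
qed

lemma ex_local_parameter:
  assumes w: "w \<in> places"
  shows "\<exists>t. t \<noteq> 0 \<and> w t = 1 \<and> (\<forall>v\<in>places - {w}. v t = 0)"
proof -
  interpret w: discrete_val w by (rule places_valuation[OF w])
  obtain t where t: "t \<noteq> 0" "w t = 1" using w.ex_val_eq by blast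
  define m where "m = 2 + (\<Sum>v\<in>places. \<bar>v t\<bar>)"
  have m: "m \<ge> 2" by (auto simp: m_def intro: sum_nonneg)
  have m_ge: "m + v t \<ge> 1" if "v \<in> places" for v
  proof -
    have "\<bar>v t\<bar> \<le> (\<Sum>v\<in>places. \<bar>v t\<bar>)" using that finite_places by (intro member_le_sum) auto
    then show ?thesis by (simp add: m_def)
  qed
  obtain h where h: "val_ge w (h - 1) m" "\<forall>v\<in>places - {w}. val_ge v h m"
    using ex_approx_idempotent[of "places - {w}" w m] finite_places w by auto
  \<comment> \<open>Close to \<open>t\<close> at \<open>w\<close> and close to 1 at the other
    places.\<close>
  define u where "u = h * t + (1 - h)"
  have h1: "val_ge w (1 - h) m" using h(1) w.val_ge_minus[of "h - 1" m] by simp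
  have "h \<noteq> 0 \<and> w h = 0" using w.val_add_eq[of 1 "h - 1"] val_ge_mono[OF h(1)] m by simp
  then have "h * t \<noteq> 0" "w (h * t) = 1" using t by (simp_all add: w.val_mult)
  then have "u \<noteq> 0" "w u = 1"
    unfolding u_def using w.val_add_eq[of "h * t" "1 - h"] val_ge_mono[OF h1, of 2] m by auto
  moreover have "v u = 0" if v: "v \<in> places - {w}" for v
  proof -
    interpret v: discrete_val v using v by (intro places_valuation) auto
    have hm: "val_ge v h m" using h(2) v by blast
    have "val_ge v (- h) 1" using val_ge_mono[OF hm] m by (simp add: v.val_ge_minus)
    then have "1 - h \<noteq> 0 \<and> v (1 - h) = 0" using v.val_add_eq[of 1 "- h"] by simp
    moreover have "val_ge v (h * t) (m + v t)"
      using hm by (intro v.val_ge_mult) (simp_all add: val_ge_def)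
    then have "val_ge v (h * t) 1"
      by (rule val_ge_mono) (use m_ge v in auto)
    ultimately have "v ((1 - h) + h * t) = 0" using v.val_add_eq[of "1 - h" "h * t"] by simp
    then show ?thesis unfolding u_def by (simp only: add.commute)
  qed
  ultimately show ?thesis by blast
qed

text \<open>
  Each local parameter has norm of degree at most \<open>- 1\<close>. Since \<open>1 / T\<close>, whose norm has degree
  \<open>- n\<close>, is a unit times a product of \<open>n\<close> local parameters, equality holds.
\<close>

lemma norm_local_parameter:
  assumes t: "\<And>w. w \<in> places \<Longrightarrow> t w \<noteq> 0 \<and> w (t w) = 1 \<and> (\<forall>v\<in>places - {w}. v (t w) = 0)"
    and w: "w \<in> places"
  shows "fract_degree (ext_norm (t w)) = - 1"
proof -
  define d where "d = (\<lambda>w. fract_degree (ext_norm (t w)))"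
  have d_le: "d w \<le> - 1" if w: "w \<in> places" for w
  proof -
    have "val_ge v (t w) 0" if v: "v \<in> places" for v
    proof (cases "v = w")
      case False
      with t[OF w] v have "v (t w) = 0" by blast
      then show ?thesis by (simp add: val_ge_def)
    qed (use t[OF w] in \<open>simp add: val_ge_def\<close>)
    then have "t w \<in> inf_integers" by (simp add: inf_integers_def)
    moreover have "val_ge w (t w) 1" using t[OF w] by (simp add: val_ge_def)
    ultimately have "deg_le (ext_norm (t w)) (- 1)" using w by (intro norm_neg_if_val_pos)
    moreover have "ext_norm (t w) \<noteq> 0" using t[OF w] ext_norm_nonzero by blast
    ultimately show ?thesis by (simp add: d_def deg_le_def)
  qed
  define p where "p = (\<Prod>w\<in>places. t w ^ ram w)"
  have p0: "p \<noteq> 0" unfolding p_def using t finite_places by auto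
  have val_p: "v (\<Prod>w\<in>F. t w ^ ram w) = (if v \<in> F then int (ram v) else 0)"
    if v: "v \<in> places" and F: "finite F" "F \<subseteq> places" for v F
    using F
  proof (induction F rule: finite_induct)
    case empty
    then show ?case using discrete_val.val_1[OF places_valuation[OF v]] by simp
  next
    case (insert u F)
    interpret v: discrete_val v by (rule places_valuation[OF v])
    have tu: "t u \<noteq> 0" "(\<Prod>w\<in>F. t w ^ ram w) \<noteq> 0" using t insert by auto
    have "v (t u) = (if v = u then 1 else 0)" using t[of u] insert.prems v by auto
    with insert tu show ?case by (auto simp: v.val_mult v.val_power)
  qed
  have norm_p: "fract_degree (ext_norm (\<Prod>w\<in>F. t w ^ ram w)) = (\<Sum>w\<in>F. int (ram w) * d w)"
    if F: "finite F" "F \<subseteq> places" for F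
    using F
  proof (induction F rule: finite_induct)
    case (insert u F)
    have "t u \<noteq> 0" "(\<Prod>w\<in>F. t w ^ ram w) \<noteq> 0" using t insert by auto
    with insert show ?case
      using ext_norm_nonzero by (simp add: ext_norm_mult ext_norm_power fract_degree_mult fract_degree_power d_def)
  qed simp
  define y where "y = emb fract_T * p"
  have y: "y \<noteq> 0" using p0 by (simp add: y_def)
  have "v y = 0" if v: "v \<in> places" for v
  proof -
    interpret v: discrete_val v by (rule places_valuation[OF v])
    have "v p = int (ram v)" using val_p[OF v finite_places] v by (simp add: p_def)
    then show ?thesis using p0 by (simp add: y_def v.val_mult val_emb[OF v])
  qed
  then have "fract_degree (ext_norm y) = 0" using norm_unit_at_infinity[OF y] by blast
  moreover have "fract_degree (ext_norm y) = int ext_degree + (\<Sum>w\<in>places. int (ram w) * d w)"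
    using ext_norm_nonzero[OF p0] norm_p[OF finite_places order_refl]
    by (simp add: y_def ext_norm_mult ext_norm_emb fract_degree_mult fract_degree_power p_def)
  ultimately have "(\<Sum>w\<in>places. int (ram w) * (d w + 1)) = 0"
    by (simp add: distrib_left sum.distrib flip: sum_ram)
  then have "(\<Sum>w\<in>places. - (int (ram w) * (d w + 1))) = 0"
    by (simp only: sum_negf minus_zero)
  moreover have "0 \<le> - (int (ram w) * (d w + 1))" if "w \<in> places" for w
    using mult_nonneg_nonpos[of "int (ram w)" "d w + 1"] d_le[OF that] by simp
  ultimately have "\<forall>w\<in>places. - (int (ram w) * (d w + 1)) = 0"
    using sum_nonneg_eq_0_iff[OF finite_places, of "\<lambda>w. - (int (ram w) * (d w + 1))"] by blast
  with w have "int (ram w) * (d w + 1) = 0" by fastforce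
  with ram_pos[OF w] have "d w + 1 = 0" by simp
  then show ?thesis by (simp add: d_def)
qed

text \<open>Powers of one local parameter suffice, since its norm has degree exactly -1.\<close>

lemma ex_norm_degree: "\<exists>g. g \<noteq> 0 \<and> fract_degree (ext_norm g) = N"
proof -
  obtain t where t: "\<And>w. w \<in> places \<Longrightarrow> t w \<noteq> 0 \<and> w (t w) = 1 \<and> (\<forall>v\<in>places - {w}. v (t w) = 0)"
    using ex_local_parameter by metis
  obtain w where w: "w \<in> places" using places_nonempty by blast
  have t0: "t w \<noteq> 0" using t[OF w] by blast
  have "fract_degree (q powi m) = m * fract_degree q" if "q \<noteq> 0" for q :: "'k poly fract" and m
    using that by (auto simp: power_int_def fract_degree_power fract_degree_inverse)
  then have "fract_degree (ext_norm (t w powi (- N))) = N"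
    using norm_local_parameter[OF t w] ext_norm_nonzero[OF t0] by (simp add: ext_norm_powi)
  then show ?thesis using t0 by (intro exI[of _ "t w powi (- N)"]) simp
qed

text \<open>Modulo \<open>1 / T\<close>, multiplication by \<open>h\<close> acts on \<open>R\<close>
  as the projection onto the \<open>ram w\<close> basis elements belonging to \<open>w\<close>, and
  the trace of a projection is its rank.\<close>

lemma trace_approx_idempotent:
  assumes w: "w \<in> places" and h: "val_ge w (h - 1) (int (ram w))"
    "\<And>v. v \<in> places - {w} \<Longrightarrow> val_ge v h (int (ram v))"
  shows "deg_le (ext_trace h - of_nat (ram w)) (- 1)"
proof -
  have len: "length inf_list = ext_degree" by (rule length_basis_list[OF basis_inf_list])
  interpret w: discrete_val w by (rule places_valuation[OF w])
  have h0: "val_ge w h 0" using w.val_ge_add[OF val_ge_mono[OF h(1)] w.val_ge_1] by simp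
  define c where "c = (\<lambda>j. if fst (inf_index ! j) = w then 1 else 0 :: 'k poly fract)"
  have entry: "deg_le (coord inf_list (h * inf_list ! j) j - c j) (- 1)" if j: "j < ext_degree" for j
  proof -
    obtain v s where vs: "inf_index ! j = (v, s)" by (cases "inf_index ! j")
    note nth = inf_index_nth[OF j vs]
    have "deg_le (coord inf_list (h * inf_list ! j - emb (c j) * inf_list ! j) j) (- 1)"
    proof (rule coord_inf_list[OF _ j])
      fix u assume u: "u \<in> places"
      interpret u: discrete_val u by (rule places_valuation[OF u])
      have *: "val_ge u ((h - emb (c j)) * inf_list ! j) (int (ram u))"
      proof (cases "u = v")
        case True
        have "val_ge u (h - emb (c j)) (int (ram u))"
          using h True u vs by (cases "v = w") (auto simp: c_def)
        from u.val_ge_mult[OF this inf_integersD[OF nth(6) u]] show ?thesis by simp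
      next
        case False
        have "val_ge u h 0" using h0 val_ge_mono[OF h(2)] u by (cases "u = w") auto
        moreover have "val_ge u (emb (c j)) 0" by (simp add: c_def u.val_ge_1)
        ultimately have "val_ge u (h - emb (c j)) 0" by (rule u.val_ge_diff)
        moreover have "val_ge u (inf_list ! j) (int (ram u))" using nth(5) u False by blast
        ultimately show ?thesis using u.val_ge_mult by fastforce
      qed
      then show "val_ge u (h * inf_list ! j - emb (c j) * inf_list ! j) (- int (ram u) * - 1)"
        by (simp add: left_diff_distrib)
    qed
    then show ?thesis
      using j len by (simp add: coord_diff[OF basis_inf_list] coord_scale[OF basis_inf_list] coord_nth[OF basis_inf_list])
  qed
  have "(\<Sum>j<ext_degree. c j) = of_nat (ram w)"
  proof -
    have "(\<Sum>j<ext_degree. c j) = (\<Sum>i\<in>local_index places. if fst i = w then 1 else 0)"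
      using sum_set_basis[OF inf_index(1), of "\<lambda>i. if fst i = w then 1 else (0 :: 'k poly fract)"]
      by (simp add: inf_index(2) length_inf_index c_def)
    also have "\<dots> = (\<Sum>v\<in>places. if v = w then of_nat (ram w) else 0)"
      unfolding sum_local_index[OF finite_places] by (intro sum.cong) auto
    finally show ?thesis using w finite_places by simp
  qed
  then have "ext_trace h - of_nat (ram w) = (\<Sum>j<ext_degree. coord inf_list (h * inf_list ! j) j - c j)"
    by (simp add: ext_trace_eq[OF basis_inf_list] len sum_subtractf)
  then show ?thesis using entry by (auto intro: deg_le_sum)
qed

end

section \<open>Consequences of tameness\<close>

locale tame_function_field = alg_function_field emb
  for emb :: "'k::alg_closed_field poly fract \<Rightarrow> 'l::field" +
  assumes tame: tame_above_infinity
begin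

text \<open>Tameness makes the leading constant \<open>ram w\<close> of the trace nonzero in
  \<open>k\<close>. The parameter \<open>m\<close> leaves room for dividing by an element with zeros
  at the other places.\<close>

lemma ex_trace_element:
  assumes w: "w \<in> places"
  shows "\<exists>h. h \<noteq> 0 \<and> \<not> deg_le (ext_trace h) (- 1) \<and> w h = 0 \<and> (\<forall>v\<in>places - {w}. val_ge v h m)"
proof -
  interpret w: discrete_val w by (rule places_valuation[OF w])
  define l where "l = \<bar>m\<bar> + (\<Sum>v\<in>places. int (ram v))"
  have l_ge: "int (ram v) \<le> l" if "v \<in> places" for v
  proof -
    have "int (ram v) \<le> (\<Sum>v\<in>places. int (ram v))" using that finite_places by (intro member_le_sum) auto
    then show ?thesis by (simp add: l_def)
  qed
  have "m \<le> l" by (simp add: l_def add_increasing2 sum_nonneg)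
  obtain h where h: "val_ge w (h - 1) l" "\<forall>v\<in>places - {w}. val_ge v h l"
    using ex_approx_idempotent[of "places - {w}" w l] finite_places w by auto
  have "h \<noteq> 0 \<and> w h = 0"
    using w.val_add_eq[of 1 "h - 1"] val_ge_mono[OF h(1)] l_ge[OF w] ram_pos[OF w] by simp
  moreover have tr: "deg_le (ext_trace h - of_nat (ram w)) (- 1)"
    using h by (intro trace_approx_idempotent[OF w]) (auto intro: val_ge_mono l_ge w)
  have "\<not> deg_le (ext_trace h) (- 1)"
  proof
    assume "deg_le (ext_trace h) (- 1)"
    from deg_le_diff[OF this tr] have "deg_le (of_nat (ram w) :: 'k poly fract) (- 1)" by simp
    then have "deg_le (fract_const (of_nat (ram w) :: 'k)) (- 1)"
      by (simp add: fract_const_of_nat)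
    moreover have "(of_nat (ram w) :: 'k) \<noteq> 0"
      using tame place_above_infinity[OF w] by (auto simp: tame_above_infinity_def of_nat_eq_0_iff_char_dvd)
    ultimately show False by (simp add: deg_le_def)
  qed
  moreover have "\<forall>v\<in>places - {w}. val_ge v h m"
    using h(2) \<open>m \<le> l\<close> by (auto intro: val_ge_mono)
  ultimately show ?thesis by blast
qed

text \<open>One element \<open>h\<close> of nonzero trace suffices: \<open>y = h / x\<close> serves
  for \<open>x\<close>.\<close>

lemma trace_nondegenerate:
  assumes "x \<noteq> 0"
  shows "\<exists>y. ext_trace (x * y) \<noteq> 0"
proof -
  obtain w where "w \<in> places" using places_nonempty by blast
  then obtain h where "\<not> deg_le (ext_trace h) (- 1)" using ex_trace_element by blast
  then have "ext_trace h \<noteq> 0" by auto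
  with assms show ?thesis by (intro exI[of _ "h / x"]) simp
qed

text \<open>
  In terms of ideals, the inverse different of \<open>R\<close> is contained in \<open>T\<close> times the radical of \<open>R\<close>: this is the
  bound \<open>e - 1\<close> for the different exponents.
\<close>

lemma norm_neg_if_trace_small:
  assumes z: "z \<noteq> 0" and tr: "\<And>r. r \<in> inf_integers \<Longrightarrow> deg_le (ext_trace (z * r)) (- 1)"
  shows "deg_le (ext_norm z) (- 1)"
proof -
  \<comment> \<open>If \<open>w z\<close> were at most 0, then \<open>r = h / z\<close> would lie in
    \<open>R\<close> for some \<open>h\<close> whose trace is not small, although
    \<open>z * r = h\<close>.\<close>
  have pos: "w z \<ge> 1" if w: "w \<in> places" for w
  proof (rule ccontr)
    assume neg: "\<not> w z \<ge> 1"
    define m where "m = (\<Sum>v\<in>places. \<bar>v z\<bar>)"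
    obtain h where h: "h \<noteq> 0" "\<not> deg_le (ext_trace h) (- 1)" "w h = 0" "\<forall>v\<in>places - {w}. val_ge v h m"
      using ex_trace_element[OF w] by blast
    have "val_ge v (h / z) 0" if v: "v \<in> places" for v
    proof (cases "v = w")
      case True
      then show ?thesis
        using discrete_val.val_divide[OF places_valuation[OF w] h(1) z] h(3) neg by (simp add: val_ge_def)
    next
      case False
      have "\<bar>v z\<bar> \<le> m" unfolding m_def using v finite_places by (intro member_le_sum) auto
      moreover have "val_ge v h m" using h(4) v False by blast
      ultimately show ?thesis
        using discrete_val.val_divide[OF places_valuation[OF v] h(1) z] h(1) z by (simp add: val_ge_def)
    qed
    then have "h / z \<in> inf_integers" by (simp add: inf_integers_def)
    from tr[OF this] h(2) z show False by simp
  qed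
  obtain w where w: "w \<in> places" using places_nonempty by blast
  have "z \<in> inf_integers" using pos by (force simp: inf_integers_def val_ge_def)
  then show ?thesis using w pos[OF w] by (intro norm_neg_if_val_pos) (auto simp: val_ge_def)
qed

end

section \<open>The discriminant and the Euclidean minimum\<close>

context tame_function_field
begin

section \<open>Integral bases and their trace matrices\<close>

definition integral_basis :: "'l list \<Rightarrow> bool" where
  "integral_basis ys \<longleftrightarrow> basis_list ys \<and>
     (\<forall>q. lin_comb ys q \<in> ring_of_integers \<longleftrightarrow> (\<forall>i<length ys. q i \<in> range to_fract))"

definition trace_mat :: "'l list \<Rightarrow> 'k poly fract mat" where
  "trace_mat xs = mat (length xs) (length xs) (\<lambda>(i, j). ext_trace (xs ! i * xs ! j))"

lemma tuple_disc_trace_mat: "tuple_disc xs = det (trace_mat xs)"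
  by (simp add: tuple_disc_def trace_mat_def)

lemma ring_of_integers_mult: "x \<in> ring_of_integers \<Longrightarrow> y \<in> ring_of_integers \<Longrightarrow> x * y \<in> ring_of_integers"
  by (simp add: ring_of_integers_eq bounded_integers_mult)

context
  fixes ys :: "'l list"
  assumes ys: "integral_basis ys"
begin

lemma integral_basis_basis: "basis_list ys"
  using ys by (simp add: integral_basis_def)

lemma integral_basis_length: "length ys = ext_degree"
  using length_basis_list[OF integral_basis_basis] .

lemma coord_integral:
  assumes "x \<in> ring_of_integers" "i < ext_degree"
  shows "coord ys x i \<in> range to_fract"
proof -
  have "lin_comb ys (coord ys x) \<in> ring_of_integers"
    using assms(1) by (simp add: lin_comb_coord[OF integral_basis_basis])
  with ys assms(2) integral_basis_length show ?thesis
    unfolding integral_basis_def by metis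
qed

lemma lin_comb_integral:
  "(\<And>i. i < ext_degree \<Longrightarrow> q i \<in> range to_fract) \<Longrightarrow> lin_comb ys q \<in> ring_of_integers"
  using ys integral_basis_length by (auto simp: integral_basis_def)

lemma integral_basis_nth:
  assumes "j < ext_degree"
  shows "ys ! j \<in> ring_of_integers"
proof -
  have "ys ! j = lin_comb ys (\<lambda>k. if k = j then 1 else 0)"
    using assms integral_basis_length by (simp add: lin_comb_def if_distrib if_distribR cong: if_cong)
  also have "\<dots> \<in> ring_of_integers"
    using subring_0[OF is_subring_polys[where 'a = 'k]] subring_1[OF is_subring_polys[where 'a = 'k]]
    by (intro lin_comb_integral) simp
  finally show ?thesis .
qed

lemma trace_integral:
  assumes "x \<in> ring_of_integers"
  shows "ext_trace x \<in> range to_fract"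
  unfolding ext_trace_eq[OF integral_basis_basis] integral_basis_length
  using assms by (intro subring_sum[OF is_subring_polys] coord_integral ring_of_integers_mult integral_basis_nth) auto

lemma trace_mat_carrier: "trace_mat ys \<in> carrier_mat ext_degree ext_degree"
  by (simp add: trace_mat_def integral_basis_length)

lemma tuple_disc_integral: "tuple_disc ys \<in> range to_fract"
  unfolding tuple_disc_trace_mat
  by (intro det_in_subring[OF is_subring_polys trace_mat_carrier])
     (simp add: trace_mat_def integral_basis_length trace_integral ring_of_integers_mult integral_basis_nth)

text \<open>The trace matrix is a Gram matrix \<open>G\<close>: with \<open>C\<close> the polynomial
  matrix of coordinates of \<open>xs\<close>, it becomes \<open>C G C^T\<close>.\<close>

lemma tuple_disc_change:
  assumes xs: "length xs = ext_degree" "set xs \<subseteq> ring_of_integers"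
  shows "\<exists>c\<in>range to_fract. tuple_disc xs = c\<^sup>2 * tuple_disc ys"
proof -
  define n where "n = ext_degree"
  define C where "C = mat n n (\<lambda>(i, k). coord ys (xs ! i) k)"
  have C: "C \<in> carrier_mat n n" by (simp add: C_def)
  have G: "trace_mat ys \<in> carrier_mat n n" using trace_mat_carrier by (simp add: n_def)
  have len: "length ys = n" by (simp add: integral_basis_length n_def)
  have "trace_mat xs = C * (trace_mat ys * transpose_mat C)"
  proof (intro eq_matI)
    fix i j assume "i < dim_row (C * (trace_mat ys * transpose_mat C))" "j < dim_col (C * (trace_mat ys * transpose_mat C))"
    then have ij: "i < n" "j < n" by (simp_all add: C_def)
    have "xs ! i * xs ! j = lin_comb ys (coord ys (xs ! i)) * lin_comb ys (coord ys (xs ! j))"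
      by (simp add: lin_comb_coord[OF integral_basis_basis])
    also have "ext_trace \<dots> = (\<Sum>k<n. coord ys (xs ! i) k * ext_trace (ys ! k * lin_comb ys (coord ys (xs ! j))))"
      by (simp add: ext_trace_lin_comb len)
    also have "\<dots> = (\<Sum>k<n. coord ys (xs ! i) k * (\<Sum>l<n. ext_trace (ys ! k * ys ! l) * coord ys (xs ! j) l))"
    proof (intro sum.cong refl arg_cong2[where f = "(*)"])
      fix k
      have "ext_trace (ys ! k * lin_comb ys (coord ys (xs ! j))) = ext_trace (lin_comb ys (coord ys (xs ! j)) * ys ! k)"
        by (simp only: mult.commute)
      also have "\<dots> = (\<Sum>l<n. coord ys (xs ! j) l * ext_trace (ys ! l * ys ! k))"
        by (simp only: ext_trace_lin_comb len)
      finally show "ext_trace (ys ! k * lin_comb ys (coord ys (xs ! j))) =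
          (\<Sum>l<n. ext_trace (ys ! k * ys ! l) * coord ys (xs ! j) l)"
        by (simp only: mult.commute)
    qed
    also have "\<dots> = (C * (trace_mat ys * transpose_mat C)) $$ (i, j)"
      using ij by (simp add: C_def trace_mat_def len scalar_prod_def atLeast0LessThan)
    finally show "trace_mat xs $$ (i, j) = (C * (trace_mat ys * transpose_mat C)) $$ (i, j)"
      using ij xs by (simp add: trace_mat_def n_def)
  qed (use xs in \<open>simp_all add: trace_mat_def C_def n_def\<close>)
  then have "tuple_disc xs = det C * (det (trace_mat ys) * det C)"
    unfolding tuple_disc_trace_mat using C G by (simp add: det_mult[of _ n] det_transpose[OF C])
  then have "tuple_disc xs = (det C)\<^sup>2 * tuple_disc ys"
    by (simp add: tuple_disc_trace_mat power2_eq_square mult_ac)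
  moreover have "det C \<in> range to_fract"
    using xs by (intro det_in_subring[OF is_subring_polys C]) (auto simp: C_def n_def intro!: coord_integral)
  ultimately show ?thesis by blast
qed

lemma disc_ideal_degree: "\<exists>d. tuple_disc ys = to_fract d \<and> ideal_degree disc_ideal = degree d"
proof -
  obtain d where d: "tuple_disc ys = to_fract d" using tuple_disc_integral by blast
  define S where "S = {d. \<exists>xs. length xs = ext_degree \<and> set xs \<subseteq> ring_of_integers \<and> to_fract d = tuple_disc xs}"
  interpret m: Modules.module "(*) :: 'k poly \<Rightarrow> 'k poly \<Rightarrow> 'k poly"
    by (rule Modules.module.intro) (simp_all only: distrib_left distrib_right mult.assoc mult_1_left)
  have "d \<in> S"
    unfolding S_def using d integral_basis_length integral_basis_nth
    by (auto intro!: exI[of _ ys] simp: in_set_conv_nth)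
  moreover have "e \<in> ideal_generated {d}" if e: "e \<in> S" for e
  proof -
    obtain xs where xs: "length xs = ext_degree" "set xs \<subseteq> ring_of_integers" "to_fract e = tuple_disc xs"
      using e by (auto simp: S_def)
    obtain c where "to_fract e = (to_fract c)\<^sup>2 * to_fract d"
      using tuple_disc_change[OF xs(1,2)] xs(3) d by auto
    then have "e = c\<^sup>2 * d" by (simp flip: to_fract_power to_fract_mult)
    then show ?thesis by (simp add: ideal_generated_singleton)
  qed
  ultimately have "ideal_generated S = ideal_generated {d}"
    unfolding ideal_generated_def m.span_eq using m.span_superset by blast
  then have "ideal_degree disc_ideal = degree d"
    by (simp add: disc_ideal_def S_def ideal_degree_principal)
  with d show ?thesis by blast
qed

lemma trace_zero_imp_zero:
  assumes "\<And>j. j < ext_degree \<Longrightarrow> ext_trace (ys ! j * x) = 0"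
  shows "x = 0"
proof (rule ccontr)
  assume "x \<noteq> 0"
  then obtain y where "ext_trace (x * y) \<noteq> 0" using trace_nondegenerate by blast
  moreover have "ext_trace (x * y) = ext_trace (lin_comb ys (coord ys y) * x)"
    by (simp add: lin_comb_coord[OF integral_basis_basis] mult.commute)
  then have "ext_trace (x * y) = 0"
    by (simp only: ext_trace_lin_comb) (simp add: integral_basis_length assms)
  ultimately show False by contradiction
qed

lemma trace_mat_mult_vec:
  assumes v: "v \<in> carrier_vec ext_degree" and j: "j < ext_degree"
  shows "(trace_mat ys *\<^sub>v v) $ j = ext_trace (ys ! j * lin_comb ys (\<lambda>i. v $ i))"
proof -
  have "ext_trace (ys ! j * lin_comb ys (\<lambda>i. v $ i)) = ext_trace (lin_comb ys (\<lambda>i. v $ i) * ys ! j)"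
    by (simp only: mult.commute)
  also have "\<dots> = (\<Sum>i<ext_degree. v $ i * ext_trace (ys ! i * ys ! j))"
    by (simp only: ext_trace_lin_comb integral_basis_length)
  finally show ?thesis
    using v j by (simp add: trace_mat_def integral_basis_length scalar_prod_def atLeast0LessThan mult.commute)
qed

text \<open>A kernel vector of the trace matrix would give a nonzero element orthogonal to all of
  \<open>K\<close> under the trace form.\<close>

lemma tuple_disc_nonzero: "tuple_disc ys \<noteq> 0"
proof
  assume "tuple_disc ys = 0"
  then obtain v where v: "v \<in> carrier_vec ext_degree" "v \<noteq> 0\<^sub>v ext_degree" "trace_mat ys *\<^sub>v v = 0\<^sub>v ext_degree"
    unfolding tuple_disc_trace_mat det_0_iff_vec_prod_zero_field[OF trace_mat_carrier] by blast
  have "lin_comb ys (\<lambda>i. v $ i) = 0"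
    using trace_mat_mult_vec[OF v(1)] v(3) by (intro trace_zero_imp_zero) simp
  then have "v $ i = 0" if "i < ext_degree" for i
    using coord_lin_comb[OF integral_basis_basis, of i "\<lambda>i. v $ i"] that by (simp add: integral_basis_length coord_0)
  with v(1,2) show False by (auto intro!: eq_vecI)
qed

text \<open>The coordinates of \<open>z\<close> form a column of the inverse trace matrix, written
  with the adjugate.\<close>

lemma ex_dual_element:
  assumes i: "i < ext_degree"
  shows "\<exists>z. z \<noteq> 0 \<and> (\<forall>j<ext_degree. ext_trace (ys ! j * z) = (if j = i then 1 else 0))"
proof -
  define D where "D = tuple_disc ys"
  have D: "D \<noteq> 0" "det (trace_mat ys) = D" using tuple_disc_nonzero by (simp_all add: D_def tuple_disc_trace_mat)
  note adj = adj_mat[OF trace_mat_carrier]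
  define v where "v = inverse D \<cdot>\<^sub>v col (adj_mat (trace_mat ys)) i"
  have adj_col: "col (adj_mat (trace_mat ys)) i \<in> carrier_vec ext_degree"
    using i by (intro col_carrier_vec[OF _ adj(1)])
  then have v: "v \<in> carrier_vec ext_degree" by (simp add: v_def)
  have "trace_mat ys *\<^sub>v v = inverse D \<cdot>\<^sub>v (trace_mat ys *\<^sub>v col (adj_mat (trace_mat ys)) i)"
    unfolding v_def by (intro mult_mat_vec[OF trace_mat_carrier adj_col])
  also have "trace_mat ys *\<^sub>v col (adj_mat (trace_mat ys)) i = col (trace_mat ys * adj_mat (trace_mat ys)) i"
    using i adj(1) trace_mat_carrier by (intro col_mult2[symmetric]) auto
  finally have Gv: "trace_mat ys *\<^sub>v v = inverse D \<cdot>\<^sub>v col (D \<cdot>\<^sub>m 1\<^sub>m ext_degree) i"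
    by (simp add: adj(2) D(2))
  define z where "z = lin_comb ys (\<lambda>i. v $ i)"
  have tr: "ext_trace (ys ! j * z) = (if j = i then 1 else 0)" if j: "j < ext_degree" for j
    using trace_mat_mult_vec[OF v j] Gv i j D(1) by (auto simp: z_def)
  moreover have "z \<noteq> 0"
    using tr[OF i] ext_trace_scale[of 0 0] by auto
  ultimately show ?thesis by blast
qed

text \<open>By duality \<open>Tr (z * y_j * y_l)\<close> is the \<open>i\<close>-th coordinate of
  the integer \<open>y_j * y_l\<close>, hence a polynomial. These entries form the product of the
  trace matrix with the matrix of \<open>z\<close>, so its determinant, the discriminant times the
  norm of \<open>z\<close>, is a nonzero polynomial.\<close>

lemma norm_dual_element:
  assumes i: "i < ext_degree" and z: "z \<noteq> 0"
    and dual: "\<And>j. j < ext_degree \<Longrightarrow> ext_trace (ys ! j * z) = (if j = i then 1 else 0)"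
  shows "fract_degree (ext_norm z) + fract_degree (tuple_disc ys) \<ge> 0"
proof -
  define n where "n = ext_degree"
  have len: "length ys = n" by (simp add: integral_basis_length n_def)
  define C where "C = trace_mat ys * mult_mat ys z"
  have carr: "trace_mat ys \<in> carrier_mat n n" "mult_mat ys z \<in> carrier_mat n n"
    using trace_mat_carrier mult_mat_carrier[of ys z] len by (simp_all add: n_def)
  then have C: "C \<in> carrier_mat n n" by (simp add: C_def)
  have "det C \<in> range to_fract"
  proof (rule det_in_subring[OF is_subring_polys C])
    fix j l assume jl: "j < n" "l < n"
    have "C $$ (j, l) = (\<Sum>m<n. coord ys (z * ys ! l) m * ext_trace (ys ! m * ys ! j))"
      using jl carr by (simp add: C_def scalar_prod_def atLeast0LessThan)
        (simp add: trace_mat_def mult_mat_index len mult.commute)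
    also have "\<dots> = ext_trace (lin_comb ys (coord ys (z * ys ! l)) * ys ! j)"
      by (simp add: ext_trace_lin_comb len)
    also have "lin_comb ys (coord ys (z * ys ! l)) * ys ! j = lin_comb ys (coord ys (ys ! j * ys ! l)) * z"
      by (simp add: lin_comb_coord[OF integral_basis_basis] mult_ac)
    also have "ext_trace \<dots> = (\<Sum>m<n. coord ys (ys ! j * ys ! l) m * (if m = i then 1 else 0))"
      by (simp add: ext_trace_lin_comb len dual n_def)
    also have "\<dots> = coord ys (ys ! j * ys ! l) i"
      using i by (simp add: n_def if_distrib cong: if_cong)
    also have "\<dots> \<in> range to_fract"
      using jl i by (intro coord_integral ring_of_integers_mult integral_basis_nth) (simp_all add: n_def)
    finally show "C $$ (j, l) \<in> range to_fract" .
  qed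
  moreover have det_C: "det C = tuple_disc ys * ext_norm z"
    unfolding C_def by (simp add: det_mult[OF carr] tuple_disc_trace_mat ext_norm_eq_det[OF integral_basis_basis])
  ultimately obtain p where p: "tuple_disc ys * ext_norm z = to_fract p" by auto
  have nz: "tuple_disc ys \<noteq> 0" "ext_norm z \<noteq> 0" using tuple_disc_nonzero ext_norm_nonzero[OF z] by auto
  then have "p \<noteq> 0" using p by auto
  then have "fract_degree (tuple_disc ys * ext_norm z) \<ge> 0" by (simp add: p)
  then show ?thesis using nz by (simp add: fract_degree_mult)
qed

end

section \<open>Approximation by integers\<close>

lemma ex_reduced_integral_basis:
  assumes "g \<noteq> 0"
  shows "\<exists>ys a. integral_basis ys \<and>
    (\<forall>q. lin_comb ys q / g \<in> inf_integers \<longleftrightarrow> (\<forall>i<ext_degree. deg_le (q i) (- a i)))"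
proof -
  obtain ys a where *: "basis_list ys"
    "\<forall>q. lin_comb ys q \<in> bounded_integers \<longleftrightarrow> (\<forall>i<length ys. q i \<in> range to_fract)"
    "\<forall>q. lin_comb ys q / g \<in> inf_integers \<longleftrightarrow> (\<forall>i<length ys. deg_le (q i) (- a i))"
    using ex_reduced_basis_bounded_integers[OF assms] by blast
  then have "integral_basis ys" by (simp add: integral_basis_def ring_of_integers_eq)
  with * show ?thesis using length_basis_list[OF *(1)] by auto
qed

lemma ex_close_integer:
  "\<exists>y\<in>ring_of_integers. deg_le (ext_norm (x - y)) (int (ideal_degree disc_ideal) - int ext_degree)"
proof -
  define D where "D = int (ideal_degree disc_ideal)"
  obtain g where g: "g \<noteq> 0" "fract_degree (ext_norm g) = D - int ext_degree"
    using ex_norm_degree by blast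
  have Ng: "ext_norm g \<noteq> 0" using ext_norm_nonzero[OF g(1)] .
  obtain ys a where ys: "integral_basis ys"
    and unit_ball: "\<And>q. lin_comb ys q / g \<in> inf_integers \<longleftrightarrow> (\<forall>i<ext_degree. deg_le (q i) (- a i))"
    using ex_reduced_integral_basis[OF g(1)] by blast
  note basis = integral_basis_basis[OF ys] and len = integral_basis_length[OF ys]
  have D: "fract_degree (tuple_disc ys) = D"
    using disc_ideal_degree[OF ys] tuple_disc_nonzero[OF ys] by (auto simp: D_def)
  \<comment> \<open>If \<open>a i\<close> were at least 2, the \<open>i\<close>-th coordinate would
    have degree at most -2 on \<open>g R\<close>. The dual element \<open>z\<close> reads off this
    coordinate by the trace, so even after multiplication by \<open>T\<close> the traces have degree
    at most -1.\<close>
  have small: "a i \<le> 1" if i: "i < ext_degree" for i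
  proof (rule ccontr)
    assume a: "\<not> a i \<le> 1"
    obtain z where z: "z \<noteq> 0" "\<And>j. j < ext_degree \<Longrightarrow> ext_trace (ys ! j * z) = (if j = i then 1 else 0)"
      using ex_dual_element[OF ys i] by blast
    have Nz: "ext_norm z \<noteq> 0" using ext_norm_nonzero[OF z(1)] .
    define u where "u = emb fract_T * (z * g)"
    have "deg_le (ext_norm u) (- 1)"
    proof (rule norm_neg_if_trace_small)
      show "u \<noteq> 0" using z g by (simp add: u_def)
      fix r assume r: "r \<in> inf_integers"
      define q where "q = coord ys (g * r)"
      have gr: "lin_comb ys q = g * r" by (simp add: q_def lin_comb_coord[OF basis])
      then have "lin_comb ys q / g \<in> inf_integers" using r g by simp
      then have q: "deg_le (q i) (- a i)" using unit_ball i by blast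
      have "u * r = emb fract_T * (lin_comb ys q * z)" by (simp add: u_def gr mult_ac)
      then have "ext_trace (u * r) = fract_T * (\<Sum>j<ext_degree. q j * (if j = i then 1 else 0))"
        by (simp add: ext_trace_scale ext_trace_lin_comb len z(2))
      also have "\<dots> = fract_T powi 1 * q i" using i by (simp add: if_distrib cong: if_cong)
      finally show "deg_le (ext_trace (u * r)) (- 1)"
        using deg_le_mono[OF q, of "- 2"] a by (simp only: deg_le_T_powi_mult_iff) simp
    qed
    \<comment> \<open>The norm of \<open>T\<close> contributes \<open>n\<close>, which cancels the
      \<open>- n\<close> in the degree of \<open>ext_norm g\<close>; what remains says that the
      degree of \<open>ext_norm z\<close> is below \<open>- D\<close>.\<close>
    then have "int ext_degree + fract_degree (ext_norm z) + fract_degree (ext_norm g) \<le> - 1"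
      using Nz Ng by (simp add: u_def ext_norm_mult ext_norm_emb deg_le_def fract_degree_mult fract_degree_power)
    with norm_dual_element[OF ys i z] g(2) D show False by simp
  qed
  define q where "q = coord ys x"
  have "\<forall>i. \<exists>p. deg_le (q i - to_fract p) (- 1)"
    using ex_poly_part by blast
  then obtain p where p: "\<And>i. deg_le (q i - to_fract (p i)) (- 1)"
    by metis
  define y where "y = lin_comb ys (\<lambda>i. to_fract (p i))"
  have y: "y \<in> ring_of_integers" unfolding y_def by (intro lin_comb_integral[OF ys]) blast
  have "x - y = lin_comb ys (\<lambda>i. q i - to_fract (p i))"
    by (simp add: lin_comb_diff y_def q_def lin_comb_coord[OF basis])
  \<comment> \<open>Rounding leaves degree at most -1, and \<open>- a i\<close> is at least
    -1.\<close>
  moreover have "\<forall>i<ext_degree. deg_le (q i - to_fract (p i)) (- a i)"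
    using deg_le_mono[OF p] small by auto
  ultimately have "(x - y) / g \<in> inf_integers" using unit_ball by simp
  then have "deg_le (ext_norm ((x - y) / g)) 0" by (rule norm_inf_integers)
  then have "deg_le (ext_norm ((x - y) / g) * ext_norm g) (0 + fract_degree (ext_norm g))"
    by (rule deg_le_mult) (simp add: deg_le_def)
  then have "deg_le (ext_norm (x - y)) (D - int ext_degree)"
    using g by (simp flip: ext_norm_mult)
  with y show ?thesis unfolding D_def by blast
qed

lemma euclidean_minimum_le:
  "euclidean_minimum \<le> ereal (real (ideal_degree disc_ideal) - real ext_degree)"
  unfolding euclidean_minimum_def
proof (rule SUP_least)
  fix x
  obtain y where y: "y \<in> ring_of_integers"
    "deg_le (ext_norm (x - y)) (int (ideal_degree disc_ideal) - int ext_degree)"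
    using ex_close_integer by blast
  have "deg_infinity (ext_norm (x - y)) \<le> ereal (real (ideal_degree disc_ideal) - real ext_degree)"
  proof (cases "ext_norm (x - y) = 0")
    case False
    with y(2) have "fract_degree (ext_norm (x - y)) \<le> int (ideal_degree disc_ideal) - int ext_degree"
      by (simp add: deg_le_def)
    then have "real_of_int (fract_degree (ext_norm (x - y))) \<le> real_of_int (int (ideal_degree disc_ideal) - int ext_degree)"
      by (simp only: of_int_le_iff)
    with False show ?thesis by (simp add: deg_infinity_def)
  qed (simp add: deg_infinity_def)
  with y(1) show "(INF y\<in>ring_of_integers. deg_infinity (ext_norm (x - y)))
      \<le> ereal (real (ideal_degree disc_ideal) - real ext_degree)"
    by (rule INF_lower2)
qed

end

theorem theorem8:
  fixes emb :: "'k::alg_closed_field poly fract \<Rightarrow> 'l::field" and n :: nat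
  assumes "function_field emb"
    and "field_extension.finite_extension emb"
    and "field_extension.separable_extension emb"
    and "field_extension.ext_degree emb = n"
    and "function_field.tame_above_infinity emb"
  shows "function_field.euclidean_minimum emb
           \<le> ereal (real (ideal_degree (function_field.disc_ideal emb)) - real n)"
proof -
  interpret function_field emb by (rule assms(1))
  interpret tame_function_field emb
    by unfold_locales (rule assms(2), rule assms(5))
  show ?thesis using euclidean_minimum_le by (simp add: assms(4))
qed

end
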